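(* Let $\nabla$ be a $\Gamma$-linear connection on $E=J^1(T,M)$. If $X=X^\alpha\frac{\delta}{\delta t^\alpha}+X^i\frac{\delta}{\delta x^i}+X^{(i)}_{(\alpha)}\frac{\partial}{\partial x^i_\alpha}$ is an arbitrary vector field on $E$, then the following Ricci identities hold. $(h_T)$: $$X^\alpha_{/\beta/\gamma}-X^\alpha_{/\gamma/\beta}=X^\mu\bar R^\alpha_{\mu\beta\gamma}-X^\alpha_{/\mu}\bar T^\mu_{\beta\gamma}-X^\alpha|^{(\mu)}_{(m)}R^{(m)}_{(\mu)\beta\gamma},$$ $$X^\alpha_{/\beta|k}-X^\alpha_{|k/\beta}=X^\mu\bar R^\alpha_{\mu\beta k}-X^\alpha_{/\mu}\bar T^\mu_{\beta k}-X^\alpha_{|m}T^m_{\beta k}-X^\alpha|^{(\mu)}_{(m)}R^{(m)}_{(\mu)\beta k},$$ $$X^\alpha_{|j|k}-X^\alpha_{|k|j}=X^\mu\bar R^\alpha_{\mu jk}-X^\alpha_{|m}T^m_{jk}-X^\alpha|^{(\mu)}_{(m)}R^{(m)}_{(\mu)jk},$$ $$X^\alpha_{/\beta}|^{(\gamma)}_{(k)}-X^\alpha|^{(\gamma)}_{(k)/\beta}=X^\mu\bar P^{\alpha\;\;(\gamma)}_{\mu\beta(k)}-X^\alpha_{/\mu}\bar C^{\mu(\gamma)}_{\beta(k)}-X^\alpha|^{(\mu)}_{(m)}P^{(m)\;(\gamma)}_{(\mu)\beta(k)},$$ $$X^\alpha_{|j}|^{(\gamma)}_{(k)}-X^\alpha|^{(\gamma)}_{(k)|j}=X^\mu\bar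 P^{\alpha\;\;(\gamma)}_{\mu j(k)}-X^\alpha_{|m}C^{m(\gamma)}_{j(k)}-X^\alpha|^{(\mu)}_{(m)}P^{(m)\;(\gamma)}_{(\mu)j(k)},$$ $$X^\alpha|^{(\beta)}_{(j)}|^{(\gamma)}_{(k)}-X^\alpha|^{(\gamma)}_{(k)}|^{(\beta)}_{(j)}=X^\mu\bar S^{\alpha(\beta)(\gamma)}_{\mu(j)(k)}-X^\alpha|^{(\mu)}_{(m)}S^{(m)(\beta)(\gamma)}_{(\mu)(j)(k)};$$ $(h_M)$: $$X^i_{/\beta/\gamma}-X^i_{/\gamma/\beta}=X^mR^i_{m\beta\gamma}-X^i_{/\mu}\bar T^\mu_{\beta\gamma}-X^i|^{(\mu)}_{(m)}R^{(m)}_{(\mu)\beta\gamma},$$ $$X^i_{/\beta|k}-X^i_{|k/\beta}=X^mR^i_{m\beta k}-X^i_{/\mu}\bar T^\mu_{\beta k}-X^i_{|m}T^m_{\beta k}-X^i|^{(\mu)}_{(m)}R^{(m)}_{(\mu)\beta k},$$ $$X^i_{|j|k}-X^i_{|k|j}=X^mR^i_{mjk}-X^i_{|m}T^m_{jk}-X^i|^{(\mu)}_{(m)}R^{(m)}_{(\mu)jk},$$ $$X^i_{/\beta}|^{(\gamma)}_{(k)}-X^i|^{(\gamma)}_{(k)/\beta}=X^mP^{i\;\;(\gamma)}_{m\beta(k)}-X^i_{/\mu}\bar C^{\mu(\gamma)}_{\beta(k)}-X^i|^{(\mu)}_{(m)}P^{(m)\;(\gamma)}_{(\mu)\beta(k)},$$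 $$X^i_{|j}|^{(\gamma)}_{(k)}-X^i|^{(\gamma)}_{(k)|j}=X^mP^{i\;\;(\gamma)}_{mj(k)}-X^i_{|m}C^{m(\gamma)}_{j(k)}-X^i|^{(\mu)}_{(m)}P^{(m)\;(\gamma)}_{(\mu)j(k)},$$ $$X^i|^{(\beta)}_{(j)}|^{(\gamma)}_{(k)}-X^i|^{(\gamma)}_{(k)}|^{(\beta)}_{(j)}=X^mS^{i(\beta)(\gamma)}_{m(j)(k)}-X^i|^{(\mu)}_{(m)}S^{(m)(\beta)(\gamma)}_{(\mu)(j)(k)};$$ $(v)$: $$X^{(i)}_{(\alpha)/\beta/\gamma}-X^{(i)}_{(\alpha)/\gamma/\beta}=X^{(m)}_{(\mu)}R^{(i)(\mu)}_{(\alpha)(m)\beta\gamma}-X^{(i)}_{(\alpha)/\mu}\bar T^\mu_{\beta\gamma}-X^{(i)}_{(\alpha)}|^{(\mu)}_{(m)}R^{(m)}_{(\mu)\beta\gamma},$$ $$X^{(i)}_{(\alpha)/\beta|k}-X^{(i)}_{(\alpha)|k/\beta}=X^{(m)}_{(\mu)}R^{(i)(\mu)}_{(\alpha)(m)\beta k}-X^{(i)}_{(\alpha)/\mu}\bar T^\mu_{\beta k}-X^{(i)}_{(\alpha)|m}T^m_{\beta k}-X^{(i)}_{(\alpha)}|^{(\mu)}_{(m)}R^{(m)}_{(\mu)\beta k},$$ $$X^{(i)}_{(\alpha)|j|k}-X^{(i)}_{(\alpha)|k|j}=X^{(m)}_{(\mu)}R^{(i)(\mu)}_{(\alpha)(m)jk}-X^{(i)}_{(\alpha)|m}T^m_{jk}-X^{(i)}_{(\alpha)}|^{(\mu)}_{(m)}R^{(m)}_{(\mu)jk},$$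 $$X^{(i)}_{(\alpha)/\beta}|^{(\gamma)}_{(k)}-X^{(i)}_{(\alpha)}|^{(\gamma)}_{(k)/\beta}=X^{(m)}_{(\mu)}P^{(i)(\mu)\;(\gamma)}_{(\alpha)(m)\beta(k)}-X^{(i)}_{(\alpha)/\mu}\bar C^{\mu(\gamma)}_{\beta(k)}-X^{(i)}_{(\alpha)}|^{(\mu)}_{(m)}P^{(m)\;(\gamma)}_{(\mu)\beta(k)},$$ $$X^{(i)}_{(\alpha)|j}|^{(\gamma)}_{(k)}-X^{(i)}_{(\alpha)}|^{(\gamma)}_{(k)|j}=X^{(m)}_{(\mu)}P^{(i)(\mu)\;(\gamma)}_{(\alpha)(m)j(k)}-X^{(i)}_{(\alpha)|m}C^{m(\gamma)}_{j(k)}-X^{(i)}_{(\alpha)}|^{(\mu)}_{(m)}P^{(m)\;(\gamma)}_{(\mu)j(k)},$$ $$X^{(i)}_{(\alpha)}|^{(\beta)}_{(j)}|^{(\gamma)}_{(k)}-X^{(i)}_{(\alpha)}|^{(\gamma)}_{(k)}|^{(\beta)}_{(j)}=X^{(m)}_{(\mu)}S^{(i)(\mu)(\beta)(\gamma)}_{(\alpha)(m)(j)(k)}-X^{(i)}_{(\alpha)}|^{(\mu)}_{(m)}S^{(m)(\beta)(\gamma)}_{(\mu)(j)(k)}.$$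
   Context: $T$ and $M$ are smooth manifolds of dimensions $p$ and $n$, with local coordinates $(t^\alpha)$ and $(x^i)$; Greek indices run from $1$ to $p$, Latin indices from $1$ to $n$, and repeated indices are summed. $E=J^1(T,M)\to T\times M$ is the first-order jet bundle, with coordinates $(t^\alpha,x^i,x^i_\alpha)$; coordinate changes have the form $\tilde t^\alpha=\tilde t^\alpha(t)$, $\tilde x^i=\tilde x^i(x)$, $\tilde x^j_\beta=\frac{\partial\tilde x^j}{\partial x^i}\frac{\partial t^\alpha}{\partial\tilde t^\beta}x^i_\alpha$. $\mathcal X(E)$ denotes the vector fields on $E$. A fixed nonlinear connection $\Gamma$ on $E$ is given by local functions $M^{(i)}_{(\alpha)\beta},N^{(i)}_{(\alpha)j}$ on $E$ with transformation rules $$\tilde M^{(j)}_{(\beta)\mu}\frac{\partial\tilde t^\mu}{\partial t^\alpha}=M^{(k)}_{(\gamma)\alpha}\frac{\partial\tilde x^j}{\partial x^k}\frac{\partial t^\gamma}{\partial\tilde t^\beta}-\frac{\partial\tilde x^j_\beta}{\partial t^\alpha},\qquad \tilde N^{(j)}_{(\beta)k}\frac{\partial\tilde x^k}{\partial x^i}=N^{(k)}_{(\gamma)i}\frac{\partial\tilde x^j}{\partial x^k}\frac{\partial t^\gamma}{\partial\tilde t^\beta}-\frac{\partial\tilde x^j_\beta}{\partial x^i}.$$ Adapted bases: $\frac{\delta}{\delta t^\alpha}=\frac{\partial}{\partial t^\alpha}-M^{(j)}_{(\beta)\alpha}\frac{\partial}{\partial x^j_\beta}$, $\frac{\delta}{\delta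 x^i}=\frac{\partial}{\partial x^i}-N^{(j)}_{(\beta)i}\frac{\partial}{\partial x^j_\beta}$, $\frac{\partial}{\partial x^i_\alpha}$, with dual basis $dt^\alpha$, $dx^i$, $\delta x^i_\alpha=dx^i_\alpha+M^{(i)}_{(\alpha)\beta}dt^\beta+N^{(i)}_{(\alpha)j}dx^j$. $h_T,h_M,v$ are the projections onto the three distributions spanned by $\frac{\delta}{\delta t^\alpha}$, by $\frac{\delta}{\delta x^i}$, by $\frac{\partial}{\partial x^i_\alpha}$. A $\Gamma$-linear connection is a linear connection $\nabla:\mathcal X(E)\times\mathcal X(E)\to\mathcal X(E)$ with $\nabla h_T=0$, $\nabla h_M=0$, $\nabla v=0$. Its nine local components are defined by $$\nabla_{\frac{\delta}{\delta t^\gamma}}\frac{\delta}{\delta t^\beta}=\bar G^\alpha_{\beta\gamma}\frac{\delta}{\delta t^\alpha},\quad \nabla_{\frac{\delta}{\delta t^\gamma}}\frac{\delta}{\delta x^i}=G^k_{i\gamma}\frac{\delta}{\delta x^k},\quad \nabla_{\frac{\delta}{\delta t^\gamma}}\frac{\partial}{\partial x^i_\beta}=G^{(k)(\beta)}_{(\alpha)(i)\gamma}\frac{\partial}{\partial x^k_\alpha},$$ $$\nabla_{\frac{\delta}{\delta x^j}}\frac{\delta}{\delta t^\beta}=\bar L^\alpha_{\beta j}\frac{\delta}{\delta t^\alpha},\quad \nabla_{\frac{\delta}{\delta x^j}}\frac{\delta}{\delta x^i}=L^k_{ij}\frac{\delta}{\delta x^k},\quad \nabla_{\frac{\delta}{\delta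 x^j}}\frac{\partial}{\partial x^i_\beta}=L^{(k)(\beta)}_{(\alpha)(i)j}\frac{\partial}{\partial x^k_\alpha},$$ $$\nabla_{\frac{\partial}{\partial x^j_\gamma}}\frac{\delta}{\delta t^\beta}=\bar C^{\alpha(\gamma)}_{\beta(j)}\frac{\delta}{\delta t^\alpha},\quad \nabla_{\frac{\partial}{\partial x^j_\gamma}}\frac{\delta}{\delta x^i}=C^{k(\gamma)}_{i(j)}\frac{\delta}{\delta x^k},\quad \nabla_{\frac{\partial}{\partial x^j_\gamma}}\frac{\partial}{\partial x^i_\beta}=C^{(k)(\beta)(\gamma)}_{(\alpha)(i)(j)}\frac{\partial}{\partial x^k_\alpha}.$$ Covariant derivatives. For a d-tensor field $D=D^{\alpha i(j)(\delta)\ldots}_{\gamma k(\beta)(l)\ldots}\frac{\delta}{\delta t^\alpha}\otimes\frac{\delta}{\delta x^i}\otimes\frac{\partial}{\partial x^j_\beta}\otimes dt^\gamma\otimes dx^k\otimes\delta x^l_\delta\ldots$, the $T$-horizontal covariant derivative is $$D^{\alpha i(j)(\delta)\ldots}_{\gamma k(\beta)(l)\ldots/\varepsilon}=\frac{\delta D^{\alpha i(j)(\delta)\ldots}_{\gamma k(\beta)(l)\ldots}}{\delta t^\varepsilon}+D^{\mu i(j)(\delta)\ldots}_{\gamma k(\beta)(l)\ldots}\bar G^\alpha_{\mu\varepsilon}+D^{\alpha m(j)(\delta)\ldots}_{\gamma k(\beta)(l)\ldots}G^i_{m\varepsilon}+D^{\alpha i(m)(\delta)\ldots}_{\gamma k(\mu)(l)\ldots}G^{(j)(\mu)}_{(\beta)(m)\varepsilon}+\ldots$$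 $$-D^{\alpha i(j)(\delta)\ldots}_{\mu k(\beta)(l)\ldots}\bar G^\mu_{\gamma\varepsilon}-D^{\alpha i(j)(\delta)\ldots}_{\gamma m(\beta)(l)\ldots}G^m_{k\varepsilon}-D^{\alpha i(j)(\mu)\ldots}_{\gamma k(\beta)(m)\ldots}G^{(m)(\delta)}_{(\mu)(l)\varepsilon}-\ldots;$$ the $M$-horizontal covariant derivative $D^{\ldots}_{\ldots|p}$ is given by the same formula with $\frac{\delta}{\delta t^\varepsilon}$, $\bar G^\alpha_{\mu\varepsilon}$, $G^i_{m\varepsilon}$, $G^{(j)(\mu)}_{(\beta)(m)\varepsilon}$ replaced by $\frac{\delta}{\delta x^p}$, $\bar L^\alpha_{\mu p}$, $L^i_{mp}$, $L^{(j)(\mu)}_{(\beta)(m)p}$; the vertical covariant derivative $D^{\ldots}_{\ldots}|^{(\varepsilon)}_{(p)}$ by the same formula with them replaced by $\frac{\partial}{\partial x^p_\varepsilon}$, $\bar C^{\alpha(\varepsilon)}_{\mu(p)}$, $C^{i(\varepsilon)}_{m(p)}$, $C^{(j)(\mu)(\varepsilon)}_{(\beta)(m)(p)}$ (and correspondingly for the subtracted terms). The families $X^\alpha$, $X^i$, $X^{(i)}_{(\alpha)}$ are treated as separate d-tensors; in an iterated covariant derivative, the indices created by the first derivative are d-tensor indices: $\beta$ in ${}_{/\beta}$ a $dt^\beta$-index, $j$ in ${}_{|j}$ a $dx^j$-index, ${}^{(\gamma)}_{(k)}$ in $|^{(\gamma)}_{(k)}$ a $\delta x^k_\gamma$-index.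 Torsion components: $$R^{(m)}_{(\mu)\alpha\beta}=\frac{\delta M^{(m)}_{(\mu)\alpha}}{\delta t^\beta}-\frac{\delta M^{(m)}_{(\mu)\beta}}{\delta t^\alpha},\quad R^{(m)}_{(\mu)\alpha j}=\frac{\delta M^{(m)}_{(\mu)\alpha}}{\delta x^j}-\frac{\delta N^{(m)}_{(\mu)j}}{\delta t^\alpha},\quad R^{(m)}_{(\mu)ij}=\frac{\delta N^{(m)}_{(\mu)i}}{\delta x^j}-\frac{\delta N^{(m)}_{(\mu)j}}{\delta x^i},$$ $$\bar T^\mu_{\alpha\beta}=\bar G^\mu_{\alpha\beta}-\bar G^\mu_{\beta\alpha},\quad \bar T^\mu_{\alpha j}=\bar L^\mu_{\alpha j},\quad T^m_{\alpha j}=-G^m_{j\alpha},\quad T^m_{ij}=L^m_{ij}-L^m_{ji},$$ $$S^{(m)(\alpha)(\beta)}_{(\mu)(i)(j)}=C^{(m)(\alpha)(\beta)}_{(\mu)(i)(j)}-C^{(m)(\beta)(\alpha)}_{(\mu)(j)(i)},\quad P^{(m)\;(\beta)}_{(\mu)\alpha(j)}=\frac{\partial M^{(m)}_{(\mu)\alpha}}{\partial x^j_\beta}-G^{(m)(\beta)}_{(\mu)(j)\alpha},\quad P^{(m)\;(\beta)}_{(\mu)i(j)}=\frac{\partial N^{(m)}_{(\mu)i}}{\partial x^j_\beta}-L^{(m)(\beta)}_{(\mu)(j)i}.$$ Curvature components: with $\mathbf R(X,Y)Z=\nabla_X\nabla_YZ-\nabla_Y\nabla_XZ-\nabla_{[X,Y]}Z$,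 they are defined by $$\mathbf R\Big(\frac{\delta}{\delta t^\gamma},\frac{\delta}{\delta t^\beta}\Big)\frac{\delta}{\delta t^\alpha}=\bar R^\delta_{\alpha\beta\gamma}\frac{\delta}{\delta t^\delta},\ \ \mathbf R\Big(\frac{\delta}{\delta t^\gamma},\frac{\delta}{\delta t^\beta}\Big)\frac{\delta}{\delta x^i}=R^l_{i\beta\gamma}\frac{\delta}{\delta x^l},\ \ \mathbf R\Big(\frac{\delta}{\delta t^\gamma},\frac{\delta}{\delta t^\beta}\Big)\frac{\partial}{\partial x^i_\alpha}=R^{(l)(\alpha)}_{(\delta)(i)\beta\gamma}\frac{\partial}{\partial x^l_\delta},$$ $$\mathbf R\Big(\frac{\delta}{\delta x^k},\frac{\delta}{\delta t^\beta}\Big)\frac{\delta}{\delta t^\alpha}=\bar R^\delta_{\alpha\beta k}\frac{\delta}{\delta t^\delta},\ \ \mathbf R\Big(\frac{\delta}{\delta x^k},\frac{\delta}{\delta t^\beta}\Big)\frac{\delta}{\delta x^i}=R^l_{i\beta k}\frac{\delta}{\delta x^l},\ \ \mathbf R\Big(\frac{\delta}{\delta x^k},\frac{\delta}{\delta t^\beta}\Big)\frac{\partial}{\partial x^i_\alpha}=R^{(l)(\alpha)}_{(\delta)(i)\beta k}\frac{\partial}{\partial x^l_\delta},$$ $$\mathbf R\Big(\frac{\delta}{\delta x^k},\frac{\delta}{\delta x^j}\Big)\frac{\delta}{\delta t^\alpha}=\bar R^\delta_{\alpha jk}\frac{\delta}{\delta t^\delta},\ \ \mathbf R\Big(\frac{\delta}{\delta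 x^k},\frac{\delta}{\delta x^j}\Big)\frac{\delta}{\delta x^i}=R^l_{ijk}\frac{\delta}{\delta x^l},\ \ \mathbf R\Big(\frac{\delta}{\delta x^k},\frac{\delta}{\delta x^j}\Big)\frac{\partial}{\partial x^i_\alpha}=R^{(l)(\alpha)}_{(\delta)(i)jk}\frac{\partial}{\partial x^l_\delta},$$ $$\mathbf R\Big(\frac{\partial}{\partial x^k_\gamma},\frac{\delta}{\delta t^\beta}\Big)\frac{\delta}{\delta t^\alpha}=\bar P^{\delta\;\;(\gamma)}_{\alpha\beta(k)}\frac{\delta}{\delta t^\delta},\ \ \mathbf R\Big(\frac{\partial}{\partial x^k_\gamma},\frac{\delta}{\delta t^\beta}\Big)\frac{\delta}{\delta x^i}=P^{l\;\;(\gamma)}_{i\beta(k)}\frac{\delta}{\delta x^l},\ \ \mathbf R\Big(\frac{\partial}{\partial x^k_\gamma},\frac{\delta}{\delta t^\beta}\Big)\frac{\partial}{\partial x^i_\alpha}=P^{(l)(\alpha)\;(\gamma)}_{(\delta)(i)\beta(k)}\frac{\partial}{\partial x^l_\delta},$$ $$\mathbf R\Big(\frac{\partial}{\partial x^k_\gamma},\frac{\delta}{\delta x^j}\Big)\frac{\delta}{\delta t^\alpha}=\bar P^{\delta\;\;(\gamma)}_{\alpha j(k)}\frac{\delta}{\delta t^\delta},\ \ \mathbf R\Big(\frac{\partial}{\partial x^k_\gamma},\frac{\delta}{\delta x^j}\Big)\frac{\delta}{\delta x^i}=P^{l\;\;(\gamma)}_{ij(k)}\frac{\delta}{\delta x^l},\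 \ \mathbf R\Big(\frac{\partial}{\partial x^k_\gamma},\frac{\delta}{\delta x^j}\Big)\frac{\partial}{\partial x^i_\alpha}=P^{(l)(\alpha)\;(\gamma)}_{(\delta)(i)j(k)}\frac{\partial}{\partial x^l_\delta},$$ $$\mathbf R\Big(\frac{\partial}{\partial x^k_\gamma},\frac{\partial}{\partial x^j_\beta}\Big)\frac{\delta}{\delta t^\alpha}=\bar S^{\delta(\beta)(\gamma)}_{\alpha(j)(k)}\frac{\delta}{\delta t^\delta},\ \ \mathbf R\Big(\frac{\partial}{\partial x^k_\gamma},\frac{\partial}{\partial x^j_\beta}\Big)\frac{\delta}{\delta x^i}=S^{l(\beta)(\gamma)}_{i(j)(k)}\frac{\delta}{\delta x^l},\ \ \mathbf R\Big(\frac{\partial}{\partial x^k_\gamma},\frac{\partial}{\partial x^j_\beta}\Big)\frac{\partial}{\partial x^i_\alpha}=S^{(l)(\alpha)(\beta)(\gamma)}_{(\delta)(i)(j)(k)}\frac{\partial}{\partial x^l_\delta}.$$ *)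

theory Defs
  imports "HOL-Analysis.Analysis"
begin

section \<open>Smooth maps and smooth manifolds\<close>

text \<open>
  \<open>pd f v z\<close> is the derivative of \<open>f\<close> at \<open>z\<close> in the direction \<open>v\<close>; for a
  coordinate vector \<open>v\<close> it is a partial derivative.  A map is smooth on an open set if its
  iterated partial derivatives of every order exist and are differentiable.
\<close>

definition pd :: "('a::real_normed_vector \<Rightarrow> 'b::real_normed_vector) \<Rightarrow> 'a \<Rightarrow> 'a \<Rightarrow> 'b" where
  "pd f v z = frechet_derivative f (at z) v"

primrec Ck_on :: "nat \<Rightarrow> 'a::euclidean_space set \<Rightarrow> ('a \<Rightarrow> 'b::real_normed_vector) \<Rightarrow> bool" where
  "Ck_on 0 S f \<longleftrightarrow> continuous_on S f"
| "Ck_on (Suc k) S f \<longleftrightarrow>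
     (\<forall>z\<in>S. f differentiable (at z)) \<and> (\<forall>b\<in>Basis. Ck_on k S (pd f b))"

definition smooth_on :: "'a::euclidean_space set \<Rightarrow> ('a \<Rightarrow> 'b::real_normed_vector) \<Rightarrow> bool" where
  "smooth_on S f \<longleftrightarrow> (\<forall>k. Ck_on k S f)"

text \<open>A chart is a pair of its domain and its coordinate map (whose values off the domain are
  irrelevant).\<close>

type_synonym ('a, 'v) chart = "'a set \<times> ('a \<Rightarrow> 'v)"

definition chart_inv :: "('a, 'v) chart \<Rightarrow> 'v \<Rightarrow> 'a" where
  "chart_inv a = inv_into (fst a) (snd a)"

definition smooth_manifold ::
    "'a topology \<Rightarrow> ('a, 'v::euclidean_space) chart set \<Rightarrow> bool" where
  "smooth_manifold X A \<longleftrightarrow>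
     Hausdorff_space X \<and> second_countable X \<and> (\<Union>a\<in>A. fst a) = topspace X \<and>
     (\<forall>a\<in>A. openin X (fst a) \<and> open (snd a ` fst a) \<and>
        homeomorphic_map (subtopology X (fst a)) (top_of_set (snd a ` fst a)) (snd a)) \<and>
     (\<forall>a\<in>A. \<forall>b\<in>A. smooth_on (snd a ` (fst a \<inter> fst b)) (snd b \<circ> chart_inv a))"

section \<open>The first-order jet bundle\<close>

text \<open>
  \<open>T\<close> is modelled on \<open>real^'p\<close> and \<open>M\<close> on \<open>real^'n\<close>.  Germs of maps from \<open>T\<close> to \<open>M\<close> are
  represented by total functions, of which only the values near the source point matter.
\<close>

definition local_rep :: "('t, 'v) chart \<Rightarrow> ('m, 'w) chart \<Rightarrow> ('t \<Rightarrow> 'm) \<Rightarrow> 'v \<Rightarrow> 'w" where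
  "local_rep a b f = snd b \<circ> f \<circ> chart_inv a"

definition smooth_near ::
    "('t, 'v::euclidean_space) chart set \<Rightarrow> ('m, 'w::euclidean_space) chart set
      \<Rightarrow> 't \<Rightarrow> ('t \<Rightarrow> 'm) \<Rightarrow> bool" where
  "smooth_near A B t f \<longleftrightarrow>
     t \<in> (\<Union>a\<in>A. fst a) \<and> f t \<in> (\<Union>b\<in>B. fst b) \<and>
     (\<forall>a\<in>A. \<forall>b\<in>B. t \<in> fst a \<longrightarrow> f t \<in> fst b \<longrightarrow>
        (\<exists>W. open W \<and> snd a t \<in> W \<and> W \<subseteq> snd a ` fst a \<and>
             f ` chart_inv a ` W \<subseteq> fst b \<and> smooth_on W (local_rep a b f)))"

text \<open>The 1-jet of \<open>f\<close> at \<open>t\<close>, as an equivalence class of pairs of a source point and a germ.\<close>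

type_synonym ('t, 'm) jet = "('t \<times> ('t \<Rightarrow> 'm)) set"

definition jet1 ::
    "('t, 'v::euclidean_space) chart set \<Rightarrow> ('m, 'w::euclidean_space) chart set
      \<Rightarrow> 't \<Rightarrow> ('t \<Rightarrow> 'm) \<Rightarrow> ('t, 'm) jet" where
  "jet1 A B t f =
     {(s, g). s = t \<and> smooth_near A B t g \<and> g t = f t \<and>
        (\<forall>a\<in>A. \<forall>b\<in>B. t \<in> fst a \<longrightarrow> f t \<in> fst b \<longrightarrow>
           (\<forall>v. pd (local_rep a b g) v (snd a t) = pd (local_rep a b f) v (snd a t)))}"

definition J1 ::
    "('t, 'v::euclidean_space) chart set \<Rightarrow> ('m, 'w::euclidean_space) chart set
      \<Rightarrow> ('t, 'm) jet set" where
  "J1 A B = {jet1 A B t f | t f. smooth_near A B t f}"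

definition jet_rep :: "('t, 'm) jet \<Rightarrow> 't \<times> ('t \<Rightarrow> 'm)" where
  "jet_rep e = (SOME q. q \<in> e)"

text \<open>
  Values of the coordinates \<open>(t\<^sup>\<alpha>, x\<^sup>i, x\<^sup>i\<^sub>\<alpha>)\<close>; the matrix entry \<open>y $ i $ \<alpha>\<close> is \<open>x\<^sup>i\<^sub>\<alpha>\<close>.  Each pair of
  a chart of \<open>T\<close> and a chart of \<open>M\<close> induces a chart of the jet bundle, and the atlas of the
  jet bundle is the family of these induced charts, indexed by \<open>A \<times> B\<close>.
\<close>

type_synonym ('p, 'n) jc = "(real^'p) \<times> (real^'n) \<times> (real^'p^'n)"

type_synonym ('t, 'm, 'p, 'n) jchart = "('t, real^'p) chart \<times> ('m, real^'n) chart"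

definition jdom ::
    "('t, real^'p) chart set \<Rightarrow> ('m, real^'n) chart set \<Rightarrow> ('t, 'm, 'p::finite, 'n::finite) jchart
      \<Rightarrow> ('t, 'm) jet set" where
  "jdom A B c =
     {e \<in> J1 A B. case jet_rep e of (t, f) \<Rightarrow> t \<in> fst (fst c) \<and> f t \<in> fst (snd c)}"

definition jcoord ::
    "('t, 'm, 'p::finite, 'n::finite) jchart \<Rightarrow> ('t, 'm) jet \<Rightarrow> ('p, 'n) jc" where
  "jcoord c e = (case jet_rep e of (t, f) \<Rightarrow>
     (snd (fst c) t, snd (snd c) (f t),
      \<chi> i \<alpha>. pd (local_rep (fst c) (snd c) f) (axis \<alpha> 1) (snd (fst c) t) $ i))"

definition jimg ::
    "('t, real^'p) chart set \<Rightarrow> ('m, real^'n) chart set \<Rightarrow> ('t, 'm, 'p::finite, 'n::finite) jchart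
      \<Rightarrow> ('p, 'n) jc set" where
  "jimg A B c = jcoord c ` jdom A B c"

definition jinv ::
    "('t, real^'p) chart set \<Rightarrow> ('m, real^'n) chart set \<Rightarrow> ('t, 'm, 'p::finite, 'n::finite) jchart
      \<Rightarrow> ('p, 'n) jc \<Rightarrow> ('t, 'm) jet" where
  "jinv A B c = inv_into (jdom A B c) (jcoord c)"

definition jtrans ::
    "('t, real^'p) chart set \<Rightarrow> ('m, real^'n) chart set
      \<Rightarrow> ('t, 'm, 'p::finite, 'n::finite) jchart \<Rightarrow> ('t, 'm, 'p, 'n) jchart
      \<Rightarrow> ('p, 'n) jc \<Rightarrow> ('p, 'n) jc" where
  "jtrans A B c d = jcoord d \<circ> jinv A B c"

definition ct :: "('p::finite, 'n::finite) jc \<Rightarrow> 'p \<Rightarrow> real" where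
  "ct z \<alpha> = fst z $ \<alpha>"

definition cx :: "('p::finite, 'n::finite) jc \<Rightarrow> 'n \<Rightarrow> real" where
  "cx z i = fst (snd z) $ i"

definition cy :: "('p::finite, 'n::finite) jc \<Rightarrow> 'n \<Rightarrow> 'p \<Rightarrow> real" where
  "cy z i \<alpha> = snd (snd z) $ i $ \<alpha>"

definition et :: "'p \<Rightarrow> ('p::finite, 'n::finite) jc" where
  "et \<alpha> = (axis \<alpha> 1, 0, 0)"

definition ex :: "'n \<Rightarrow> ('p::finite, 'n::finite) jc" where
  "ex i = (0, axis i 1, 0)"

definition ey :: "'n \<Rightarrow> 'p \<Rightarrow> ('p::finite, 'n::finite) jc" where
  "ey i \<alpha> = (0, 0, axis i (axis \<alpha> 1))"

section \<open>Functions and vector fields on the jet bundle\<close>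

definition smooth_functions ::
    "('t, real^'p) chart set \<Rightarrow> ('m, real^'n) chart set \<Rightarrow> (('t, 'm) jet \<Rightarrow> real) set" where
  "smooth_functions A B = {f. \<forall>c\<in>A \<times> B. smooth_on (jimg A B c) (f \<circ> jinv A B c)}"

text \<open>
  A tangent vector at \<open>e\<close> is the family of its component vectors in all induced charts around
  \<open>e\<close>, related by the Jacobians of the coordinate changes.  The family is 0 at all other
  indices (and everywhere if \<open>e\<close> is not a jet), so that equality of vector fields is equality
  of functions.
\<close>

type_synonym ('t, 'm, 'p, 'n) vfield =
  "('t, 'm) jet \<Rightarrow> ('t, 'm, 'p, 'n) jchart \<Rightarrow> ('p, 'n) jc"

definition tangent_space ::
    "('t, real^'p) chart set \<Rightarrow> ('m, real^'n) chart set \<Rightarrow> ('t, 'm) jet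
      \<Rightarrow> (('t, 'm, 'p::finite, 'n::finite) jchart \<Rightarrow> ('p, 'n) jc) set" where
  "tangent_space A B e =
     {v. (\<forall>c\<in>A \<times> B. \<forall>d\<in>A \<times> B. e \<in> jdom A B c \<longrightarrow> e \<in> jdom A B d \<longrightarrow>
            v d = pd (jtrans A B c d) (v c) (jcoord c e)) \<and>
         (\<forall>c. c \<notin> A \<times> B \<or> e \<notin> jdom A B c \<longrightarrow> v c = 0)}"

definition vector_fields ::
    "('t, real^'p) chart set \<Rightarrow> ('m, real^'n) chart set
      \<Rightarrow> ('t, 'm, 'p::finite, 'n::finite) vfield set" where
  "vector_fields A B =
     {Y. (\<forall>e. Y e \<in> tangent_space A B e) \<and>
         (\<forall>c\<in>A \<times> B. smooth_on (jimg A B c) (\<lambda>z. Y (jinv A B c z) c))}"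

definition vf_local ::
    "('t, real^'p) chart set \<Rightarrow> ('m, real^'n) chart set \<Rightarrow> ('t, 'm, 'p::finite, 'n::finite) jchart
      \<Rightarrow> ('t, 'm, 'p, 'n) vfield \<Rightarrow> ('p, 'n) jc \<Rightarrow> ('p, 'n) jc" where
  "vf_local A B c Y z = Y (jinv A B c z) c"

section \<open>Linear connections\<close>

definition linear_connection ::
    "('t, real^'p) chart set \<Rightarrow> ('m, real^'n) chart set
      \<Rightarrow> (('t, 'm, 'p::finite, 'n::finite) vfield \<Rightarrow> ('t, 'm, 'p, 'n) vfield \<Rightarrow> ('t, 'm, 'p, 'n) vfield)
      \<Rightarrow> bool" where
  "linear_connection A B nabla \<longleftrightarrow>
     (\<forall>Y\<in>vector_fields A B. \<forall>Z\<in>vector_fields A B. nabla Y Z \<in> vector_fields A B) \<and>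
     (\<forall>Y\<in>vector_fields A B. \<forall>Y'\<in>vector_fields A B. \<forall>Z\<in>vector_fields A B.
        nabla (\<lambda>e c. Y e c + Y' e c) Z = (\<lambda>e c. nabla Y Z e c + nabla Y' Z e c)) \<and>
     (\<forall>f\<in>smooth_functions A B. \<forall>Y\<in>vector_fields A B. \<forall>Z\<in>vector_fields A B.
        nabla (\<lambda>e c. f e *\<^sub>R Y e c) Z = (\<lambda>e c. f e *\<^sub>R nabla Y Z e c)) \<and>
     (\<forall>Y\<in>vector_fields A B. \<forall>Z\<in>vector_fields A B. \<forall>Z'\<in>vector_fields A B.
        nabla Y (\<lambda>e c. Z e c + Z' e c) = (\<lambda>e c. nabla Y Z e c + nabla Y Z' e c)) \<and>
     (\<forall>f\<in>smooth_functions A B. \<forall>Y\<in>vector_fields A B. \<forall>Z\<in>vector_fields A B.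
        \<forall>c\<in>A \<times> B. \<forall>e\<in>jdom A B c.
          nabla Y (\<lambda>e c. f e *\<^sub>R Z e c) e c =
            pd (f \<circ> jinv A B c) (Y e c) (jcoord c e) *\<^sub>R Z e c + f e *\<^sub>R nabla Y Z e c)"

text \<open>
  The localization of a connection to the coordinate domain of an induced chart \<open>c\<close>: it acts
  on local fields, given by their component functions in \<open>c\<close>.  Its value at \<open>w\<close> is computed
  with globally defined fields that have the prescribed germs at \<open>w\<close>; such fields exist for
  smooth local fields, and the value does not depend on their choice.
\<close>

definition globalize ::
    "('t, real^'p) chart set \<Rightarrow> ('m, real^'n) chart set \<Rightarrow> ('t, 'm, 'p::finite, 'n::finite) jchart
      \<Rightarrow> (('p, 'n) jc \<Rightarrow> ('p, 'n) jc) \<Rightarrow> ('p, 'n) jc \<Rightarrow> ('t, 'm, 'p, 'n) vfield" where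
  "globalize A B c y w =
     (SOME Y. Y \<in> vector_fields A B \<and>
        (\<exists>W. open W \<and> w \<in> W \<and> W \<subseteq> jimg A B c \<and> (\<forall>z\<in>W. vf_local A B c Y z = y z)))"

definition local_conn ::
    "('t, real^'p) chart set \<Rightarrow> ('m, real^'n) chart set
      \<Rightarrow> (('t, 'm, 'p::finite, 'n::finite) vfield \<Rightarrow> ('t, 'm, 'p, 'n) vfield \<Rightarrow> ('t, 'm, 'p, 'n) vfield)
      \<Rightarrow> ('t, 'm, 'p, 'n) jchart
      \<Rightarrow> (('p, 'n) jc \<Rightarrow> ('p, 'n) jc) \<Rightarrow> (('p, 'n) jc \<Rightarrow> ('p, 'n) jc) \<Rightarrow> ('p, 'n) jc \<Rightarrow> ('p, 'n) jc" where
  "local_conn A B nabla c x y w =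
     vf_local A B c (nabla (globalize A B c x w) (globalize A B c y w)) w"

section \<open>Nonlinear connections and adapted bases\<close>

text \<open>
  In a fixed induced chart the coefficients are functions of the coordinates:
  \<open>M z i \<alpha> \<beta>\<close> is \<open>M\<^sup>(\<^sup>i\<^sup>)\<^sub>(\<^sub>\<alpha>\<^sub>)\<^sub>\<beta>\<close> and \<open>N z i \<alpha> j\<close> is \<open>N\<^sup>(\<^sup>i\<^sup>)\<^sub>(\<^sub>\<alpha>\<^sub>)\<^sub>j\<close>.
\<close>

type_synonym ('p, 'n) Mcoeff = "('p, 'n) jc \<Rightarrow> 'n \<Rightarrow> 'p \<Rightarrow> 'p \<Rightarrow> real"
type_synonym ('p, 'n) Ncoeff = "('p, 'n) jc \<Rightarrow> 'n \<Rightarrow> 'p \<Rightarrow> 'n \<Rightarrow> real"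

text \<open>In the transformation rules, tilded coordinates are those of \<open>d\<close>.\<close>

definition nonlinear_connection ::
    "('t, real^'p) chart set \<Rightarrow> ('m, real^'n) chart set
      \<Rightarrow> (('t, 'm, 'p::finite, 'n::finite) jchart \<Rightarrow> ('p, 'n) Mcoeff)
      \<Rightarrow> (('t, 'm, 'p, 'n) jchart \<Rightarrow> ('p, 'n) Ncoeff) \<Rightarrow> bool" where
  "nonlinear_connection A B M N \<longleftrightarrow>
     (\<forall>c\<in>A \<times> B. \<forall>i \<alpha> \<beta>. smooth_on (jimg A B c) (\<lambda>z. M c z i \<alpha> \<beta>)) \<and>
     (\<forall>c\<in>A \<times> B. \<forall>i \<alpha> j. smooth_on (jimg A B c) (\<lambda>z. N c z i \<alpha> j)) \<and>
     (\<forall>c\<in>A \<times> B. \<forall>d\<in>A \<times> B. \<forall>e\<in>jdom A B c \<inter> jdom A B d.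
        let z = jcoord c e; w = jcoord d e; \<phi> = jtrans A B c d; \<psi> = jtrans A B d c in
        (\<forall>j \<beta> \<alpha>.
           (\<Sum>\<mu>\<in>UNIV. M d w j \<beta> \<mu> * pd (\<lambda>u. ct (\<phi> u) \<mu>) (et \<alpha>) z) =
           (\<Sum>k\<in>UNIV. \<Sum>\<gamma>\<in>UNIV.
              M c z k \<gamma> \<alpha> * pd (\<lambda>u. cx (\<phi> u) j) (ex k) z * pd (\<lambda>u. ct (\<psi> u) \<gamma>) (et \<beta>) w)
           - pd (\<lambda>u. cy (\<phi> u) j \<beta>) (et \<alpha>) z) \<and>
        (\<forall>j \<beta> i.
           (\<Sum>k\<in>UNIV. N d w j \<beta> k * pd (\<lambda>u. cx (\<phi> u) k) (ex i) z) =
           (\<Sum>k\<in>UNIV. \<Sum>\<gamma>\<in>UNIV.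
              N c z k \<gamma> i * pd (\<lambda>u. cx (\<phi> u) j) (ex k) z * pd (\<lambda>u. ct (\<psi> u) \<gamma>) (et \<beta>) w)
           - pd (\<lambda>u. cy (\<phi> u) j \<beta>) (ex i) z))"

text \<open>
  Indices of the adapted frame: \<open>tI \<alpha>\<close> is a \<open>T\<close>-index, \<open>xI i\<close> an \<open>M\<close>-index, and \<open>yI i \<alpha>\<close> the
  vertical double index consisting of \<open>(i)\<close> and \<open>(\<alpha>)\<close>.
\<close>

datatype ('p, 'n) idx = tI 'p | xI 'n | yI 'n 'p

fun frame ::
    "('p::finite, 'n::finite) Mcoeff \<Rightarrow> ('p, 'n) Ncoeff \<Rightarrow> ('p, 'n) idx \<Rightarrow> ('p, 'n) jc \<Rightarrow> ('p, 'n) jc" where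
  "frame M N (tI \<alpha>) z = et \<alpha> - (\<Sum>j\<in>UNIV. \<Sum>\<beta>\<in>UNIV. M z j \<beta> \<alpha> *\<^sub>R ey j \<beta>)"
| "frame M N (xI i) z = ex i - (\<Sum>j\<in>UNIV. \<Sum>\<beta>\<in>UNIV. N z j \<beta> i *\<^sub>R ey j \<beta>)"
| "frame M N (yI i \<alpha>) z = ey i \<alpha>"

fun coframe ::
    "('p::finite, 'n::finite) Mcoeff \<Rightarrow> ('p, 'n) Ncoeff \<Rightarrow> ('p, 'n) idx \<Rightarrow> ('p, 'n) jc
      \<Rightarrow> ('p, 'n) jc \<Rightarrow> real" where
  "coframe M N (tI \<alpha>) z v = ct v \<alpha>"
| "coframe M N (xI i) z v = cx v i"
| "coframe M N (yI i \<alpha>) z v =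
     cy v i \<alpha> + (\<Sum>\<beta>\<in>UNIV. M z i \<alpha> \<beta> * ct v \<beta>) + (\<Sum>j\<in>UNIV. N z i \<alpha> j * cx v j)"

definition proj_hT ::
    "('p::finite, 'n::finite) Mcoeff \<Rightarrow> ('p, 'n) Ncoeff \<Rightarrow> ('p, 'n) jc \<Rightarrow> ('p, 'n) jc \<Rightarrow> ('p, 'n) jc" where
  "proj_hT M N z v = (\<Sum>\<alpha>\<in>UNIV. coframe M N (tI \<alpha>) z v *\<^sub>R frame M N (tI \<alpha>) z)"

definition proj_hM ::
    "('p::finite, 'n::finite) Mcoeff \<Rightarrow> ('p, 'n) Ncoeff \<Rightarrow> ('p, 'n) jc \<Rightarrow> ('p, 'n) jc \<Rightarrow> ('p, 'n) jc" where
  "proj_hM M N z v = (\<Sum>i\<in>UNIV. coframe M N (xI i) z v *\<^sub>R frame M N (xI i) z)"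

definition proj_v ::
    "('p::finite, 'n::finite) Mcoeff \<Rightarrow> ('p, 'n) Ncoeff \<Rightarrow> ('p, 'n) jc \<Rightarrow> ('p, 'n) jc \<Rightarrow> ('p, 'n) jc" where
  "proj_v M N z v =
     (\<Sum>i\<in>UNIV. \<Sum>\<alpha>\<in>UNIV. coframe M N (yI i \<alpha>) z v *\<^sub>R frame M N (yI i \<alpha>) z)"

text \<open>The defining expansions of the components below are expansions in the adapted frame;
  coefficients of a vector in that frame are its values under the coframe.\<close>

lemma coframe_expansion: "v = proj_hT M N z v + proj_hM M N z v + proj_v M N z v"
proof -
  have 1: "fst (proj_hT M N z v + proj_hM M N z v + proj_v M N z v) = fst v"
    by (simp add: proj_hT_def proj_hM_def proj_v_def fst_sum et_def ex_def ey_def ct_def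
        vec_eq_iff axis_def if_distrib sum.delta cong: if_cong)
  have 2: "fst (snd (proj_hT M N z v + proj_hM M N z v + proj_v M N z v)) = fst (snd v)"
    by (simp add: proj_hT_def proj_hM_def proj_v_def fst_sum snd_sum et_def ex_def ey_def cx_def
        vec_eq_iff axis_def if_distrib sum.delta cong: if_cong)
  have ax: "(\<Sum>j\<in>UNIV. \<Sum>\<beta>\<in>UNIV. f j \<beta> * (axis j (axis \<beta> 1) :: real^'p^'n) $ i $ \<alpha>) = f i \<alpha>"
    for f :: "'n::finite \<Rightarrow> 'p::finite \<Rightarrow> real" and i \<alpha>
  proof -
    have "(\<Sum>\<beta>\<in>UNIV. f j \<beta> * (axis j (axis \<beta> 1) :: real^'p^'n) $ i $ \<alpha>) = (if j = i then f i \<alpha> else 0)" for j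
      by (cases "j = i") (simp_all add: axis_def if_distrib sum.delta cong: if_cong)
    then show ?thesis by (simp add: sum.delta)
  qed
  have ft: "snd (snd (frame M N (tI \<alpha>) z)) $ i $ \<beta> = - M z i \<beta> \<alpha>" for \<alpha> i \<beta>
    by (simp add: snd_sum et_def ey_def ax)
  have fx: "snd (snd (frame M N (xI k) z)) $ i $ \<beta> = - N z i \<beta> k" for k i \<beta>
    by (simp add: snd_sum ex_def ey_def ax)
  have fy: "snd (snd (frame M N (yI k \<alpha>) z)) = axis k (axis \<alpha> 1)" for k \<alpha>
    by (simp add: ey_def)
  have 3: "snd (snd (proj_hT M N z v + proj_hM M N z v + proj_v M N z v)) = snd (snd v)"
    by (simp add: proj_hT_def proj_hM_def proj_v_def snd_sum ft fx fy ax vec_eq_iff sum_negf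
        cy_def del: frame.simps) (simp add: mult.commute)
  show ?thesis using 1 2 3 by (simp add: prod_eq_iff)
qed

section \<open>Gamma-linear connections\<close>

definition lift_proj ::
    "(('t, 'm, 'p::finite, 'n::finite) jchart \<Rightarrow> ('p, 'n) jc \<Rightarrow> ('p, 'n) jc \<Rightarrow> ('p, 'n) jc)
      \<Rightarrow> ('t, 'm, 'p, 'n) vfield \<Rightarrow> ('t, 'm, 'p, 'n) vfield" where
  "lift_proj P Y = (\<lambda>e c. P c (jcoord c e) (Y e c))"

text \<open>Covariant derivative of an endomorphism field \<open>H\<close>:
  \<open>(\<nabla>\<^sub>Y H) Z = \<nabla>\<^sub>Y (H Z) - H (\<nabla>\<^sub>Y Z)\<close>.\<close>

definition nabla_endo ::
    "(('t, 'm, 'p::finite, 'n::finite) vfield \<Rightarrow> ('t, 'm, 'p, 'n) vfield \<Rightarrow> ('t, 'm, 'p, 'n) vfield)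
      \<Rightarrow> (('t, 'm, 'p, 'n) vfield \<Rightarrow> ('t, 'm, 'p, 'n) vfield)
      \<Rightarrow> ('t, 'm, 'p, 'n) vfield \<Rightarrow> ('t, 'm, 'p, 'n) vfield \<Rightarrow> ('t, 'm, 'p, 'n) vfield" where
  "nabla_endo nabla H Y Z = (\<lambda>e c. nabla Y (H Z) e c - H (nabla Y Z) e c)"

definition Gamma_linear_connection ::
    "('t, real^'p) chart set \<Rightarrow> ('m, real^'n) chart set
      \<Rightarrow> (('t, 'm, 'p::finite, 'n::finite) jchart \<Rightarrow> ('p, 'n) Mcoeff)
      \<Rightarrow> (('t, 'm, 'p, 'n) jchart \<Rightarrow> ('p, 'n) Ncoeff)
      \<Rightarrow> (('t, 'm, 'p, 'n) vfield \<Rightarrow> ('t, 'm, 'p, 'n) vfield \<Rightarrow> ('t, 'm, 'p, 'n) vfield) \<Rightarrow> bool" where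
  "Gamma_linear_connection A B M N nabla \<longleftrightarrow>
     linear_connection A B nabla \<and>
     (\<forall>Y\<in>vector_fields A B. \<forall>Z\<in>vector_fields A B.
        nabla_endo nabla (lift_proj (\<lambda>c. proj_hT (M c) (N c))) Y Z = (\<lambda>e c. 0) \<and>
        nabla_endo nabla (lift_proj (\<lambda>c. proj_hM (M c) (N c))) Y Z = (\<lambda>e c. 0) \<and>
        nabla_endo nabla (lift_proj (\<lambda>c. proj_v (M c) (N c))) Y Z = (\<lambda>e c. 0))"

section \<open>Components in a fixed induced chart\<close>

text \<open>
  From here on \<open>M\<close>, \<open>N\<close> are the coefficients of the nonlinear connection in one induced chart
  and \<open>D\<close> is a localized connection acting on local fields of that chart.

  \<open>conn_coeff M N D a b k\<close> is the coefficient of the frame field \<open>a\<close> in the derivative of the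
  frame field \<open>b\<close> along the frame field \<open>k\<close>.  The nine families of local components of a
  Gamma-linear connection are the ones with \<open>a\<close> and \<open>b\<close> of the same kind:
  \<open>(tI \<alpha>) (tI \<beta>)\<close>, \<open>(xI k) (xI i)\<close>, \<open>(yI k \<alpha>) (yI i \<beta>)\<close>, each with last index
  \<open>tI \<gamma>\<close> (the \<open>G\<close>'s), \<open>xI j\<close> (the \<open>L\<close>'s) or \<open>yI j \<gamma>\<close> (the \<open>C\<close>'s).
\<close>

type_synonym ('p, 'n) lconn =
  "(('p, 'n) jc \<Rightarrow> ('p, 'n) jc) \<Rightarrow> (('p, 'n) jc \<Rightarrow> ('p, 'n) jc) \<Rightarrow> ('p, 'n) jc \<Rightarrow> ('p, 'n) jc"

definition conn_coeff ::
    "('p::finite, 'n::finite) Mcoeff \<Rightarrow> ('p, 'n) Ncoeff \<Rightarrow> ('p, 'n) lconn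
      \<Rightarrow> ('p, 'n) idx \<Rightarrow> ('p, 'n) idx \<Rightarrow> ('p, 'n) idx \<Rightarrow> ('p, 'n) jc \<Rightarrow> real" where
  "conn_coeff M N D a b k z = coframe M N a z (D (frame M N k) (frame M N b) z)"

definition bracket ::
    "(('p::finite, 'n::finite) jc \<Rightarrow> ('p, 'n) jc) \<Rightarrow> (('p, 'n) jc \<Rightarrow> ('p, 'n) jc)
      \<Rightarrow> ('p, 'n) jc \<Rightarrow> ('p, 'n) jc" where
  "bracket x y z = pd y (x z) z - pd x (y z) z"

definition curvature ::
    "('p::finite, 'n::finite) lconn \<Rightarrow> (('p, 'n) jc \<Rightarrow> ('p, 'n) jc) \<Rightarrow> (('p, 'n) jc \<Rightarrow> ('p, 'n) jc)
      \<Rightarrow> (('p, 'n) jc \<Rightarrow> ('p, 'n) jc) \<Rightarrow> ('p, 'n) jc \<Rightarrow> ('p, 'n) jc" where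
  "curvature D x y u z = D x (D y u) z - D y (D x u) z - D (bracket x y) u z"

text \<open>
  \<open>curv_coeff M N D l a b k\<close> is the coefficient of the frame field \<open>l\<close> in
  \<open>\<^bold>R(\<delta>\<^sub>k, \<delta>\<^sub>b) \<delta>\<^sub>a\<close>; note that the order of the last two indices is reversed with respect
  to the arguments of the curvature.  With \<open>l\<close> and \<open>a\<close> of the same kind, the kinds
  \<open>(tI, tI)\<close>, \<open>(tI, xI)\<close>, \<open>(xI, xI)\<close> of \<open>(b, k)\<close> give the \<open>R\<close>'s, \<open>(tI, yI)\<close> and \<open>(xI, yI)\<close> give
  the \<open>P\<close>'s and \<open>(yI, yI)\<close> gives the \<open>S\<close>'s.
\<close>

definition curv_coeff ::
    "('p::finite, 'n::finite) Mcoeff \<Rightarrow> ('p, 'n) Ncoeff \<Rightarrow> ('p, 'n) lconn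
      \<Rightarrow> ('p, 'n) idx \<Rightarrow> ('p, 'n) idx \<Rightarrow> ('p, 'n) idx \<Rightarrow> ('p, 'n) idx \<Rightarrow> ('p, 'n) jc \<Rightarrow> real" where
  "curv_coeff M N D l a b k z =
     coframe M N l z (curvature D (frame M N k) (frame M N b) (frame M N a) z)"

definition delta ::
    "('p::finite, 'n::finite) Mcoeff \<Rightarrow> ('p, 'n) Ncoeff \<Rightarrow> ('p, 'n) idx
      \<Rightarrow> (('p, 'n) jc \<Rightarrow> real) \<Rightarrow> ('p, 'n) jc \<Rightarrow> real" where
  "delta M N k f z = pd f (frame M N k z) z"

subsection \<open>Torsion components\<close>

definition tor_Rtt :: "('p::finite, 'n::finite) Mcoeff \<Rightarrow> ('p, 'n) Ncoeff
      \<Rightarrow> 'n \<Rightarrow> 'p \<Rightarrow> 'p \<Rightarrow> 'p \<Rightarrow> ('p, 'n) jc \<Rightarrow> real" where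
  "tor_Rtt M N m \<mu> \<alpha> \<beta> z =
     delta M N (tI \<beta>) (\<lambda>u. M u m \<mu> \<alpha>) z - delta M N (tI \<alpha>) (\<lambda>u. M u m \<mu> \<beta>) z"

definition tor_Rtx :: "('p::finite, 'n::finite) Mcoeff \<Rightarrow> ('p, 'n) Ncoeff
      \<Rightarrow> 'n \<Rightarrow> 'p \<Rightarrow> 'p \<Rightarrow> 'n \<Rightarrow> ('p, 'n) jc \<Rightarrow> real" where
  "tor_Rtx M N m \<mu> \<alpha> j z =
     delta M N (xI j) (\<lambda>u. M u m \<mu> \<alpha>) z - delta M N (tI \<alpha>) (\<lambda>u. N u m \<mu> j) z"

definition tor_Rxx :: "('p::finite, 'n::finite) Mcoeff \<Rightarrow> ('p, 'n) Ncoeff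
      \<Rightarrow> 'n \<Rightarrow> 'p \<Rightarrow> 'n \<Rightarrow> 'n \<Rightarrow> ('p, 'n) jc \<Rightarrow> real" where
  "tor_Rxx M N m \<mu> i j z =
     delta M N (xI j) (\<lambda>u. N u m \<mu> i) z - delta M N (xI i) (\<lambda>u. N u m \<mu> j) z"

definition tor_Tbar_tt :: "('p::finite, 'n::finite) Mcoeff \<Rightarrow> ('p, 'n) Ncoeff \<Rightarrow> ('p, 'n) lconn
      \<Rightarrow> 'p \<Rightarrow> 'p \<Rightarrow> 'p \<Rightarrow> ('p, 'n) jc \<Rightarrow> real" where
  "tor_Tbar_tt M N D \<mu> \<alpha> \<beta> z =
     conn_coeff M N D (tI \<mu>) (tI \<alpha>) (tI \<beta>) z - conn_coeff M N D (tI \<mu>) (tI \<beta>) (tI \<alpha>) z"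

definition tor_Tbar_tx :: "('p::finite, 'n::finite) Mcoeff \<Rightarrow> ('p, 'n) Ncoeff \<Rightarrow> ('p, 'n) lconn
      \<Rightarrow> 'p \<Rightarrow> 'p \<Rightarrow> 'n \<Rightarrow> ('p, 'n) jc \<Rightarrow> real" where
  "tor_Tbar_tx M N D \<mu> \<alpha> j z = conn_coeff M N D (tI \<mu>) (tI \<alpha>) (xI j) z"

definition tor_T_tx :: "('p::finite, 'n::finite) Mcoeff \<Rightarrow> ('p, 'n) Ncoeff \<Rightarrow> ('p, 'n) lconn
      \<Rightarrow> 'n \<Rightarrow> 'p \<Rightarrow> 'n \<Rightarrow> ('p, 'n) jc \<Rightarrow> real" where
  "tor_T_tx M N D m \<alpha> j z = - conn_coeff M N D (xI m) (xI j) (tI \<alpha>) z"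

definition tor_T_xx :: "('p::finite, 'n::finite) Mcoeff \<Rightarrow> ('p, 'n) Ncoeff \<Rightarrow> ('p, 'n) lconn
      \<Rightarrow> 'n \<Rightarrow> 'n \<Rightarrow> 'n \<Rightarrow> ('p, 'n) jc \<Rightarrow> real" where
  "tor_T_xx M N D m i j z =
     conn_coeff M N D (xI m) (xI i) (xI j) z - conn_coeff M N D (xI m) (xI j) (xI i) z"

text \<open>The arguments of \<open>tor_S\<close> are the index pairs \<open>(m, \<mu>)\<close>, \<open>(i, \<alpha>)\<close>, \<open>(j, \<beta>)\<close>.\<close>

definition tor_S :: "('p::finite, 'n::finite) Mcoeff \<Rightarrow> ('p, 'n) Ncoeff \<Rightarrow> ('p, 'n) lconn
      \<Rightarrow> 'n \<Rightarrow> 'p \<Rightarrow> 'n \<Rightarrow> 'p \<Rightarrow> 'n \<Rightarrow> 'p \<Rightarrow> ('p, 'n) jc \<Rightarrow> real" where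
  "tor_S M N D m \<mu> i \<alpha> j \<beta> z =
     conn_coeff M N D (yI m \<mu>) (yI i \<alpha>) (yI j \<beta>) z - conn_coeff M N D (yI m \<mu>) (yI j \<beta>) (yI i \<alpha>) z"

definition tor_Pt :: "('p::finite, 'n::finite) Mcoeff \<Rightarrow> ('p, 'n) Ncoeff \<Rightarrow> ('p, 'n) lconn
      \<Rightarrow> 'n \<Rightarrow> 'p \<Rightarrow> 'p \<Rightarrow> 'n \<Rightarrow> 'p \<Rightarrow> ('p, 'n) jc \<Rightarrow> real" where
  "tor_Pt M N D m \<mu> \<alpha> j \<beta> z =
     pd (\<lambda>u. M u m \<mu> \<alpha>) (ey j \<beta>) z - conn_coeff M N D (yI m \<mu>) (yI j \<beta>) (tI \<alpha>) z"

definition tor_Px :: "('p::finite, 'n::finite) Mcoeff \<Rightarrow> ('p, 'n) Ncoeff \<Rightarrow> ('p, 'n) lconn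
      \<Rightarrow> 'n \<Rightarrow> 'p \<Rightarrow> 'n \<Rightarrow> 'n \<Rightarrow> 'p \<Rightarrow> ('p, 'n) jc \<Rightarrow> real" where
  "tor_Px M N D m \<mu> i j \<beta> z =
     pd (\<lambda>u. N u m \<mu> i) (ey j \<beta>) z - conn_coeff M N D (yI m \<mu>) (yI j \<beta>) (xI i) z"

subsection \<open>Covariant derivatives of d-tensors\<close>

text \<open>
  The components of a d-tensor are indexed by a list of contravariant and a list of covariant
  slots.  A slot with index \<open>tI\<close>, \<open>xI\<close>, \<open>yI\<close> belongs to \<open>\<delta>/\<delta>t\<close>, \<open>\<delta>/\<delta>x\<close>, \<open>\<partial>/\<partial>x\<^sup>i\<^sub>\<alpha>\<close> if it is
  contravariant and to \<open>dt\<close>, \<open>dx\<close>, \<open>\<delta>x\<^sup>i\<^sub>\<alpha>\<close> if it is covariant.  Repeated indices are summed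
  over all indices of the same kind only, so components whose slots have different kinds
  are never mixed and belong to separate d-tensors.
\<close>

type_synonym ('p, 'n) dtensor =
  "('p, 'n) idx list \<Rightarrow> ('p, 'n) idx list \<Rightarrow> ('p, 'n) jc \<Rightarrow> real"

fun ksum :: "('p::finite, 'n::finite) idx \<Rightarrow> (('p, 'n) idx \<Rightarrow> real) \<Rightarrow> real" where
  "ksum (tI _) F = (\<Sum>\<mu>\<in>UNIV. F (tI \<mu>))"
| "ksum (xI _) F = (\<Sum>m\<in>UNIV. F (xI m))"
| "ksum (yI _ _) F = (\<Sum>m\<in>UNIV. \<Sum>\<mu>\<in>UNIV. F (yI m \<mu>))"

text \<open>
  The covariant derivative along the frame field \<open>k\<close>: \<open>T\<close>-horizontal, \<open>M\<close>-horizontal or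
  vertical according to whether \<open>k\<close> is \<open>tI \<epsilon>\<close>, \<open>xI p\<close> or \<open>yI p \<epsilon>\<close>.
\<close>

definition cov_along ::
    "('p::finite, 'n::finite) Mcoeff \<Rightarrow> ('p, 'n) Ncoeff \<Rightarrow> ('p, 'n) lconn \<Rightarrow> ('p, 'n) idx
      \<Rightarrow> ('p, 'n) dtensor \<Rightarrow> ('p, 'n) dtensor" where
  "cov_along M N D k X us ls z =
     delta M N k (X us ls) z
     + (\<Sum>r<length us. ksum (us ! r) (\<lambda>s. X (us[r := s]) ls z * conn_coeff M N D (us ! r) s k z))
     - (\<Sum>r<length ls. ksum (ls ! r) (\<lambda>s. X us (ls[r := s]) z * conn_coeff M N D s (ls ! r) k z))"

text \<open>All covariant derivatives of \<open>X\<close> collected into one d-tensor, whose last covariant slot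
  is the index of differentiation.\<close>

definition cov ::
    "('p::finite, 'n::finite) Mcoeff \<Rightarrow> ('p, 'n) Ncoeff \<Rightarrow> ('p, 'n) lconn
      \<Rightarrow> ('p, 'n) dtensor \<Rightarrow> ('p, 'n) dtensor" where
  "cov M N D X us ls = (if ls = [] then (\<lambda>z. 0) else cov_along M N D (last ls) X us (butlast ls))"

text \<open>The components of a vector field in the adapted frame, as d-tensors.\<close>

fun vf_dtensor ::
    "('p::finite, 'n::finite) Mcoeff \<Rightarrow> ('p, 'n) Ncoeff \<Rightarrow> (('p, 'n) jc \<Rightarrow> ('p, 'n) jc)
      \<Rightarrow> ('p, 'n) dtensor" where
  "vf_dtensor M N x [a] [] = (\<lambda>z. coframe M N a z (x z))"
| "vf_dtensor M N x _ _ = (\<lambda>z. 0)"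

end

theory Submission
  imports Defs
begin

text \<open>
  In the domain of an induced chart every smooth local function or vector field agrees near a given
  point with a global one: multiply by a bump function and extend by zero, which is smooth because
  \<open>T\<close> and \<open>M\<close> are Hausdorff.  Hence \<open>\<nabla>\<close> localizes to a connection on the chart domain with the usual
  linearity and Leibniz rules.  The transformation rules of \<open>\<Gamma>\<close> make the three distributions
  independent of the chart, so the extensions of frame fields are fixed by the corresponding
  projection and \<open>\<nabla>h\<^sub>T = \<nabla>h\<^sub>M = \<nabla>v = 0\<close> kills all connection coefficients with indices of different
  kinds.  Sums over one kind of index are then sums over all indices of the adapted frame, and the
  eighteen identities are instances of the single identity
  \<open>X\<^sup>a\<^sub>;\<^sub>b\<^sub>;\<^sub>k - X\<^sup>a\<^sub>;\<^sub>k\<^sub>;\<^sub>b = \<Sum>\<^sub>s X\<^sup>s R\<^sup>a\<^sub>s\<^sub>b\<^sub>k - \<Sum>\<^sub>s X\<^sup>a\<^sub>;\<^sub>s T\<^sup>s\<^sub>b\<^sub>k\<close>, where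
  \<open>T(\<delta>\<^sub>k, \<delta>\<^sub>b) = \<nabla>\<^sub>k \<delta>\<^sub>b - \<nabla>\<^sub>b \<delta>\<^sub>k - [\<delta>\<^sub>k, \<delta>\<^sub>b]\<close> has the components \<open>T\<^sup>s\<^sub>b\<^sub>k\<close>.
\<close>

subsection \<open>Directional derivatives\<close>

text \<open>The jet bundle is a set of classes of germs without a topology of its own, and a vector
  field on it is the family of its component vectors in all charts. A field cut off in one chart
  must therefore be pushed forward by the Jacobians of all coordinate changes, which calls for the
  explicit formula of the change of jet coordinates; that a support is closed is tested on its
  projections to T and M. \<open>local_conn\<close> chooses its global fields anew at every point,
  so neither linearity nor smoothness in the point is built in. Both hold because one fixed pair of
  extensions computes all values near a given point, and only then does the double derivative in the
  curvature behave as expected. The base components of the frame fields are constants, so their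
  brackets are vertical. Together with the vanishing mixed coefficients this accounts for the zeros
  among the torsion components and makes the R's pure bracket terms. In the identity the bracket
  enters three times: in the commutator on functions, in the curvature and in the torsion. The parts
  containing connection coefficients cancel and the derivative parts match.\<close>

lemma has_derivative_pd:
  "f differentiable (at z) \<Longrightarrow> (f has_derivative (\<lambda>v. pd f v z)) (at z)"
  by (simp add: pd_def frechet_derivative_works)

lemma pd_eqI: "(f has_derivative f') (at z) \<Longrightarrow> pd f v z = f' v"
  by (metis pd_def frechet_derivative_at)

lemma pd_linear: "f differentiable (at z) \<Longrightarrow> bounded_linear (\<lambda>v. pd f v z)"
  using has_derivative_pd has_derivative_bounded_linear by blast

lemma has_derivative_cong_open:
  assumes "open S" "z \<in> S" "\<And>x. x \<in> S \<Longrightarrow> f x = g x"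
  shows "(f has_derivative f') (at z) \<longleftrightarrow> (g has_derivative f') (at z)"
  using assms has_derivative_transform_within_open by metis

text \<open>\<open>frechet_derivative\<close> is a choice made from the predicate
  \<open>has_derivative\<close>, so functions with the same germ at z get the same choice.\<close>

lemma pd_cong:
  assumes "open S" "z \<in> S" "\<And>x. x \<in> S \<Longrightarrow> f x = g x"
  shows "pd f v z = pd g v z"
  using has_derivative_cong_open[OF assms] by (simp add: pd_def frechet_derivative_def)

lemma differentiable_cong_open:
  assumes "open S" "z \<in> S" "\<And>x. x \<in> S \<Longrightarrow> f x = g x"
  shows "f differentiable (at z) \<longleftrightarrow> g differentiable (at z)"
  using has_derivative_cong_open[OF assms] by (simp add: differentiable_def)

lemma pd_compose:
  assumes "f differentiable (at z)" "g differentiable (at (f z))"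
  shows "pd (\<lambda>x. g (f x)) v z = pd g (pd f v z) (f z)"
  using has_derivative_compose[OF has_derivative_pd[OF assms(1)] has_derivative_pd[OF assms(2)]]
  by (rule pd_eqI)

lemma pd_linear_compose:
  assumes "bounded_linear L" "f differentiable (at z)"
  shows "pd (\<lambda>x. L (f x)) v z = L (pd f v z)"
  by (rule pd_eqI, rule bounded_linear.has_derivative[OF assms(1) has_derivative_pd[OF assms(2)]])

lemma pd_bounded_linear: "bounded_linear L \<Longrightarrow> pd L v z = L v"
  by (rule pd_eqI) (rule bounded_linear_imp_has_derivative)

lemma pd_const [simp]: "pd (\<lambda>x. c) v z = 0"
  by (simp add: pd_def)

lemma pd_add:
  assumes "f differentiable (at z)" "g differentiable (at z)"
  shows "pd (\<lambda>x. f x + g x) v z = pd f v z + pd g v z"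
  by (rule pd_eqI) (intro has_derivative_add has_derivative_pd assms)

lemma pd_sum:
  assumes "\<And>i. i \<in> I \<Longrightarrow> f i differentiable (at z)"
  shows "pd (\<lambda>x. \<Sum>i\<in>I. f i x) v z = (\<Sum>i\<in>I. pd (f i) v z)"
  by (rule pd_eqI) (intro has_derivative_sum has_derivative_pd assms)

lemma pd_bilinear:
  assumes "bounded_bilinear mul" "f differentiable (at z)" "g differentiable (at z)"
  shows "pd (\<lambda>x. mul (f x) (g x)) v z = mul (f z) (pd g v z) + mul (pd f v z) (g z)"
  by (rule pd_eqI, rule bounded_bilinear.FDERIV[OF assms(1)]) (intro has_derivative_pd assms)+

lemma pd_0 [simp]: "f differentiable (at z) \<Longrightarrow> pd f 0 z = 0"
  using linear_0[OF bounded_linear.linear[OF pd_linear]] .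

lemma pd_dir_add:
  "f differentiable (at z) \<Longrightarrow> pd f (u + v) z = pd f u z + pd f v z"
  using linear_add[OF bounded_linear.linear[OF pd_linear]] .

lemma pd_dir_diff:
  "f differentiable (at z) \<Longrightarrow> pd f (u - v) z = pd f u z - pd f v z"
  using linear_diff[OF bounded_linear.linear[OF pd_linear]] .

lemma pd_dir_scale:
  "f differentiable (at z) \<Longrightarrow> pd f (r *\<^sub>R u) z = r *\<^sub>R pd f u z"
  using linear_scale[OF bounded_linear.linear[OF pd_linear]] .

lemma pd_dir_sum:
  "f differentiable (at z) \<Longrightarrow> pd f (\<Sum>i\<in>I. u i) z = (\<Sum>i\<in>I. pd f (u i) z)"
  using linear_sum[OF bounded_linear.linear[OF pd_linear]] .

lemma pd_basis_expansion:
  fixes f :: "'a::euclidean_space \<Rightarrow> 'b::real_normed_vector"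
  assumes "f differentiable (at z)"
  shows "pd f v z = (\<Sum>b\<in>Basis. (v \<bullet> b) *\<^sub>R pd f b z)"
proof -
  have "pd f v z = pd f (\<Sum>b\<in>Basis. (v \<bullet> b) *\<^sub>R b) z"
    by (simp add: euclidean_representation)
  then show ?thesis
    using assms by (simp add: pd_dir_sum pd_dir_scale)
qed

subsection \<open>Closure properties of smooth maps\<close>

lemma Ck_on_cong:
  assumes "open S"
  shows "(\<And>z. z \<in> S \<Longrightarrow> f z = g z) \<Longrightarrow> Ck_on k S f \<longleftrightarrow> Ck_on k S g"
proof (induction k arbitrary: f g)
  case 0
  show ?case unfolding Ck_on.simps by (rule continuous_on_cong) (use 0 in auto)
next
  case (Suc k)
  have "Ck_on k S (pd f b) \<longleftrightarrow> Ck_on k S (pd g b)" for b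
    by (rule Suc.IH) (use pd_cong[OF assms _ Suc.prems] in auto)
  moreover have "f differentiable (at z) \<longleftrightarrow> g differentiable (at z)" if "z \<in> S" for z
    by (rule differentiable_cong_open[OF assms that Suc.prems])
  ultimately show ?case by simp
qed

lemma Ck_on_transform:
  assumes "open S" "Ck_on k S f" "\<And>z. z \<in> S \<Longrightarrow> f z = g z"
  shows "Ck_on k S g"
  using Ck_on_cong[of S f g k] assms by blast

lemma Ck_on_subset: "Ck_on k S f \<Longrightarrow> R \<subseteq> S \<Longrightarrow> Ck_on k R f"
  by (induction k arbitrary: f) (auto intro: continuous_on_subset)

lemma Ck_on_Suc_D: "Ck_on (Suc k) S f \<Longrightarrow> Ck_on k S f"
proof (induction k arbitrary: f)
  case 0
  then show ?case
    by (auto intro!: continuous_at_imp_continuous_on differentiable_imp_continuous_within)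
next
  case (Suc k)
  then show ?case by (metis Ck_on.simps(2))
qed

lemma Ck_on_const: "Ck_on k S (\<lambda>x. c)"
proof (induction k arbitrary: c)
  case (Suc k)
  have "pd (\<lambda>x::'a. c) b = (\<lambda>x. 0)" for b by auto
  then show ?case using Suc by simp
qed simp

lemma Ck_on_linear_compose:
  assumes "open S" "bounded_linear L"
  shows "Ck_on k S f \<Longrightarrow> Ck_on k S (\<lambda>z. L (f z))"
proof (induction k arbitrary: f)
  case 0
  then show ?case by (simp add: bounded_linear.continuous_on[OF assms(2)])
next
  case (Suc k)
  have "Ck_on k S (pd (\<lambda>z. L (f z)) b)" if "b \<in> Basis" for b
  proof -
    have "Ck_on k S (\<lambda>z. L (pd f b z))" using Suc that by simp
    moreover have "L (pd f b z) = pd (\<lambda>z. L (f z)) b z" if "z \<in> S" for z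
      using Suc.prems that by (simp add: pd_linear_compose[OF assms(2)])
    ultimately show ?thesis by (rule Ck_on_transform[OF assms(1)])
  qed
  moreover have "(\<lambda>z. L (f z)) differentiable (at z)" if "z \<in> S" for z
    using bounded_linear.has_derivative[OF assms(2) has_derivative_pd[of f z]] Suc.prems that
    by (auto simp: differentiable_def)
  ultimately show ?case by simp
qed

lemma Ck_on_add:
  assumes "open S"
  shows "Ck_on k S f \<Longrightarrow> Ck_on k S g \<Longrightarrow> Ck_on k S (\<lambda>z. f z + g z)"
proof (induction k arbitrary: f g)
  case 0
  then show ?case by (simp add: continuous_on_add)
next
  case (Suc k)
  have "Ck_on k S (pd (\<lambda>z. f z + g z) b)" if "b \<in> Basis" for b
  proof -
    have "Ck_on k S (\<lambda>z. pd f b z + pd g b z)" using Suc that by simp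
    moreover have "pd f b z + pd g b z = pd (\<lambda>z. f z + g z) b z" if "z \<in> S" for z
      using pd_add Suc.prems that by (metis Ck_on.simps(2))
    ultimately show ?thesis by (rule Ck_on_transform[OF assms(1)])
  qed
  then show ?case using Suc.prems by simp
qed

lemma Ck_on_bilinear:
  assumes "open S" "bounded_bilinear mul"
  shows "Ck_on k S f \<Longrightarrow> Ck_on k S g \<Longrightarrow> Ck_on k S (\<lambda>z. mul (f z) (g z))"
proof (induction k arbitrary: f g)
  case 0
  then show ?case by (simp add: bounded_bilinear.continuous_on[OF assms(2)])
next
  case (Suc k)
  have "Ck_on k S (pd (\<lambda>z. mul (f z) (g z)) b)" if "b \<in> Basis" for b
  proof -
    have "Ck_on k S (\<lambda>z. mul (f z) (pd g b z) + mul (pd f b z) (g z))"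
    proof (intro Ck_on_add assms)
      show "Ck_on k S (\<lambda>z. mul (f z) (pd g b z))" "Ck_on k S (\<lambda>z. mul (pd f b z) (g z))"
        using Suc.prems that Ck_on_Suc_D[OF Suc.prems(1)] Ck_on_Suc_D[OF Suc.prems(2)]
        by (auto intro!: Suc.IH)
    qed
    moreover have "mul (f z) (pd g b z) + mul (pd f b z) (g z) = pd (\<lambda>z. mul (f z) (g z)) b z" if "z \<in> S" for z
      using pd_bilinear[OF assms(2)] Suc.prems that by (metis Ck_on.simps(2))
    ultimately show ?thesis by (rule Ck_on_transform[OF assms(1)])
  qed
  moreover have "(\<lambda>z. mul (f z) (g z)) differentiable (at z)" if "z \<in> S" for z
    using bounded_bilinear.FDERIV[OF assms(2) has_derivative_pd[of f z] has_derivative_pd[of g z]]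
      Suc.prems that by (auto simp: differentiable_def)
  ultimately show ?case by simp
qed

lemma Ck_on_sum:
  assumes "open S"
  shows "(\<And>i. i \<in> I \<Longrightarrow> Ck_on k S (f i)) \<Longrightarrow> Ck_on k S (\<lambda>z. \<Sum>i\<in>I. f i z)"
  by (induction I rule: infinite_finite_induct) (auto intro: Ck_on_const Ck_on_add assms)

text \<open>\<open>Ck_on\<close> speaks of basis directions only, while the chain rule
  differentiates g in the moving direction \<open>pd f b z\<close>. Expanding that direction in the
  basis leaves products of \<open>pd f b\<close> with the maps \<open>pd g c\<close> composed with
  f, and the induction applies to these.\<close>

lemma Ck_on_compose:
  fixes f :: "'a::euclidean_space \<Rightarrow> 'b::euclidean_space" and g :: "'b \<Rightarrow> 'c::real_normed_vector"
  assumes "open S" "open R" "f ` S \<subseteq> R"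
  shows "Ck_on k S f \<Longrightarrow> Ck_on k R g \<Longrightarrow> Ck_on k S (\<lambda>z. g (f z))"
proof (induction k arbitrary: g)
  case 0
  then show ?case using assms(3) continuous_on_compose2 by (metis Ck_on.simps(1))
next
  case (Suc k)
  have fd: "f differentiable (at z)" and gd: "g differentiable (at (f z))" if "z \<in> S" for z
    using Suc.prems that assms(3) by auto
  have "Ck_on k S (pd (\<lambda>z. g (f z)) b)" if "b \<in> Basis" for b
  proof -
    have "Ck_on k S (\<lambda>z. (pd f b z \<bullet> c) *\<^sub>R pd g c (f z))" if "c \<in> Basis" for c
    proof (rule Ck_on_bilinear[OF assms(1) bounded_bilinear_scaleR])
      show "Ck_on k S (\<lambda>z. pd f b z \<bullet> c)"
        using Suc.prems(1) \<open>b \<in> Basis\<close>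
        by (intro Ck_on_linear_compose[OF assms(1) bounded_linear_inner_left]) simp
      show "Ck_on k S (\<lambda>z. pd g c (f z))"
        using Suc.prems that by (intro Suc.IH Ck_on_Suc_D[OF Suc.prems(1)]) auto
    qed
    then have "Ck_on k S (\<lambda>z. \<Sum>c\<in>Basis. (pd f b z \<bullet> c) *\<^sub>R pd g c (f z))"
      by (rule Ck_on_sum[OF assms(1)])
    moreover have "(\<Sum>c\<in>Basis. (pd f b z \<bullet> c) *\<^sub>R pd g c (f z)) = pd (\<lambda>z. g (f z)) b z"
      if "z \<in> S" for z
      by (simp add: pd_compose[OF fd gd] that flip: pd_basis_expansion[OF gd])
    ultimately show ?thesis by (rule Ck_on_transform[OF assms(1)])
  qed
  moreover have "(\<lambda>z. g (f z)) differentiable (at z)" if "z \<in> S" for z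
    using has_derivative_compose[OF has_derivative_pd[OF fd] has_derivative_pd[OF gd]] that
    by (auto simp: differentiable_def)
  ultimately show ?case by simp
qed

lemma Ck_on_local:
  "(\<And>z. z \<in> S \<Longrightarrow> \<exists>W. open W \<and> z \<in> W \<and> Ck_on k W f) \<Longrightarrow> Ck_on k S f"
proof (induction k arbitrary: f)
  case 0
  then show ?case
    by (fastforce intro: continuous_at_imp_continuous_on simp: continuous_on_eq_continuous_at)
next
  case (Suc k)
  have "Ck_on k S (pd f b)" if "b \<in> Basis" for b
    by (rule Suc.IH) (use Suc.prems that in fastforce)
  moreover have "f differentiable (at z)" if "z \<in> S" for z
    using Suc.prems[OF that] by auto
  ultimately show ?case by simp
qed

lemma smooth_on_transform:
  assumes "open S" "smooth_on S f" "\<And>z. z \<in> S \<Longrightarrow> f z = g z"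
  shows "smooth_on S g"
  using Ck_on_transform[of S _ f g] assms unfolding smooth_on_def by blast

lemma smooth_on_subset: "smooth_on S f \<Longrightarrow> R \<subseteq> S \<Longrightarrow> smooth_on R f"
  unfolding smooth_on_def using Ck_on_subset by metis

lemma smooth_on_local:
  "(\<And>z. z \<in> S \<Longrightarrow> \<exists>W. open W \<and> z \<in> W \<and> smooth_on W f) \<Longrightarrow> smooth_on S f"
  unfolding smooth_on_def by (meson Ck_on_local)

lemma smooth_on_differentiable: "smooth_on S f \<Longrightarrow> z \<in> S \<Longrightarrow> f differentiable (at z)"
  unfolding smooth_on_def using Ck_on.simps(2) by blast

lemma smooth_on_continuous: "smooth_on S f \<Longrightarrow> continuous_on S f"
  unfolding smooth_on_def using Ck_on.simps(1) by blast

lemma smooth_on_const [simp]: "smooth_on S (\<lambda>x. c)"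
  by (simp add: smooth_on_def Ck_on_const)

lemma smooth_on_linear_compose:
  "open S \<Longrightarrow> bounded_linear L \<Longrightarrow> smooth_on S f \<Longrightarrow> smooth_on S (\<lambda>z. L (f z))"
  unfolding smooth_on_def by (metis Ck_on_linear_compose)

lemma smooth_on_ident: "smooth_on S (\<lambda>x. x)"
proof -
  have "Ck_on k S (\<lambda>x. x)" for k
  proof (cases k)
    case (Suc l)
    have "pd (\<lambda>x::'a. x) b = (\<lambda>x. b)" for b by (auto simp: pd_def)
    then show ?thesis by (simp add: Suc Ck_on_const)
  qed simp
  then show ?thesis by (simp add: smooth_on_def)
qed

lemma smooth_on_linear: "bounded_linear L \<Longrightarrow> smooth_on S L"
  using smooth_on_linear_compose[OF open_UNIV _ smooth_on_ident] smooth_on_subset by blast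

lemma smooth_on_add:
  "open S \<Longrightarrow> smooth_on S f \<Longrightarrow> smooth_on S g \<Longrightarrow> smooth_on S (\<lambda>z. f z + g z)"
  unfolding smooth_on_def by (metis Ck_on_add)

lemma smooth_on_bilinear:
  "open S \<Longrightarrow> bounded_bilinear mul \<Longrightarrow> smooth_on S f \<Longrightarrow> smooth_on S g
    \<Longrightarrow> smooth_on S (\<lambda>z. mul (f z) (g z))"
  unfolding smooth_on_def by (metis Ck_on_bilinear)

lemmas smooth_on_mult = smooth_on_bilinear[OF _ bounded_bilinear_mult]
lemmas smooth_on_scaleR = smooth_on_bilinear[OF _ bounded_bilinear_scaleR]

lemma smooth_on_minus: "open S \<Longrightarrow> smooth_on S f \<Longrightarrow> smooth_on S (\<lambda>z. - f z)"
  by (rule smooth_on_linear_compose) (auto intro: bounded_linear_minus bounded_linear_ident)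

lemma smooth_on_diff:
  "open S \<Longrightarrow> smooth_on S f \<Longrightarrow> smooth_on S g \<Longrightarrow> smooth_on S (\<lambda>z. f z - g z)"
  using smooth_on_add[OF _ _ smooth_on_minus] by force

lemma smooth_on_sum:
  "open S \<Longrightarrow> (\<And>i. i \<in> I \<Longrightarrow> smooth_on S (f i)) \<Longrightarrow> smooth_on S (\<lambda>z. \<Sum>i\<in>I. f i z)"
  unfolding smooth_on_def by (auto intro: Ck_on_sum)

lemma smooth_on_compose:
  fixes f :: "'a::euclidean_space \<Rightarrow> 'b::euclidean_space" and g :: "'b \<Rightarrow> 'c::real_normed_vector"
  assumes "open S" "open R" "f ` S \<subseteq> R" "smooth_on S f" "smooth_on R g"
  shows "smooth_on S (\<lambda>z. g (f z))"
  using assms unfolding smooth_on_def by (metis Ck_on_compose)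

lemma smooth_on_pd_Basis: "smooth_on S f \<Longrightarrow> b \<in> Basis \<Longrightarrow> smooth_on S (pd f b)"
  unfolding smooth_on_def using Ck_on.simps(2) by blast

text \<open>The basis expansion separates the moving direction from the partial derivatives of
  f.\<close>

lemma smooth_on_pd_field:
  fixes f :: "'a::euclidean_space \<Rightarrow> 'b::real_normed_vector"
  assumes "open S" "smooth_on S f" "smooth_on S v"
  shows "smooth_on S (\<lambda>z. pd f (v z) z)"
proof -
  have "smooth_on S (\<lambda>z. \<Sum>b\<in>Basis. (v z \<bullet> b) *\<^sub>R pd f b z)"
    by (intro smooth_on_sum smooth_on_scaleR smooth_on_pd_Basis assms
        smooth_on_linear_compose[OF assms(1) bounded_linear_inner_left])
  then show ?thesis
    by (rule smooth_on_transform[OF assms(1)])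
      (simp add: pd_basis_expansion[OF smooth_on_differentiable[OF assms(2)], of _ "v _"])
qed

lemma smooth_on_pd: "open S \<Longrightarrow> smooth_on S f \<Longrightarrow> smooth_on S (pd f v)"
  using smooth_on_pd_field[of S f "\<lambda>_. v"] by (simp add: eta_contract_eq)

lemma smooth_on_componentwise:
  fixes f :: "'a::euclidean_space \<Rightarrow> 'b::euclidean_space"
  assumes "open S" "\<And>b. b \<in> Basis \<Longrightarrow> smooth_on S (\<lambda>z. f z \<bullet> b)"
  shows "smooth_on S f"
proof -
  have "smooth_on S (\<lambda>z. \<Sum>b\<in>Basis. (f z \<bullet> b) *\<^sub>R b)"
    by (intro smooth_on_sum smooth_on_scaleR assms smooth_on_const)
  then show ?thesis by (simp add: euclidean_representation)
qed

lemma smooth_on_Pair: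
  fixes f :: "'a::euclidean_space \<Rightarrow> 'b::euclidean_space" and g :: "'a \<Rightarrow> 'c::euclidean_space"
  assumes "open S" "smooth_on S f" "smooth_on S g"
  shows "smooth_on S (\<lambda>z. (f z, g z))"
proof -
  have "smooth_on S (\<lambda>z. (f z, 0) + (0, g z))"
    by (intro smooth_on_add assms smooth_on_linear_compose[OF assms(1), of "\<lambda>x. (x, 0)"]
        smooth_on_linear_compose[OF assms(1), of "\<lambda>x. (0, x)"])
      (auto intro!: bounded_linear_Pair bounded_linear_ident bounded_linear_zero)
  then show ?thesis by simp
qed

lemma smooth_on_vec:
  fixes f :: "'a::euclidean_space \<Rightarrow> 'b::euclidean_space ^ 'i::finite"
  assumes "open S" "\<And>i. smooth_on S (\<lambda>z. f z $ i)"
  shows "smooth_on S f"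
proof (rule smooth_on_componentwise[OF assms(1)])
  fix b :: "'b ^ 'i" assume "b \<in> Basis"
  then obtain i u where b: "b = axis i u" by (auto simp: Basis_vec_def)
  show "smooth_on S (\<lambda>z. f z \<bullet> b)"
    unfolding b inner_axis
    by (rule smooth_on_linear_compose[OF assms(1) bounded_linear_inner_left assms(2)])
qed

text \<open>The derivative is minus the square of the function itself, so each order of smoothness
  yields the next.\<close>

lemma smooth_on_inverse: "smooth_on {0<..} (inverse :: real \<Rightarrow> real)"
proof -
  have d: "(inverse has_derivative (\<lambda>h. - (inverse x * h * inverse x))) (at x)" if "x > 0" for x :: real
    using that by (auto intro!: derivative_eq_intros)
  have "Ck_on k {0<..} (inverse :: real \<Rightarrow> real)" for k
  proof (induction k)
    case 0
    then show ?case by (auto intro!: continuous_intros)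
  next
    case (Suc k)
    have "Ck_on k {0<..} (\<lambda>x. - (inverse x * inverse x :: real))"
      by (intro Ck_on_linear_compose[of _ uminus] Ck_on_bilinear[OF _ bounded_bilinear_mult] Suc
          bounded_linear_minus bounded_linear_ident) auto
    moreover have "- (inverse x * inverse x) = pd inverse 1 x" if "x > 0" for x :: real
      using pd_eqI[OF d[OF that], of 1] by simp
    ultimately have "Ck_on k {0<..} (pd inverse (1::real))"
      using Ck_on_cong[of "{0<..}" "\<lambda>x. - (inverse x * inverse x :: real)" "pd inverse 1" k] by simp
    then show ?case using d by (auto simp: differentiable_def)
  qed
  then show ?thesis by (simp add: smooth_on_def)
qed

subsection \<open>Symmetry of second derivatives\<close>

text \<open>Both mixed derivatives are limits of the second difference quotient: apply the mean value
  theorem in one direction and then in the other.\<close>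

lemma second_difference_mvt:
  fixes f :: "'a::euclidean_space \<Rightarrow> real"
  assumes "open S" "smooth_on S f" "h > 0"
    and S: "\<And>s t. \<bar>s\<bar> \<le> h \<Longrightarrow> \<bar>t\<bar> \<le> h \<Longrightarrow> z + s *\<^sub>R u + t *\<^sub>R v \<in> S"
  shows "\<exists>s t. 0 < s \<and> s < h \<and> 0 < t \<and> t < h \<and>
    f (z + h *\<^sub>R u + h *\<^sub>R v) - f (z + h *\<^sub>R u) - f (z + h *\<^sub>R v) + f z =
      h * h * pd (pd f u) v (z + s *\<^sub>R u + t *\<^sub>R v)"
proof -
  have line: "((\<lambda>s. g (p + s *\<^sub>R w)) has_real_derivative pd g w (p + s *\<^sub>R w)) (at s)"
    if "smooth_on S g" "p + s *\<^sub>R w \<in> S" for g :: "'a \<Rightarrow> real" and p w s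
  proof -
    have "((\<lambda>s. p + s *\<^sub>R w) has_derivative (\<lambda>r. r *\<^sub>R w)) (at s)"
      by (auto intro!: derivative_eq_intros)
    from has_derivative_compose[OF this has_derivative_pd[OF smooth_on_differentiable[OF that]]]
    have "((\<lambda>s. g (p + s *\<^sub>R w)) has_derivative (\<lambda>r. pd g (r *\<^sub>R w) (p + s *\<^sub>R w))) (at s)" .
    then show ?thesis
      unfolding has_field_derivative_def
      by (rule has_derivative_eq_rhs)
        (simp add: fun_eq_iff pd_dir_scale[OF smooth_on_differentiable[OF that]])
  qed
  have "\<exists>s. 0 < s \<and> s < h \<and>
     (f ((z + h *\<^sub>R v) + h *\<^sub>R u) - f (z + h *\<^sub>R u)) - (f ((z + h *\<^sub>R v) + 0 *\<^sub>R u) - f (z + 0 *\<^sub>R u)) =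
     (h - 0) * (pd f u ((z + h *\<^sub>R v) + s *\<^sub>R u) - pd f u (z + s *\<^sub>R u))"
    apply (rule MVT2[OF \<open>h > 0\<close>, where f = "\<lambda>s. f ((z + h *\<^sub>R v) + s *\<^sub>R u) - f (z + s *\<^sub>R u)"])
    apply (rule DERIV_diff; rule line[OF assms(2)])
    subgoal for s using S[of s h] by (auto simp: algebra_simps)
    subgoal for s using S[of s 0] \<open>h > 0\<close> by (auto simp: algebra_simps)
    done
  then obtain s where s: "0 < s" "s < h"
    "(f ((z + h *\<^sub>R v) + h *\<^sub>R u) - f (z + h *\<^sub>R u)) - (f ((z + h *\<^sub>R v) + 0 *\<^sub>R u) - f (z + 0 *\<^sub>R u)) =
     (h - 0) * (pd f u ((z + h *\<^sub>R v) + s *\<^sub>R u) - pd f u (z + s *\<^sub>R u))" by blast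
  have "\<exists>t. 0 < t \<and> t < h \<and> pd f u ((z + s *\<^sub>R u) + h *\<^sub>R v) - pd f u ((z + s *\<^sub>R u) + 0 *\<^sub>R v) =
     (h - 0) * pd (pd f u) v ((z + s *\<^sub>R u) + t *\<^sub>R v)"
    apply (rule MVT2[OF \<open>h > 0\<close>, where f = "\<lambda>t. pd f u ((z + s *\<^sub>R u) + t *\<^sub>R v)"])
    apply (rule line[OF smooth_on_pd[OF assms(1,2)]])
    using S s by auto
  then obtain t where t: "0 < t" "t < h"
    "pd f u ((z + s *\<^sub>R u) + h *\<^sub>R v) - pd f u ((z + s *\<^sub>R u) + 0 *\<^sub>R v) =
     (h - 0) * pd (pd f u) v ((z + s *\<^sub>R u) + t *\<^sub>R v)" by blast
  have "z + h *\<^sub>R v + s *\<^sub>R u = z + s *\<^sub>R u + h *\<^sub>R v" "z + h *\<^sub>R v + h *\<^sub>R u = z + h *\<^sub>R u + h *\<^sub>R v"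
    by (simp_all add: algebra_simps)
  with s t have "f (z + h *\<^sub>R u + h *\<^sub>R v) - f (z + h *\<^sub>R u) - f (z + h *\<^sub>R v) + f z =
      h * h * pd (pd f u) v (z + s *\<^sub>R u + t *\<^sub>R v)" by simp
  with s t show ?thesis by blast
qed

lemma pd_commute:
  fixes f :: "'a::euclidean_space \<Rightarrow> real"
  assumes "open S" "smooth_on S f" "z \<in> S"
  shows "pd (pd f u) v z = pd (pd f v) u z"
proof -
  obtain e where e: "e > 0" "ball z e \<subseteq> S" using assms openE by blast
  \<comment> \<open>Keeps every point z + s u + t v with s and t below r inside the ball of radius
    e; the summand 1 avoids division by zero.\<close>
  define r where "r = e / (norm u + norm v + 1)"
  have r: "r > 0" unfolding r_def using e by (simp add: add_nonneg_pos)
  have inS: "z + s *\<^sub>R u + t *\<^sub>R v \<in> S" if "\<bar>s\<bar> < r" "\<bar>t\<bar> < r" for s t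
  proof -
    have "norm (s *\<^sub>R u + t *\<^sub>R v) \<le> \<bar>s\<bar> * norm u + \<bar>t\<bar> * norm v"
      by (metis norm_scaleR norm_triangle_ineq)
    also have "\<dots> \<le> r * norm u + r * norm v"
      using that by (intro add_mono mult_right_mono) auto
    also have "\<dots> < r * (norm u + norm v + 1)" using r by (simp add: algebra_simps)
    also have "\<dots> = e" by (simp add: r_def add_nonneg_eq_0_iff)
    finally have "dist (z + (s *\<^sub>R u + t *\<^sub>R v)) z < e"
      by (simp add: dist_norm)
    then show ?thesis using e by (auto simp: dist_commute add.assoc)
  qed
  \<comment> \<open>With n + 2 the first step size is already strictly below r, as the strict bounds
    in \<open>inS\<close> require.\<close>
  define h where "h n = r / real (n + 2)" for n :: nat
  have h: "h n > 0" "h n < r" for n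
    using r by (auto simp: h_def field_simps add_pos_nonneg)
  have hlim: "h \<longlonglongrightarrow> 0"
    unfolding h_def using LIMSEQ_ignore_initial_segment[OF lim_const_over_n[of r], of 2] by simp
  \<comment> \<open>Stated for arbitrary u and v: the difference quotient is symmetric in them, so
    using it in both orders gives two limits of one sequence.\<close>
  have lim: "(\<lambda>n. (f (z + h n *\<^sub>R u + h n *\<^sub>R v) - f (z + h n *\<^sub>R u) - f (z + h n *\<^sub>R v) + f z)
      / (h n * h n)) \<longlonglongrightarrow> pd (pd f u) v z"
    if inS: "\<And>s t. \<bar>s\<bar> < r \<Longrightarrow> \<bar>t\<bar> < r \<Longrightarrow> z + s *\<^sub>R u + t *\<^sub>R v \<in> S" for u v
  proof -
    let ?P = "\<lambda>n s t. 0 < s \<and> s < h n \<and> 0 < t \<and> t < h n \<and>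
      f (z + h n *\<^sub>R u + h n *\<^sub>R v) - f (z + h n *\<^sub>R u) - f (z + h n *\<^sub>R v) + f z =
        h n * h n * pd (pd f u) v (z + s *\<^sub>R u + t *\<^sub>R v)"
    have "\<forall>n. \<exists>s t. ?P n s t"
    proof
      fix n
      show "\<exists>s t. ?P n s t"
        by (rule second_difference_mvt[OF assms(1,2) h(1)], rule inS) (use h(2)[of n] in auto)
    qed
    then obtain s t where st: "\<And>n. ?P n (s n) (t n)" by metis
    have "s \<longlonglongrightarrow> 0" "t \<longlonglongrightarrow> 0"
      using st by (auto intro!: tendsto_sandwich[OF _ _ tendsto_const hlim] always_eventually less_imp_le)
    then have "(\<lambda>n. z + s n *\<^sub>R u + t n *\<^sub>R v) \<longlonglongrightarrow> z + 0 *\<^sub>R u + 0 *\<^sub>R v"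
      by (intro tendsto_intros)
    moreover have "continuous (at z) (pd (pd f u) v)"
      using smooth_on_continuous[OF smooth_on_pd[OF assms(1) smooth_on_pd[OF assms(1,2)]]] assms
      by (simp add: continuous_on_eq_continuous_at)
    ultimately have "(\<lambda>n. pd (pd f u) v (z + s n *\<^sub>R u + t n *\<^sub>R v)) \<longlonglongrightarrow> pd (pd f u) v z"
      using isCont_tendsto_compose by fastforce
    moreover have "pd (pd f u) v (z + s n *\<^sub>R u + t n *\<^sub>R v) =
       (f (z + h n *\<^sub>R u + h n *\<^sub>R v) - f (z + h n *\<^sub>R u) - f (z + h n *\<^sub>R v) + f z) / (h n * h n)" for n
      using st[of n] h(1)[of n] by simp
    ultimately show ?thesis by simp
  qed
  have "z + s *\<^sub>R v + t *\<^sub>R u \<in> S" if "\<bar>s\<bar> < r" "\<bar>t\<bar> < r" for s t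
    using inS[OF that(2,1)] by (simp add: algebra_simps)
  from lim[OF this] lim[OF inS] show ?thesis
    by (auto intro!: LIMSEQ_unique simp: algebra_simps)
qed

subsection \<open>Bump functions\<close>

text \<open>The case n = 0 is the classical smooth function exp (-1/x) that is flat at 0. The powers
  of 1/x are included because differentiation then stays within linear combinations of the
  family.\<close>

definition flat :: "nat \<Rightarrow> real \<Rightarrow> real" where
  "flat n x = (if x > 0 then inverse x ^ n * exp (- inverse x) else 0)"

text \<open>From the right, u = 1/x turns this into the exponential outgrowing every power.\<close>

lemma flat_tendsto_0: "(flat n \<longlongrightarrow> 0) (at 0)"
proof -
  have "((\<lambda>u. u ^ n / exp u) \<longlongrightarrow> 0) (at_top :: real filter)"
    by (rule tendsto_power_div_exp_0)
  then have "((\<lambda>x. inverse x ^ n / exp (inverse x)) \<longlongrightarrow> (0::real)) (at_right 0)"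
    by (rule filterlim_compose[OF _ filterlim_inverse_at_top_right])
  moreover have "\<forall>\<^sub>F x in at_right 0. inverse x ^ n / exp (inverse x) = flat n x"
    by (auto simp: eventually_at_right_field flat_def exp_minus divide_inverse intro: gt_ex)
  ultimately have "(flat n \<longlongrightarrow> 0) (at_right 0)"
    using tendsto_cong by force
  moreover have "(flat n \<longlongrightarrow> 0) (at_left 0)"
    by (rule tendsto_eventually) (auto simp: eventually_at_left_field flat_def intro: lt_ex)
  ultimately show ?thesis by (simp add: filterlim_split_at)
qed

lemma flat_deriv:
  "(flat n has_real_derivative (flat (n + 2) x - real n * flat (n + 1) x)) (at x)"
proof (cases x "0 :: real" rule: linorder_cases)
  case less
  have "((\<lambda>x. 0) has_real_derivative 0) (at x)" by simp
  then have "(flat n has_real_derivative 0) (at x)"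
    by (rule DERIV_cong_ev[THEN iffD1, rotated 3])
      (use less in \<open>auto simp: flat_def eventually_nhds intro!: exI[of _ "{..<0}"]\<close>)
  then show ?thesis using less by (simp add: flat_def)
next
  case equal
  \<comment> \<open>The difference quotient at 0 is the next member of the family, whose limit is
    known.\<close>
  have "((\<lambda>h. (flat n (0 + h) - flat n 0) / h) \<longlongrightarrow> 0) (at 0)"
  proof (rule Lim_transform_eventually[OF flat_tendsto_0[of "Suc n"]])
    show "\<forall>\<^sub>F h in at 0. flat (Suc n) h = (flat n (0 + h) - flat n 0) / h"
      by (rule always_eventually) (auto simp: flat_def divide_inverse)
  qed
  then show ?thesis using equal by (simp add: DERIV_def flat_def)
next
  case greater
  have "((\<lambda>x. inverse x ^ n * exp (- inverse x)) has_real_derivative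
      (flat (n + 2) x - real n * flat (n + 1) x)) (at x)"
    using greater
    by (cases n) (auto intro!: derivative_eq_intros simp: flat_def field_simps power2_eq_square,
        metis One_nat_def Suc_pred neq0_conv power_Suc)
  then show ?thesis
    by (rule DERIV_cong_ev[THEN iffD1, rotated 3])
      (use greater in \<open>auto simp: flat_def eventually_nhds intro!: exI[of _ "{0<..}"]\<close>)
qed

lemma smooth_on_flat: "smooth_on UNIV (flat n)"
proof -
  have d: "(flat n has_derivative (\<lambda>h. (flat (n + 2) x - real n * flat (n + 1) x) * h)) (at x)" for n x
    using flat_deriv unfolding has_field_derivative_def .
  have df: "flat n differentiable (at x)" for n x
    using d by (auto simp: differentiable_def)
  have "Ck_on k UNIV (flat n)" for k n
  proof (induction k arbitrary: n)
    case 0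
    then show ?case
      by (auto intro!: continuous_at_imp_continuous_on differentiable_imp_continuous_within df)
  next
    case (Suc k)
    have "Ck_on k UNIV (\<lambda>x. flat (n + 2) x + (- real n) * flat (n + 1) x)"
      by (intro Ck_on_add Ck_on_linear_compose[of _ "\<lambda>y. (- real n) * y"] Suc bounded_linear_mult_right) auto
    moreover have "(\<lambda>x. flat (n + 2) x + (- real n) * flat (n + 1) x) = pd (flat n) 1"
      using pd_eqI[OF d] by auto
    ultimately show ?case by (simp add: df)
  qed
  then show ?thesis by (simp add: smooth_on_def)
qed

lemma smooth_bump:
  fixes w :: "'a::euclidean_space"
  assumes "open W" "w \<in> W"
  obtains h :: "'a \<Rightarrow> real" and V K where "smooth_on UNIV h" "open V" "w \<in> V" "\<And>z. z \<in> V \<Longrightarrow> h z = 1"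
    "compact K" "K \<subseteq> W" "\<And>z. z \<notin> K \<Longrightarrow> h z = 0"
proof -
  obtain e where e: "e > 0" "cball w e \<subseteq> W" using assms open_contains_cball by blast
  \<comment> \<open>Squared distance, which is smooth also at w, scaled to reach 2 on the sphere of
    radius e.\<close>
  define s where "s z = (z - w) \<bullet> (z - w) * (2 / e\<^sup>2)" for z
  \<comment> \<open>Equals 1 where s is at most 1 and 0 where s is at least 2. The arguments 2 - s
    and s - 1 add up to 1, so one of them is positive and the denominator never vanishes.\<close>
  define h where "h z = flat 0 (2 - s z) * inverse (flat 0 (2 - s z) + flat 0 (s z - 1))" for z
  have ss: "smooth_on UNIV s"
    unfolding s_def
    by (intro smooth_on_mult smooth_on_bilinear[OF _ bounded_bilinear_inner] smooth_on_diff
        smooth_on_ident smooth_on_const open_UNIV)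
  have f: "smooth_on UNIV (\<lambda>z. flat 0 (g z))" if "smooth_on UNIV g" for g :: "'a \<Rightarrow> real"
    by (rule smooth_on_compose[OF _ _ _ that smooth_on_flat]) auto
  have pos: "flat 0 (2 - s z) + flat 0 (s z - 1) > 0" for z
    by (auto simp: flat_def add_pos_pos)
  have "smooth_on UNIV (\<lambda>z. inverse (flat 0 (2 - s z) + flat 0 (s z - 1)))"
    by (rule smooth_on_compose[OF _ _ _ _ smooth_on_inverse])
      (auto intro!: smooth_on_add f smooth_on_diff ss simp: pos)
  then have sh: "smooth_on UNIV h"
    unfolding h_def by (intro smooth_on_mult f smooth_on_diff ss) auto
  have h1: "h z = 1" if "z \<in> {z. s z < 1}" for z
    using that pos[of z] by (simp add: h_def flat_def)
  have op: "open {z. s z < 1}"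
    using smooth_on_continuous[OF ss] by (intro open_Collect_less) (auto intro: continuous_intros)
  have h0: "h z = 0" if "z \<notin> cball w e" for z
  proof -
    have "e\<^sup>2 \<le> (norm (z - w))\<^sup>2"
      using that e by (intro power_mono) (auto simp: dist_norm norm_minus_commute)
    then have "2 - s z \<le> 0" using e by (simp add: s_def dot_square_norm field_simps)
    then show ?thesis by (simp add: h_def flat_def)
  qed
  show ?thesis
    by (rule that[OF sh op _ h1 compact_cball e(2) h0]) (simp_all add: s_def)
qed

subsection \<open>Charts of a smooth manifold\<close>

locale manifold =
  fixes X :: "'a topology" and \<A> :: "('a, 'v::euclidean_space) chart set"
  assumes smooth_manifold: "smooth_manifold X \<A>"
begin

lemma topspace_eq: "topspace X = (\<Union>a\<in>\<A>. fst a)"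
  using smooth_manifold by (auto simp: smooth_manifold_def)

lemma openin_chart: "a \<in> \<A> \<Longrightarrow> openin X (fst a)"
  and open_chart_image: "a \<in> \<A> \<Longrightarrow> open (snd a ` fst a)"
  and homeomorphic_chart:
    "a \<in> \<A> \<Longrightarrow> homeomorphic_map (subtopology X (fst a)) (top_of_set (snd a ` fst a)) (snd a)"
  using smooth_manifold by (simp_all add: smooth_manifold_def)

lemma topspace_chart: "a \<in> \<A> \<Longrightarrow> topspace (subtopology X (fst a)) = fst a"
  by (simp add: Int_absorb1 openin_chart openin_subset)

lemma inj_on_chart: "a \<in> \<A> \<Longrightarrow> inj_on (snd a) (fst a)"
  using homeomorphic_chart topspace_chart
  by (metis homeomorphic_imp_injective_map)

lemma chart_inv_chart [simp]: "a \<in> \<A> \<Longrightarrow> p \<in> fst a \<Longrightarrow> chart_inv a (snd a p) = p"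
  by (simp add: chart_inv_def inj_on_chart)

lemma chart_chart_inv [simp]: "v \<in> snd a ` fst a \<Longrightarrow> snd a (chart_inv a v) = v"
  by (simp add: chart_inv_def f_inv_into_f)

lemma chart_inv_in [simp]: "v \<in> snd a ` fst a \<Longrightarrow> chart_inv a v \<in> fst a"
  by (simp add: chart_inv_def inv_into_into)

lemma open_chart_image_Int:
  assumes "a \<in> \<A>" "openin X U"
  shows "open (snd a ` (fst a \<inter> U))"
proof -
  have "openin (subtopology X (fst a)) (fst a \<inter> U)"
    using assms(2) by (auto simp: openin_subtopology)
  then have "openin (top_of_set (snd a ` fst a)) (snd a ` (fst a \<inter> U))"
    using homeomorphic_imp_open_map[OF homeomorphic_chart[OF assms(1)]] by (simp add: open_map_def)
  then show ?thesis
    using open_chart_image[OF assms(1)] by (simp add: openin_open_eq)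
qed

lemma open_overlap: "a \<in> \<A> \<Longrightarrow> b \<in> \<A> \<Longrightarrow> open (snd a ` (fst a \<inter> fst b))"
  by (simp add: open_chart_image_Int openin_chart)

lemma smooth_on_transition:
  "a \<in> \<A> \<Longrightarrow> b \<in> \<A> \<Longrightarrow> smooth_on (snd a ` (fst a \<inter> fst b)) (snd b \<circ> chart_inv a)"
  using smooth_manifold by (auto simp: smooth_manifold_def)

lemma overlap_iff:
  "a \<in> \<A> \<Longrightarrow> v \<in> snd a ` (fst a \<inter> U) \<longleftrightarrow> v \<in> snd a ` fst a \<and> chart_inv a v \<in> U"
  by (auto simp: image_iff)

text \<open>This is where the Hausdorff property enters: compact subsets of a chart are closed in the
  whole manifold, so that bump functions can be extended by zero.\<close>

lemma openin_compl_chart_compact: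
  assumes "a \<in> \<A>" "compact K" "K \<subseteq> snd a ` fst a"
  shows "openin X (topspace X - chart_inv a ` K)"
proof -
  have "compactin (top_of_set (snd a ` fst a)) K"
    using assms by (simp add: compactin_subtopology)
  moreover have "homeomorphic_maps (subtopology X (fst a)) (top_of_set (snd a ` fst a)) (snd a) (chart_inv a)"
  proof -
    obtain g where g: "homeomorphic_maps (subtopology X (fst a)) (top_of_set (snd a ` fst a)) (snd a) g"
      using homeomorphic_chart[OF assms(1)] homeomorphic_map_maps by blast
    \<comment> \<open>\<open>chart_inv\<close> is an \<open>inv_into\<close>; its continuity is
      inherited from the inverse homeomorphism, with which it agrees on the image of the
      chart.\<close>
    have "g v = chart_inv a v" if "v \<in> snd a ` fst a" for v
      using g that assms(1) topspace_chart[OF assms(1)] unfolding homeomorphic_maps_def by auto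
    then show ?thesis
      using g homeomorphic_maps_eq[of _ _ "snd a" g "snd a" "chart_inv a"] by fastforce
  qed
  then have "continuous_map (top_of_set (snd a ` fst a)) (subtopology X (fst a)) (chart_inv a)"
    by (simp add: homeomorphic_maps_def)
  ultimately have "compactin (subtopology X (fst a)) (chart_inv a ` K)"
    using image_compactin by blast
  then have "compactin X (chart_inv a ` K)"
    by (simp add: compactin_subtopology)
  then have "closedin X (chart_inv a ` K)"
    using smooth_manifold compactin_imp_closedin by (auto simp: smooth_manifold_def)
  then show ?thesis by (simp add: closedin_def)
qed

end

subsection \<open>Coordinates on the jet bundle\<close>

locale jet_manifolds = T: manifold T A + M: manifold Mf B
  for T :: "'t topology" and Mf :: "'m topology"
    and A :: "('t, real^'p::finite) chart set" and B :: "('m, real^'n::finite) chart set"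
begin

abbreviation near where "near \<equiv> smooth_near A B"
abbreviation jet where "jet \<equiv> jet1 A B"

lemma nearD:
  assumes "near t f" "a \<in> A" "b \<in> B" "t \<in> fst a" "f t \<in> fst b"
  obtains W where "open W" "snd a t \<in> W" "W \<subseteq> snd a ` fst a" "f ` chart_inv a ` W \<subseteq> fst b"
    "smooth_on W (local_rep a b f)"
  using assms unfolding smooth_near_def by blast

lemma local_rep_differentiable:
  assumes "near t f" "a \<in> A" "b \<in> B" "t \<in> fst a" "f t \<in> fst b"
  shows "local_rep a b f differentiable (at (snd a t))"
  using nearD[OF assms] smooth_on_differentiable by metis

text \<open>Chain rule: near the point the new local representative is the old one between a
  transition map of T and one of M.\<close>

lemma pd_local_rep_change:
  assumes f: "near t f" and ab: "a \<in> A" "b \<in> B" "t \<in> fst a" "f t \<in> fst b"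
    and ab': "a' \<in> A" "b' \<in> B" "t \<in> fst a'" "f t \<in> fst b'"
  shows "pd (local_rep a' b' f) v (snd a' t) =
    pd (snd b' \<circ> chart_inv b) (pd (local_rep a b f) (pd (snd a \<circ> chart_inv a') v (snd a' t)) (snd a t)) (snd b (f t))"
proof -
  obtain W where W: "open W" "snd a t \<in> W" "W \<subseteq> snd a ` fst a" "f ` chart_inv a ` W \<subseteq> fst b"
    "smooth_on W (local_rep a b f)" using nearD[OF f ab] .
  obtain W' where W': "open W'" "snd a' t \<in> W'" "W' \<subseteq> snd a' ` fst a'" "f ` chart_inv a' ` W' \<subseteq> fst b'"
    using nearD[OF f ab'] by metis
  let ?O = "snd a' ` (fst a' \<inter> fst a)" and ?\<tau> = "snd a \<circ> chart_inv a'" and ?\<sigma> = "snd b' \<circ> chart_inv b"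
  have tO: "snd a' t \<in> ?O" using ab ab' by auto
  have O: "open ?O" using T.open_overlap ab ab' by blast
  have \<tau>: "smooth_on ?O ?\<tau>" using T.smooth_on_transition ab ab' by blast
  have \<tau>t: "?\<tau> (snd a' t) = snd a t" using ab ab' by simp
  \<comment> \<open>Where the change of T-charts lands in W, f takes values in the domain of b, so
    the two representatives can be compared.\<close>
  let ?V = "?O \<inter> ?\<tau> -` W \<inter> W'"
  have V: "open ?V"
    by (rule open_Int[OF continuous_open_preimage[OF smooth_on_continuous[OF \<tau>] O W(1)] W'(1)])
  have tV: "snd a' t \<in> ?V" using tO W W' \<tau>t by simp
  have eq: "local_rep a' b' f u = ?\<sigma> (local_rep a b f (?\<tau> u))" if "u \<in> ?V" for u
  proof -
    have u: "chart_inv a' u \<in> fst a" "snd a (chart_inv a' u) \<in> W"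
      using that T.overlap_iff[OF ab'(1)] by auto
    then have "f (chart_inv a' u) \<in> fst b"
      using W(4) T.chart_inv_chart[OF ab(1) u(1)] by (metis image_eqI subsetD)
    then show ?thesis using u ab by (simp add: local_rep_def)
  qed
  have "pd (local_rep a' b' f) v (snd a' t) = pd (\<lambda>u. ?\<sigma> (local_rep a b f (?\<tau> u))) v (snd a' t)"
    by (rule pd_cong[OF V tV eq])
  also have "\<dots> = pd ?\<sigma> (pd (\<lambda>u. local_rep a b f (?\<tau> u)) v (snd a' t)) (local_rep a b f (?\<tau> (snd a' t)))"
  proof (rule pd_compose)
    have "local_rep a b f (?\<tau> (snd a' t)) = snd b (f t)"
      using ab ab' by (simp add: local_rep_def)
    moreover have "snd b (f t) \<in> snd b ` (fst b \<inter> fst b')" using ab ab' by auto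
    ultimately show "?\<sigma> differentiable at (local_rep a b f (?\<tau> (snd a' t)))"
      using smooth_on_differentiable[OF M.smooth_on_transition] ab ab' by metis
    show "(\<lambda>u. local_rep a b f (?\<tau> u)) differentiable at (snd a' t)"
      by (rule differentiable_compose[of "local_rep a b f"])
        (use local_rep_differentiable[OF f ab] \<tau>t smooth_on_differentiable[OF \<tau> tO] in
          \<open>auto simp: comp_def\<close>)
  qed
  also have "pd (\<lambda>u. local_rep a b f (?\<tau> u)) v (snd a' t) = pd (local_rep a b f) (pd ?\<tau> v (snd a' t)) (snd a t)"
    using pd_compose[of ?\<tau> "snd a' t" "local_rep a b f" v] \<tau>t local_rep_differentiable[OF f ab]
      smooth_on_differentiable[OF \<tau> tO] by simp
  also have "local_rep a b f (?\<tau> (snd a' t)) = snd b (f t)"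
    using ab ab' by (simp add: local_rep_def)
  finally show ?thesis .
qed

text \<open>A jet class demands equal derivatives in all pairs of charts. By the chain rule one pair
  decides, since every other derivative is computed from that one and from transition maps.\<close>

lemma jet_eqI:
  assumes f: "near t f" and g: "near t g" and fg: "f t = g t"
    and ab: "a \<in> A" "b \<in> B" "t \<in> fst a" "f t \<in> fst b"
    and pd: "\<And>v. pd (local_rep a b f) v (snd a t) = pd (local_rep a b g) v (snd a t)"
  shows "jet t f = jet t g"
proof -
  have "pd (local_rep a' b' f) v (snd a' t) = pd (local_rep a' b' g) v (snd a' t)"
    if "a' \<in> A" "b' \<in> B" "t \<in> fst a'" "f t \<in> fst b'" for a' b' v
    using pd_local_rep_change[OF f ab that] pd_local_rep_change[OF g, of a b a' b'] ab that fg pd by simp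
  then show ?thesis
    unfolding jet1_def using fg by auto
qed

text \<open>\<open>jet_rep\<close> picks an arbitrary germ of the class. All data that
  \<open>jcoord\<close> reads off are shared by the germs of a class, so the jet coordinates do not
  depend on this choice.\<close>

lemma jet_rep_jet:
  assumes "near t f"
  obtains g where "jet_rep (jet t f) = (t, g)" "near t g" "g t = f t" "jet t g = jet t f"
    "\<And>a b v. a \<in> A \<Longrightarrow> b \<in> B \<Longrightarrow> t \<in> fst a \<Longrightarrow> f t \<in> fst b \<Longrightarrow>
      pd (local_rep a b g) v (snd a t) = pd (local_rep a b f) v (snd a t)"
proof -
  have "(t, f) \<in> jet t f" using assms by (simp add: jet1_def)
  then have "jet_rep (jet t f) \<in> jet t f" unfolding jet_rep_def by (rule someI)
  then obtain g where g: "jet_rep (jet t f) = (t, g)" "(t, g) \<in> jet t f"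
    by (cases "jet_rep (jet t f)") (auto simp: jet1_def)
  show ?thesis
    by (rule that[of g]) (use g in \<open>auto simp: jet1_def\<close>)
qed

definition src :: "('t, 'm) jet \<Rightarrow> 't" where "src e = fst (jet_rep e)"
definition tgt :: "('t, 'm) jet \<Rightarrow> 'm" where "tgt e = snd (jet_rep e) (src e)"

lemma src_jet: "near t f \<Longrightarrow> src (jet t f) = t"
  and tgt_jet: "near t f \<Longrightarrow> tgt (jet t f) = f t"
  by (erule jet_rep_jet; simp add: src_def tgt_def)+

lemma J1_cases:
  assumes "e \<in> J1 A B"
  obtains f where "near (src e) f" "e = jet (src e) f" "tgt e = f (src e)"
proof -
  obtain t f where tf: "e = jet t f" "near t f" using assms by (auto simp: J1_def)
  then have "src e = t" "tgt e = f t" using src_jet tgt_jet by auto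
  with tf that show ?thesis by auto
qed

lemma jdom_iff: "e \<in> jdom A B c \<longleftrightarrow> e \<in> J1 A B \<and> src e \<in> fst (fst c) \<and> tgt e \<in> fst (snd c)"
  by (auto simp: jdom_def src_def tgt_def split: prod.splits)

lemma jcoord_jet:
  assumes "near t f" "a \<in> A" "b \<in> B" "t \<in> fst a" "f t \<in> fst b"
  shows "jcoord (a, b) (jet t f) =
    (snd a t, snd b (f t), \<chi> i \<alpha>. pd (local_rep a b f) (axis \<alpha> 1) (snd a t) $ i)"
  by (rule jet_rep_jet[OF assms(1)]) (simp add: jcoord_def assms)

lemma fst_jcoord: "fst (jcoord c e) = snd (fst c) (src e)"
  and fst_snd_jcoord: "fst (snd (jcoord c e)) = snd (snd c) (tgt e)"
  by (simp_all add: jcoord_def src_def tgt_def split: prod.splits)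

text \<open>The first two coordinates fix source and target because charts are injective. The matrix
  fixes the partial derivatives, hence the whole derivative in this pair of charts, and
  \<open>jet_eqI\<close> does the rest.\<close>

lemma inj_on_jcoord: "c \<in> A \<times> B \<Longrightarrow> inj_on (jcoord c) (jdom A B c)"
proof (rule inj_onI)
  fix e e'
  assume c: "c \<in> A \<times> B" and e: "e \<in> jdom A B c" and e': "e' \<in> jdom A B c"
    and eq: "jcoord c e = jcoord c e'"
  obtain a b where ab: "c = (a, b)" "a \<in> A" "b \<in> B" using c by auto
  obtain f where f: "near (src e) f" "e = jet (src e) f" "tgt e = f (src e)"
    using e J1_cases jdom_iff by metis
  obtain g where g: "near (src e') g" "e' = jet (src e') g" "tgt e' = g (src e')"
    using e' J1_cases jdom_iff by metis
  have d: "src e \<in> fst a" "src e' \<in> fst a" "f (src e) \<in> fst b" "g (src e') \<in> fst b"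
    using e e' f g ab by (auto simp: jdom_iff)
  have "snd a (src e) = snd a (src e')" "snd b (tgt e) = snd b (tgt e')"
    using eq ab by (metis fst_jcoord fst_snd_jcoord fst_conv snd_conv)+
  then have st: "src e' = src e" "g (src e) = f (src e)"
    using d f g T.inj_on_chart[OF ab(2)] M.inj_on_chart[OF ab(3)] by (metis inj_onD)+
  have "jcoord (a, b) (jet (src e) f) = jcoord (a, b) (jet (src e) g)"
    using eq ab f g st by simp
  then have ax: "pd (local_rep a b f) (axis \<alpha> 1) (snd a (src e)) = pd (local_rep a b g) (axis \<alpha> 1) (snd a (src e))" for \<alpha>
    using jcoord_jet[OF f(1) ab(2,3)] jcoord_jet[OF _ ab(2,3), of "src e" g] d g st
    by (simp add: vec_eq_iff)
  have "pd (local_rep a b f) v (snd a (src e)) = pd (local_rep a b g) v (snd a (src e))" for v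
    using ax pd_basis_expansion[OF local_rep_differentiable[OF f(1) ab(2,3)], of v]
      pd_basis_expansion[OF local_rep_differentiable[of "src e" g a b], of v] d g st ab
    by (auto simp: Basis_vec_def intro!: sum.cong)
  then have "jet (src e) f = jet (src e) g"
    using jet_eqI[OF f(1) _ _ ab(2,3)] g st d by metis
  then show "e = e'" using f g st by metis
qed

text \<open>Supplies a jet for every prescribed set of coordinates: a germ that is affine in the two
  charts. Away from the source its values may be arbitrary, since \<open>chart_inv\<close> is an
  \<open>inv_into\<close>.\<close>

lemma near_affine:
  assumes ab: "a \<in> A" "b \<in> B" and t0: "t0 \<in> snd a ` fst a" and x0: "x0 \<in> snd b ` fst b"
    and L: "bounded_linear L"
  defines "f \<equiv> chart_inv b \<circ> (\<lambda>v. x0 + L (v - t0)) \<circ> snd a"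
  shows "near (chart_inv a t0) f" "f (chart_inv a t0) = chart_inv b x0"
    "pd (local_rep a b f) v t0 = L v"
proof -
  let ?F = "\<lambda>v. x0 + L (v - t0)"
  have L0: "L 0 = 0" using L by (simp add: linear_0 bounded_linear.linear)
  show ft: "f (chart_inv a t0) = chart_inv b x0"
    using t0 L0 by (simp add: f_def)
  have sF: "smooth_on S ?F" for S
  proof -
    have "smooth_on UNIV ?F"
      by (intro smooth_on_add smooth_on_linear_compose[OF _ L] smooth_on_diff smooth_on_ident smooth_on_const open_UNIV)
    then show ?thesis using smooth_on_subset by blast
  qed
  have cF: "continuous_on UNIV ?F" using smooth_on_continuous[OF sF] .
  show "near (chart_inv a t0) f"
    unfolding smooth_near_def
  proof (intro conjI ballI impI)
    show "chart_inv a t0 \<in> (\<Union>a\<in>A. fst a)" "f (chart_inv a t0) \<in> (\<Union>b\<in>B. fst b)"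
      using ab t0 x0 ft by auto
    fix a' b' assume a': "a' \<in> A" "chart_inv a t0 \<in> fst a'" and b': "b' \<in> B" "f (chart_inv a t0) \<in> fst b'"
    let ?O = "snd a' ` (fst a' \<inter> fst a)" and ?P = "snd b ` (fst b \<inter> fst b')" and ?\<tau> = "snd a \<circ> chart_inv a'"
    have O: "open ?O" and P: "open ?P" and \<tau>: "smooth_on ?O ?\<tau>"
      using T.open_overlap M.open_overlap T.smooth_on_transition a' b' ab by auto
    \<comment> \<open>Here the affine value lies in the overlap of b and b', so passing to b' is a
      smooth transition.\<close>
    let ?W = "?O \<inter> (\<lambda>u. ?F (?\<tau> u)) -` ?P"
    have sF\<tau>: "smooth_on ?O (\<lambda>u. ?F (?\<tau> u))"
      by (rule smooth_on_compose[OF O open_UNIV _ \<tau> sF]) simp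
    have W: "open ?W" by (rule continuous_open_preimage[OF smooth_on_continuous[OF sF\<tau>] O P])
    have t0W: "snd a' (chart_inv a t0) \<in> ?W"
    proof -
      have "snd a' (chart_inv a t0) \<in> ?O" using a' t0 by auto
      moreover have "?F (?\<tau> (snd a' (chart_inv a t0))) = x0" using a' t0 L0 by simp
      moreover have "x0 \<in> ?P" using b' ft x0 M.overlap_iff[OF ab(2)] by auto
      ultimately show ?thesis by simp
    qed
    have fW: "f (chart_inv a' u) = chart_inv b (?F (?\<tau> u))" for u
      by (simp add: f_def)
    have fb: "f ` chart_inv a' ` ?W \<subseteq> fst b'"
      using fW M.overlap_iff[OF ab(2)] by fastforce
    have "smooth_on ?W (\<lambda>u. (snd b' \<circ> chart_inv b) (?F (?\<tau> u)))"
      by (rule smooth_on_compose[OF W P _ smooth_on_subset[OF sF\<tau>] M.smooth_on_transition[OF ab(2) b'(1)]]) auto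
    then have "smooth_on ?W (local_rep a' b' f)"
      by (simp add: local_rep_def comp_def f_def)
    then show "\<exists>W. open W \<and> snd a' (chart_inv a t0) \<in> W \<and> W \<subseteq> snd a' ` fst a' \<and>
             f ` chart_inv a' ` W \<subseteq> fst b' \<and> smooth_on W (local_rep a' b' f)"
      using W t0W fb by (intro exI[of _ ?W]) auto
  qed
  \<comment> \<open>Only here does \<open>chart_inv\<close> undo the charts, so that the
    representative is the affine map; being a neighbourhood of t0, this set determines the
    derivative there.\<close>
  let ?V = "snd a ` fst a \<inter> ?F -` (snd b ` fst b)"
  have V: "open ?V"
    using continuous_open_preimage[OF continuous_on_subset[OF cF subset_UNIV] T.open_chart_image M.open_chart_image] ab by blast
  have tV: "t0 \<in> ?V" using t0 x0 L0 by simp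
  have eq: "local_rep a b f u = ?F u" if "u \<in> ?V" for u
    using that by (auto simp: local_rep_def f_def simp del: T.chart_chart_inv M.chart_chart_inv)
      (metis M.chart_chart_inv T.chart_chart_inv image_eqI)+
  have "pd (local_rep a b f) v t0 = pd ?F v t0" by (rule pd_cong[OF V tV eq])
  also have "\<dots> = L v"
    by (rule pd_eqI) (auto intro!: derivative_eq_intros bounded_linear.has_derivative[OF L])
  finally show "pd (local_rep a b f) v t0 = L v" .
qed

text \<open>The fibre coordinate is unrestricted because every matrix is the linear part of an
  affine germ. With U and V free, one statement describes both the image of a chart and the overlap
  of two charts, and thereby their openness.\<close>

lemma jcoord_image:
  assumes ab: "a \<in> A" "b \<in> B"
  shows "jcoord (a, b) ` {e \<in> J1 A B. src e \<in> fst a \<inter> U \<and> tgt e \<in> fst b \<inter> V} =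
    {z. fst z \<in> snd a ` (fst a \<inter> U) \<and> fst (snd z) \<in> snd b ` (fst b \<inter> V)}" (is "?L = ?R")
proof
  show "?L \<subseteq> ?R" by (auto simp: fst_jcoord fst_snd_jcoord)
  show "?R \<subseteq> ?L"
  proof
    fix z :: "('p, 'n) jc" assume z: "z \<in> ?R"
    obtain t x y where zz: "z = (t, x, y)" by (cases z)
    define f where "f = chart_inv b \<circ> (\<lambda>v. x + y *v (v - t)) \<circ> snd a"
    have tx: "t \<in> snd a ` fst a" "x \<in> snd b ` fst b" using z zz by auto
    have L: "bounded_linear ((*v) y)" by (rule matrix_vector_mul_bounded_linear)
    note f = near_affine[OF ab tx L, folded f_def]
    have in1: "chart_inv a t \<in> fst a \<inter> U" "f (chart_inv a t) \<in> fst b \<inter> V"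
      using z zz T.overlap_iff[OF ab(1)] M.overlap_iff[OF ab(2)] f(2) by auto
    have "jcoord (a, b) (jet (chart_inv a t) f) = z"
      using in1 f tx zz
      by (simp add: jcoord_jet[OF f(1) ab] vec_eq_iff matrix_vector_mul_component inner_axis)
    moreover have "jet (chart_inv a t) f \<in> J1 A B" using f by (auto simp: J1_def)
    ultimately show "z \<in> ?L"
      using in1 src_jet[OF f(1)] tgt_jet[OF f(1)] by (intro image_eqI[of _ _ "jet (chart_inv a t) f"]) auto
  qed
qed

end

lemma pd_vec_expansion:
  fixes f :: "real ^ 'i::finite \<Rightarrow> 'b::real_normed_vector"
  assumes "f differentiable (at z)"
  shows "pd f v z = (\<Sum>k\<in>UNIV. v $ k *\<^sub>R pd f (axis k 1) z)"
proof -
  have "pd f v z = pd f (\<Sum>k\<in>UNIV. v $ k *\<^sub>R axis k 1) z"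
    using basis_expansion[of v] by (simp add: scalar_mult_eq_scaleR)
  then show ?thesis using assms by (simp add: pd_dir_sum pd_dir_scale)
qed

lemma bounded_linear_ct: "bounded_linear (\<lambda>v :: ('p::finite, 'n::finite) jc. ct v \<alpha>)"
  and bounded_linear_cx: "bounded_linear (\<lambda>v :: ('p, 'n) jc. cx v i)"
  and bounded_linear_cy: "bounded_linear (\<lambda>v :: ('p, 'n) jc. cy v i \<alpha>)"
  unfolding ct_def cx_def cy_def
  by (intro bounded_linear_vec_nth[THEN bounded_linear_compose] bounded_linear_snd[THEN bounded_linear_compose]
      bounded_linear_fst[THEN bounded_linear_compose] bounded_linear_snd bounded_linear_fst)+

section \<open>Coordinate changes of the jet bundle and their Jacobians\<close>

context jet_manifolds
begin

definition ovl :: "('t, 'm, 'p, 'n) jchart \<Rightarrow> ('t, 'm, 'p, 'n) jchart \<Rightarrow> ('p, 'n) jc set" where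
  "ovl c d = jcoord c ` (jdom A B c \<inter> jdom A B d)"

definition trT where "trT c d = snd (fst d) \<circ> chart_inv (fst c)"
definition trM where "trM c d = snd (snd d) \<circ> chart_inv (snd c)"

abbreviation ovT where "ovT c d \<equiv> snd (fst c) ` (fst (fst c) \<inter> fst (fst d))"
abbreviation ovM where "ovM c d \<equiv> snd (snd c) ` (fst (snd c) \<inter> fst (snd d))"

lemma ovl_eq:
  assumes "c \<in> A \<times> B"
  shows "ovl c d = {z. fst z \<in> ovT c d \<and> fst (snd z) \<in> ovM c d}"
proof -
  have "jdom A B c \<inter> jdom A B d = {e \<in> J1 A B. src e \<in> fst (fst c) \<inter> fst (fst d) \<and> tgt e \<in> fst (snd c) \<inter> fst (snd d)}"
    by (auto simp: jdom_iff)
  then show ?thesis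
    using jcoord_image[of "fst c" "snd c" "fst (fst d)" "fst (snd d)"] assms
    by (simp add: ovl_def mem_Times_iff)
qed

lemma jimg_eq:
  assumes "c \<in> A \<times> B"
  shows "jimg A B c = {z. fst z \<in> snd (fst c) ` fst (fst c) \<and> fst (snd z) \<in> snd (snd c) ` fst (snd c)}"
  using ovl_eq[OF assms, of c] by (simp add: ovl_def jimg_def)

lemma open_product:
  assumes "open U" "open V"
  shows "open {z :: ('p, 'n) jc. fst z \<in> U \<and> fst (snd z) \<in> V}"
proof -
  have "{z :: ('p, 'n) jc. fst z \<in> U \<and> fst (snd z) \<in> V} = U \<times> V \<times> UNIV" by auto
  then show ?thesis using assms by (simp add: open_Times)
qed

lemma open_jimg: "c \<in> A \<times> B \<Longrightarrow> open (jimg A B c)"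
  by (auto simp: jimg_eq intro!: open_product T.open_chart_image M.open_chart_image)

lemma open_ovl: "c \<in> A \<times> B \<Longrightarrow> d \<in> A \<times> B \<Longrightarrow> open (ovl c d)"
  by (auto simp: ovl_eq intro!: open_product T.open_overlap M.open_overlap)

lemma ovl_subset: "ovl c d \<subseteq> jimg A B c"
  by (auto simp: ovl_def jimg_def)

lemma jcoord_in_jimg: "e \<in> jdom A B c \<Longrightarrow> jcoord c e \<in> jimg A B c"
  by (simp add: jimg_def)

lemma jcoord_in_ovl: "e \<in> jdom A B c \<Longrightarrow> e \<in> jdom A B d \<Longrightarrow> jcoord c e \<in> ovl c d"
  by (simp add: ovl_def)

lemma jinv_in [simp]: "z \<in> jimg A B c \<Longrightarrow> jinv A B c z \<in> jdom A B c"
  by (simp add: jinv_def jimg_def inv_into_into)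

lemma jcoord_jinv [simp]: "z \<in> jimg A B c \<Longrightarrow> jcoord c (jinv A B c z) = z"
  by (simp add: jinv_def jimg_def f_inv_into_f)

lemma jinv_jcoord [simp]: "c \<in> A \<times> B \<Longrightarrow> e \<in> jdom A B c \<Longrightarrow> jinv A B c (jcoord c e) = e"
  by (simp add: jinv_def inj_on_jcoord)

lemma jinv_in_ovl: "c \<in> A \<times> B \<Longrightarrow> z \<in> ovl c d \<Longrightarrow> jinv A B c z \<in> jdom A B d"
  by (auto simp: ovl_def)

lemma jtrans_jcoord: "c \<in> A \<times> B \<Longrightarrow> e \<in> jdom A B c \<Longrightarrow> jtrans A B c d (jcoord c e) = jcoord d e"
  by (simp add: jtrans_def)

lemma jtrans_in_ovl:
  "c \<in> A \<times> B \<Longrightarrow> z \<in> ovl c d \<Longrightarrow> jtrans A B c d z \<in> ovl d c"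
  by (auto simp: ovl_def jtrans_jcoord)

lemma smooth_on_trT: "c \<in> A \<times> B \<Longrightarrow> d \<in> A \<times> B \<Longrightarrow> smooth_on (ovT c d) (trT c d)"
  and smooth_on_trM: "c \<in> A \<times> B \<Longrightarrow> d \<in> A \<times> B \<Longrightarrow> smooth_on (ovM c d) (trM c d)"
  unfolding trT_def trM_def by (auto intro!: T.smooth_on_transition M.smooth_on_transition)

lemma open_ovT: "c \<in> A \<times> B \<Longrightarrow> d \<in> A \<times> B \<Longrightarrow> open (ovT c d)"
  and open_ovM: "c \<in> A \<times> B \<Longrightarrow> d \<in> A \<times> B \<Longrightarrow> open (ovM c d)"
  by (auto intro!: T.open_overlap M.open_overlap)

lemma trT_in: "c \<in> A \<times> B \<Longrightarrow> v \<in> ovT c d \<Longrightarrow> trT c d v \<in> ovT d c"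
  by (auto simp: trT_def mem_Times_iff)

text \<open>The classical change of jet coordinates, with the Jacobian of the inverse change on T
  evaluated at the new point. \<open>jtrans\<close> itself runs through chosen germs, so its
  smoothness becomes visible only in this form.\<close>

definition jform :: "('t, 'm, 'p, 'n) jchart \<Rightarrow> ('t, 'm, 'p, 'n) jchart \<Rightarrow> ('p, 'n) jc \<Rightarrow> ('p, 'n) jc" where
  "jform c d z = (trT c d (fst z), trM c d (fst (snd z)),
     \<chi> j \<beta>. \<Sum>k\<in>UNIV. \<Sum>\<gamma>\<in>UNIV. snd (snd z) $ k $ \<gamma> * pd (trM c d) (axis k 1) (fst (snd z)) $ j
        * pd (trT d c) (axis \<beta> 1) (trT c d (fst z)) $ \<gamma>)"

lemma jtrans_eq:
  assumes c: "c \<in> A \<times> B" and d: "d \<in> A \<times> B" and z: "z \<in> ovl c d"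
  shows "jtrans A B c d z = jform c d z"
proof -
  obtain a b where ab: "c = (a, b)" "a \<in> A" "b \<in> B" using c by auto
  obtain a' b' where ab': "d = (a', b')" "a' \<in> A" "b' \<in> B" using d by auto
  obtain e where e: "z = jcoord c e" "e \<in> jdom A B c" "e \<in> jdom A B d" using z by (auto simp: ovl_def)
  obtain f where f: "near (src e) f" "e = jet (src e) f" "tgt e = f (src e)"
    using e J1_cases jdom_iff by metis
  define t where "t = src e"
  have in1: "t \<in> fst a" "f t \<in> fst b" "t \<in> fst a'" "f t \<in> fst b'" and f': "near t f" "e = jet t f"
    using e f ab ab' by (auto simp: jdom_iff t_def)
  define x y where "x = snd b (f t)" and "y = snd (snd z)"
  have zc: "z = (snd a t, x, y)" "y = (\<chi> i \<alpha>. pd (local_rep a b f) (axis \<alpha> 1) (snd a t) $ i)"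
    using jcoord_jet[OF f'(1) ab(2,3) in1(1,2)] e(1) f'(2) ab(1) by (simp_all add: x_def y_def)
  \<comment> \<open>The matrix records derivatives along axes only; differentiability makes it the
    full derivative, which the chain rule needs in the direction coming from the chart change of
    T.\<close>
  have lr: "pd (local_rep a b f) v (snd a t) = y *v v" for v
    using pd_vec_expansion[OF local_rep_differentiable[OF f'(1) ab(2,3) in1(1,2)], of v]
    by (simp add: zc(2) vec_eq_iff matrix_vector_mult_def mult.commute)
  have tt: "trT c d (snd a t) = snd a' t" "trM c d x = snd b' (f t)"
    using in1 ab ab' by (simp_all add: trT_def trM_def x_def)
  have \<sigma>: "trM c d differentiable (at x)"
    using smooth_on_differentiable[OF smooth_on_trM[OF c d]] in1 ab ab' by (simp add: x_def)
  have "pd (local_rep a' b' f) (axis \<beta> 1) (snd a' t) $ j =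
     (\<Sum>k\<in>UNIV. \<Sum>\<gamma>\<in>UNIV. y $ k $ \<gamma> * pd (trM c d) (axis k 1) x $ j * pd (trT d c) (axis \<beta> 1) (snd a' t) $ \<gamma>)" for j \<beta>
  proof -
    have "pd (local_rep a' b' f) (axis \<beta> 1) (snd a' t) =
      pd (trM c d) (y *v pd (trT d c) (axis \<beta> 1) (snd a' t)) x"
      using pd_local_rep_change[OF f'(1) ab(2,3) in1(1,2) ab'(2,3) in1(3,4)]
      by (simp add: lr trM_def trT_def ab ab' x_def)
    also have "\<dots> = (\<Sum>k\<in>UNIV. (y *v pd (trT d c) (axis \<beta> 1) (snd a' t)) $ k *\<^sub>R pd (trM c d) (axis k 1) x)"
      by (rule pd_vec_expansion[OF \<sigma>])
    finally show ?thesis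
      by (simp add: matrix_vector_mult_def sum_distrib_left mult_ac)
  qed
  then have "jcoord d e = jform c d z"
    using jcoord_jet[OF f'(1) ab'(2,3) in1(3,4)] f'(2) ab' zc(1) tt by (simp add: jform_def)
  then show ?thesis using jtrans_jcoord[OF c e(2)] e by simp
qed

lemma smooth_on_comp_fst:
  assumes "open U" "open V" "smooth_on U (f :: real^'p \<Rightarrow> 'z::real_normed_vector)"
  shows "smooth_on {z :: ('p, 'n) jc. fst z \<in> U \<and> fst (snd z) \<in> V} (\<lambda>z. f (fst z))"
  using assms by (intro smooth_on_compose[OF open_product _ _ smooth_on_linear[OF bounded_linear_fst]]) auto

lemma smooth_on_comp_snd:
  assumes "open U" "open V" "smooth_on V (f :: real^'n \<Rightarrow> 'z::real_normed_vector)"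
  shows "smooth_on {z :: ('p, 'n) jc. fst z \<in> U \<and> fst (snd z) \<in> V} (\<lambda>z. f (fst (snd z)))"
  using assms
  by (intro smooth_on_compose[OF open_product _ _ smooth_on_linear[OF bounded_linear_fst_comp[OF bounded_linear_snd]]]) auto

lemma smooth_on_jform:
  assumes c: "c \<in> A \<times> B" and d: "d \<in> A \<times> B"
  shows "smooth_on (ovl c d) (jform c d)"
proof -
  note op = open_ovl[OF c d]
  have 1: "smooth_on (ovl c d) (\<lambda>z. trT c d (fst z))"
    unfolding ovl_eq[OF c] by (rule smooth_on_comp_fst[OF open_ovT[OF c d] open_ovM[OF c d] smooth_on_trT[OF c d]])
  have 2: "smooth_on (ovl c d) (\<lambda>z. trM c d (fst (snd z)))"
    unfolding ovl_eq[OF c] by (rule smooth_on_comp_snd[OF open_ovT[OF c d] open_ovM[OF c d] smooth_on_trM[OF c d]])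
  have 3: "smooth_on (ovl c d) (\<lambda>z. pd (trM c d) v (fst (snd z)))" for v
    unfolding ovl_eq[OF c]
    by (rule smooth_on_comp_snd[OF open_ovT[OF c d] open_ovM[OF c d] smooth_on_pd[OF open_ovM[OF c d] smooth_on_trM[OF c d]]])
  have "smooth_on (ovT c d) (\<lambda>t. pd (trT d c) v (trT c d t))" for v
    by (rule smooth_on_compose[OF open_ovT[OF c d] open_ovT[OF d c] _ smooth_on_trT[OF c d]
          smooth_on_pd[OF open_ovT[OF d c] smooth_on_trT[OF d c]]]) (auto intro!: trT_in[OF c])
  then have 4: "smooth_on (ovl c d) (\<lambda>z. pd (trT d c) v (trT c d (fst z)))" for v
    unfolding ovl_eq[OF c] by (rule smooth_on_comp_fst[OF open_ovT[OF c d] open_ovM[OF c d]])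
  note comp = smooth_on_linear_compose[OF op bounded_linear_vec_nth]
  have 5: "smooth_on (ovl c d) (\<lambda>z. \<chi> j \<beta>. \<Sum>k\<in>UNIV. \<Sum>\<gamma>\<in>UNIV. snd (snd z) $ k $ \<gamma> * pd (trM c d) (axis k 1) (fst (snd z)) $ j
        * pd (trT d c) (axis \<beta> 1) (trT c d (fst z)) $ \<gamma>)"
    by (intro smooth_on_vec op; simp, intro smooth_on_sum smooth_on_mult op comp 3 4 smooth_on_linear[OF bounded_linear_cy[unfolded cy_def]])
  show ?thesis
    unfolding jform_def by (intro smooth_on_Pair op 1 2 5)
qed

lemma smooth_on_jtrans:
  assumes c: "c \<in> A \<times> B" and d: "d \<in> A \<times> B"
  shows "smooth_on (ovl c d) (jtrans A B c d)"
  by (rule smooth_on_transform[OF open_ovl[OF c d] smooth_on_jform[OF c d]]) (simp add: jtrans_eq[OF c d])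

lemma jtrans_differentiable:
  assumes "c \<in> A \<times> B" "d \<in> A \<times> B" "e \<in> jdom A B c" "e \<in> jdom A B d"
  shows "jtrans A B c d differentiable (at (jcoord c e))"
  using smooth_on_differentiable[OF smooth_on_jtrans] jcoord_in_ovl assms by blast

text \<open>Cocycle rule of the Jacobians: it is what \<open>tangent_space\<close> demands of a
  vector pushed forward from one chart to all others.\<close>

lemma pd_jtrans_comp:
  assumes c: "c \<in> A \<times> B" and d: "d \<in> A \<times> B" and d': "d' \<in> A \<times> B"
    and e: "e \<in> jdom A B c" "e \<in> jdom A B d" "e \<in> jdom A B d'"
  shows "pd (jtrans A B d d') (pd (jtrans A B c d) v (jcoord c e)) (jcoord d e) =
    pd (jtrans A B c d') v (jcoord c e)"
proof -
  have "pd (\<lambda>z. jtrans A B d d' (jtrans A B c d z)) v (jcoord c e) = pd (jtrans A B c d') v (jcoord c e)"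
  proof (rule pd_cong)
    show "open (ovl c d)" "jcoord c e \<in> ovl c d" using open_ovl[OF c d] jcoord_in_ovl e by auto
    show "jtrans A B d d' (jtrans A B c d z) = jtrans A B c d' z" if "z \<in> ovl c d" for z
      using that c d by (auto simp: ovl_def jtrans_jcoord)
  qed
  moreover have "jtrans A B c d (jcoord c e) = jcoord d e" using jtrans_jcoord[OF c e(1)] .
  ultimately show ?thesis
    using pd_compose[OF jtrans_differentiable[OF c d e(1,2)], of "jtrans A B d d'" v]
      jtrans_differentiable[OF d d' e(2,3)] by simp
qed

lemma pd_jtrans_self:
  assumes c: "c \<in> A \<times> B" and e: "e \<in> jdom A B c"
  shows "pd (jtrans A B c c) v (jcoord c e) = v"
proof -
  have "pd (jtrans A B c c) v (jcoord c e) = pd (\<lambda>z. z) v (jcoord c e)"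
    by (rule pd_cong[OF open_jimg[OF c] jcoord_in_jimg[OF e]]) (simp add: jtrans_def)
  then show ?thesis by (simp add: pd_bounded_linear bounded_linear_ident)
qed

text \<open>The new t depends on t alone and the new x on x alone, so the Jacobian has separate
  blocks on T and on M.\<close>

lemma fst_pd_jtrans:
  assumes c: "c \<in> A \<times> B" and d: "d \<in> A \<times> B" and e: "e \<in> jdom A B c" "e \<in> jdom A B d"
  shows "fst (pd (jtrans A B c d) v (jcoord c e)) = pd (trT c d) (fst v) (fst (jcoord c e))"
    and "fst (snd (pd (jtrans A B c d) v (jcoord c e))) = pd (trM c d) (fst (snd v)) (fst (snd (jcoord c e)))"
proof -
  have z: "jcoord c e \<in> ovl c d" using jcoord_in_ovl e by blast
  then have in1: "fst (jcoord c e) \<in> ovT c d" "fst (snd (jcoord c e)) \<in> ovM c d"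
    by (auto simp: ovl_eq[OF c])
  note dj = jtrans_differentiable[OF c d e]
  have l2: "bounded_linear (\<lambda>z::('p,'n) jc. fst (snd z))"
    by (rule bounded_linear_fst_comp[OF bounded_linear_snd])
  have "fst (pd (jtrans A B c d) v (jcoord c e)) = pd (\<lambda>z. fst (jtrans A B c d z)) v (jcoord c e)"
    by (simp add: pd_linear_compose[OF bounded_linear_fst dj])
  also have "\<dots> = pd (\<lambda>z. trT c d (fst z)) v (jcoord c e)"
    by (rule pd_cong[OF open_ovl[OF c d] z]) (simp add: jtrans_eq[OF c d] jform_def)
  also have "\<dots> = pd (trT c d) (fst v) (fst (jcoord c e))"
    using pd_compose[of fst "jcoord c e" "trT c d" v] smooth_on_differentiable[OF smooth_on_trT[OF c d] in1(1)]
    by (simp add: bounded_linear_imp_differentiable bounded_linear_fst pd_bounded_linear)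
  finally show "fst (pd (jtrans A B c d) v (jcoord c e)) = pd (trT c d) (fst v) (fst (jcoord c e))" .
  have "fst (snd (pd (jtrans A B c d) v (jcoord c e))) = pd (\<lambda>z. fst (snd (jtrans A B c d z))) v (jcoord c e)"
    by (simp add: pd_linear_compose[OF l2 dj])
  also have "\<dots> = pd (\<lambda>z. trM c d (fst (snd z))) v (jcoord c e)"
    by (rule pd_cong[OF open_ovl[OF c d] z]) (simp add: jtrans_eq[OF c d] jform_def)
  also have "\<dots> = pd (trM c d) (fst (snd v)) (fst (snd (jcoord c e)))"
    using pd_compose[of "\<lambda>z. fst (snd z)" "jcoord c e" "trM c d" v] smooth_on_differentiable[OF smooth_on_trM[OF c d] in1(2)]
    by (simp add: bounded_linear_imp_differentiable l2 pd_bounded_linear[OF l2])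
  finally show "fst (snd (pd (jtrans A B c d) v (jcoord c e))) = pd (trM c d) (fst (snd v)) (fst (snd (jcoord c e)))" .
qed

text \<open>Within a fibre the coordinate change is linear, so its derivative in a vertical
  direction is read off from the coefficients.\<close>

lemma cy_pd_jtrans_vertical:
  assumes c: "c \<in> A \<times> B" and d: "d \<in> A \<times> B" and e: "e \<in> jdom A B c" "e \<in> jdom A B d"
  shows "snd (snd (pd (jtrans A B c d) (ey k \<gamma>) (jcoord c e))) $ j $ \<beta> =
    pd (trM c d) (axis k 1) (fst (snd (jcoord c e))) $ j * pd (trT d c) (axis \<beta> 1) (fst (jcoord d e)) $ \<gamma>"
proof -
  define z where "z = jcoord c e"
  have z: "z \<in> ovl c d" using jcoord_in_ovl e by (simp add: z_def)
  note dj = jtrans_differentiable[OF c d e, folded z_def]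
  \<comment> \<open>The fibre part of the coordinate change with the base point frozen at z.\<close>
  define L where "L u = (\<Sum>k\<in>UNIV. \<Sum>\<gamma>\<in>UNIV. snd (snd u) $ k $ \<gamma> * pd (trM c d) (axis k 1) (fst (snd z)) $ j
        * pd (trT d c) (axis \<beta> 1) (trT c d (fst z)) $ \<gamma>)" for u :: "('p, 'n) jc"
  have L: "bounded_linear L"
    unfolding L_def by (intro bounded_linear_sum bounded_linear_mult_const bounded_linear_cy[unfolded cy_def])
  have line: "((\<lambda>s. z + s *\<^sub>R ey k \<gamma>) has_derivative (\<lambda>r. r *\<^sub>R ey k \<gamma>)) (at (0::real))"
    by (auto intro!: derivative_eq_intros)
  have dl: "(\<lambda>s. z + s *\<^sub>R ey k \<gamma>) differentiable (at (0::real))"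
    using line by (auto simp: differentiable_def)
  have in2: "z + s *\<^sub>R ey k \<gamma> \<in> ovl c d" for s
    using z by (simp add: ovl_eq[OF c] ey_def)
  have eq: "snd (snd (jtrans A B c d (z + s *\<^sub>R ey k \<gamma>))) $ j $ \<beta> = L (z + s *\<^sub>R ey k \<gamma>)" for s
    unfolding jtrans_eq[OF c d in2] jform_def L_def by (simp add: ey_def)
  have "snd (snd (pd (jtrans A B c d) (ey k \<gamma>) z)) $ j $ \<beta> = pd (\<lambda>u. snd (snd (jtrans A B c d u)) $ j $ \<beta>) (ey k \<gamma>) z"
    by (simp add: pd_linear_compose[OF bounded_linear_cy[unfolded cy_def] dj])
  \<comment> \<open>L is compared with the coordinate change only along a vertical line, where the
    base coordinates stay fixed, so the derivative is first rewritten as one along that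
    line.\<close>
  also have "\<dots> = pd (\<lambda>s. snd (snd (jtrans A B c d (z + s *\<^sub>R ey k \<gamma>))) $ j $ \<beta>) 1 (0::real)"
  proof -
    have "(\<lambda>u. snd (snd (jtrans A B c d u)) $ j $ \<beta>) differentiable (at (z + 0 *\<^sub>R ey k \<gamma>))"
      using bounded_linear.has_derivative[OF bounded_linear_cy[unfolded cy_def] has_derivative_pd[OF dj]] by (auto simp: differentiable_def)
    from pd_compose[OF dl this, of 1] show ?thesis by (simp add: pd_eqI[OF line])
  qed
  also have "\<dots> = pd (\<lambda>s. L (z + s *\<^sub>R ey k \<gamma>)) 1 (0::real)" by (simp add: eq)
  also have "\<dots> = L (ey k \<gamma>)"
    using pd_linear_compose[OF L dl, of 1] by (simp add: pd_eqI[OF line])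
  also have "\<dots> = pd (trM c d) (axis k 1) (fst (snd z)) $ j * pd (trT d c) (axis \<beta> 1) (trT c d (fst z)) $ \<gamma>"
  proof -
    have "axis k (axis \<gamma> 1) $ k' $ \<gamma>' = (if k' = k then if \<gamma>' = \<gamma> then 1 else 0 else (0::real))" for k' \<gamma>'
      by (simp add: axis_def)
    then have "L (ey k \<gamma>) = (\<Sum>k'\<in>UNIV. if k' = k then
       pd (trM c d) (axis k' 1) (fst (snd z)) $ j * pd (trT d c) (axis \<beta> 1) (trT c d (fst z)) $ \<gamma> else 0)"
      unfolding L_def by (intro sum.cong refl) (simp add: ey_def mult_delta_left)
    then show ?thesis by simp
  qed
  also have "trT c d (fst z) = fst (jcoord d e)"
    using jtrans_eq[OF c d z] jtrans_jcoord[OF c e(1), of d] by (simp add: jform_def z_def)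
  finally show ?thesis by (simp add: z_def)
qed

end

subsection \<open>Extension of local fields\<close>

context jet_manifolds
begin

abbreviation VF :: "('t, 'm, 'p, 'n) vfield set" where "VF \<equiv> vector_fields A B"

lemma vf_change:
  "Y \<in> VF \<Longrightarrow> c \<in> A \<times> B \<Longrightarrow> d \<in> A \<times> B \<Longrightarrow> e \<in> jdom A B c \<Longrightarrow> e \<in> jdom A B d
    \<Longrightarrow> Y e d = pd (jtrans A B c d) (Y e c) (jcoord c e)"
  unfolding vector_fields_def tangent_space_def by blast

lemma vf_outside: "Y \<in> VF \<Longrightarrow> c \<notin> A \<times> B \<or> e \<notin> jdom A B c \<Longrightarrow> Y e c = 0"
  unfolding vector_fields_def tangent_space_def by blast

lemma vf_smooth: "Y \<in> VF \<Longrightarrow> c \<in> A \<times> B \<Longrightarrow> smooth_on (jimg A B c) (vf_local A B c Y)"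
  unfolding vector_fields_def vf_local_def[abs_def] by blast

lemma vfI:
  assumes "\<And>c d e. c \<in> A \<times> B \<Longrightarrow> d \<in> A \<times> B \<Longrightarrow> e \<in> jdom A B c \<Longrightarrow> e \<in> jdom A B d
      \<Longrightarrow> Y e d = pd (jtrans A B c d) (Y e c) (jcoord c e)"
    and "\<And>c e. c \<notin> A \<times> B \<or> e \<notin> jdom A B c \<Longrightarrow> Y e c = 0"
    and "\<And>c. c \<in> A \<times> B \<Longrightarrow> smooth_on (jimg A B c) (vf_local A B c Y)"
  shows "Y \<in> VF"
  using assms unfolding vector_fields_def tangent_space_def vf_local_def[abs_def] by blast

lemma vf_add:
  assumes "Y \<in> VF" "Z \<in> VF"
  shows "(\<lambda>e c. Y e c + Z e c) \<in> VF"
proof (rule vfI)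
  fix c d e assume c: "c \<in> A \<times> B" and d: "d \<in> A \<times> B" and e: "e \<in> jdom A B c" "e \<in> jdom A B d"
  show "Y e d + Z e d = pd (jtrans A B c d) (Y e c + Z e c) (jcoord c e)"
    by (simp add: pd_dir_add[OF jtrans_differentiable[OF c d e]]
        vf_change[OF assms(1) c d e] vf_change[OF assms(2) c d e])
next
  show "Y e c + Z e c = 0" if "c \<notin> A \<times> B \<or> e \<notin> jdom A B c" for e c
    using vf_outside[OF assms(1) that] vf_outside[OF assms(2) that] by simp
next
  fix c assume c: "c \<in> A \<times> B"
  show "smooth_on (jimg A B c) (vf_local A B c (\<lambda>e c. Y e c + Z e c))"
    using smooth_on_add[OF open_jimg[OF c] vf_smooth[OF assms(1) c] vf_smooth[OF assms(2) c]]
    by (simp add: vf_local_def[abs_def])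
qed

lemma smooth_functionsD:
  "F \<in> smooth_functions A B \<Longrightarrow> c \<in> A \<times> B \<Longrightarrow> smooth_on (jimg A B c) (\<lambda>z. F (jinv A B c z))"
  unfolding smooth_functions_def comp_def by blast

lemma vf_scale:
  assumes "F \<in> smooth_functions A B" "Y \<in> VF"
  shows "(\<lambda>e c. F e *\<^sub>R Y e c) \<in> VF"
proof (rule vfI)
  fix c d e assume c: "c \<in> A \<times> B" and d: "d \<in> A \<times> B" and e: "e \<in> jdom A B c" "e \<in> jdom A B d"
  show "F e *\<^sub>R Y e d = pd (jtrans A B c d) (F e *\<^sub>R Y e c) (jcoord c e)"
    by (simp add: pd_dir_scale[OF jtrans_differentiable[OF c d e]] vf_change[OF assms(2) c d e])
next
  show "F e *\<^sub>R Y e c = 0" if "c \<notin> A \<times> B \<or> e \<notin> jdom A B c" for e c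
    using vf_outside[OF assms(2) that] by simp
next
  fix c assume c: "c \<in> A \<times> B"
  show "smooth_on (jimg A B c) (vf_local A B c (\<lambda>e c. F e *\<^sub>R Y e c))"
    using smooth_on_scaleR[OF open_jimg[OF c] smooth_functionsD[OF assms(1) c] vf_smooth[OF assms(2) c]]
    by (simp add: vf_local_def[abs_def])
qed

text \<open>The components y in c, pushed forward to every other chart and continued by zero.
  Membership in \<open>VF\<close> is proved for y supported in a compact subset of the chart
  image.\<close>

definition extend_vf :: "('t, 'm, 'p, 'n) jchart \<Rightarrow> (('p, 'n) jc \<Rightarrow> ('p, 'n) jc) \<Rightarrow> ('t, 'm, 'p, 'n) vfield" where
  "extend_vf c y = (\<lambda>e d. if d \<in> A \<times> B \<and> e \<in> jdom A B d \<and> e \<in> jdom A B c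
     then pd (jtrans A B c d) (y (jcoord c e)) (jcoord c e) else 0)"

definition extend_fun :: "('t, 'm, 'p, 'n) jchart \<Rightarrow> (('p, 'n) jc \<Rightarrow> real) \<Rightarrow> ('t, 'm) jet \<Rightarrow> real" where
  "extend_fun c f e = (if e \<in> jdom A B c then f (jcoord c e) else 0)"

text \<open>Replaces the statement that a compact set in one chart is closed in the jet bundle. The
  projections of K to T and M are compact, so their complements are open. A point of the image of d
  outside the overlap has source or target outside the charts of c, hence in one of these
  complements; conversely a jet with coordinates in K has both its source and its target in the
  projections.\<close>

lemma cover_chart:
  assumes c: "c \<in> A \<times> B" and d: "d \<in> A \<times> B" and K: "compact K" "K \<subseteq> jimg A B c"
  obtains Q where "open Q" "jimg A B d \<subseteq> ovl d c \<union> Q"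
    "\<And>e. e \<in> jdom A B d \<Longrightarrow> e \<in> jdom A B c \<Longrightarrow> jcoord d e \<in> Q \<Longrightarrow> jcoord c e \<notin> K"
proof -
  obtain a b where ab: "c = (a, b)" "a \<in> A" "b \<in> B" using c by auto
  obtain a' b' where ab': "d = (a', b')" "a' \<in> A" "b' \<in> B" using d by auto
  let ?KT = "fst ` K" and ?KM = "(\<lambda>z. fst (snd z)) ` K"
  let ?OT = "topspace T - chart_inv a ` ?KT" and ?OM = "topspace Mf - chart_inv b ` ?KM"
  have KT: "compact ?KT" "?KT \<subseteq> snd a ` fst a" and KM: "compact ?KM" "?KM \<subseteq> snd b ` fst b"
    using K(2) jimg_eq[OF c] ab by (auto intro!: compact_continuous_image continuous_intros K(1))
  let ?Q1 = "{z :: ('p, 'n) jc. fst z \<in> snd a' ` (fst a' \<inter> ?OT) \<and> fst (snd z) \<in> snd b' ` fst b'}"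
  let ?Q2 = "{z :: ('p, 'n) jc. fst z \<in> snd a' ` fst a' \<and> fst (snd z) \<in> snd b' ` (fst b' \<inter> ?OM)}"
  show ?thesis
  proof (rule that[of "?Q1 \<union> ?Q2"])
    show "open (?Q1 \<union> ?Q2)"
      by (intro open_Un open_product T.open_chart_image_Int M.open_chart_image_Int T.open_chart_image
          M.open_chart_image T.openin_compl_chart_compact M.openin_compl_chart_compact KT KM ab ab')
    show "jimg A B d \<subseteq> ovl d c \<union> (?Q1 \<union> ?Q2)"
    proof
      fix z assume z: "z \<in> jimg A B d"
      have zd: "fst z \<in> snd a' ` fst a'" "fst (snd z) \<in> snd b' ` fst b'"
        using z jimg_eq[OF d] ab' by auto
      have in1: "chart_inv a' (fst z) \<in> topspace T" "chart_inv b' (fst (snd z)) \<in> topspace Mf"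
        using zd ab' by (auto simp: T.topspace_eq M.topspace_eq)
      show "z \<in> ovl d c \<union> (?Q1 \<union> ?Q2)"
      proof (cases "chart_inv a' (fst z) \<in> fst a \<and> chart_inv b' (fst (snd z)) \<in> fst b")
        case True
        then have "z \<in> ovl d c"
          using zd ab ab' ovl_eq[OF d, of c] by (simp add: T.overlap_iff M.overlap_iff)
        then show ?thesis by blast
      next
        case False
        moreover have "chart_inv a ` ?KT \<subseteq> fst a" "chart_inv b ` ?KM \<subseteq> fst b"
          using KT(2) KM(2) by (auto dest!: subsetD)
        ultimately have "chart_inv a' (fst z) \<in> ?OT \<or> chart_inv b' (fst (snd z)) \<in> ?OM"
          using in1 by blast
        then have "z \<in> ?Q1 \<union> ?Q2"
          using zd ab' by (simp add: T.overlap_iff M.overlap_iff)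
        then show ?thesis by blast
      qed
    qed
    fix e assume e: "e \<in> jdom A B d" "e \<in> jdom A B c" "jcoord d e \<in> ?Q1 \<union> ?Q2"
    have st: "src e \<in> fst a'" "tgt e \<in> fst b'" "src e \<in> fst a" "tgt e \<in> fst b"
      using e ab ab' by (auto simp: jdom_iff)
    have f: "fst (jcoord d e) = snd a' (src e)" "fst (snd (jcoord d e)) = snd b' (tgt e)"
      "fst (jcoord c e) = snd a (src e)" "fst (snd (jcoord c e)) = snd b (tgt e)"
      using ab ab' by (simp_all add: fst_jcoord fst_snd_jcoord)
    show "jcoord c e \<notin> K"
    proof
      assume "jcoord c e \<in> K"
      then have "snd a (src e) \<in> ?KT" "snd b (tgt e) \<in> ?KM" using f by (metis image_eqI)+
      then have "src e \<in> chart_inv a ` ?KT" "tgt e \<in> chart_inv b ` ?KM"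
        using st ab by (metis T.chart_inv_chart image_eqI, metis M.chart_inv_chart image_eqI)
      moreover have "src e \<in> ?OT \<or> tgt e \<in> ?OM"
        using e(3) f st ab' by (auto simp: T.overlap_iff M.overlap_iff simp del: Diff_iff)
      ultimately show False by blast
    qed
  qed
qed

text \<open>In another chart the extension is a composite with the coordinate change on the overlap
  and vanishes on Q; both are open and cover the chart.\<close>

lemma extend_fun_smooth:
  assumes c: "c \<in> A \<times> B" and f: "smooth_on (jimg A B c) f"
    and K: "compact K" "K \<subseteq> jimg A B c" "\<And>z. z \<notin> K \<Longrightarrow> f z = 0"
  shows "extend_fun c f \<in> smooth_functions A B"
  unfolding smooth_functions_def comp_def
proof (rule CollectI, rule ballI)
  fix d assume d: "d \<in> A \<times> B"
  obtain Q where Q: "open Q" "jimg A B d \<subseteq> ovl d c \<union> Q"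
    "\<And>e. e \<in> jdom A B d \<Longrightarrow> e \<in> jdom A B c \<Longrightarrow> jcoord d e \<in> Q \<Longrightarrow> jcoord c e \<notin> K"
    by (rule cover_chart[OF c d K(1,2)]) (rule that)
  let ?g = "\<lambda>z. extend_fun c f (jinv A B d z)"
  have 1: "smooth_on (ovl d c) ?g"
  proof (rule smooth_on_transform[OF open_ovl[OF d c]])
    show "smooth_on (ovl d c) (\<lambda>z. f (jtrans A B d c z))"
      by (rule smooth_on_compose[OF open_ovl[OF d c] open_jimg[OF c] _ smooth_on_jtrans[OF d c] f])
        (use jtrans_in_ovl[OF d] ovl_subset in blast)
    show "f (jtrans A B d c z) = ?g z" if "z \<in> ovl d c" for z
      using jinv_in_ovl[OF d that] by (simp add: extend_fun_def jtrans_def)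
  qed
  have 2: "smooth_on (Q \<inter> jimg A B d) ?g"
  proof (rule smooth_on_transform[OF open_Int[OF Q(1) open_jimg[OF d]] smooth_on_const[of _ 0]])
    show "0 = ?g z" if "z \<in> Q \<inter> jimg A B d" for z
      using that Q(3)[of "jinv A B d z"] K(3) by (auto simp: extend_fun_def)
  qed
  show "smooth_on (jimg A B d) ?g"
  proof (rule smooth_on_local)
    fix z assume "z \<in> jimg A B d"
    then show "\<exists>W. open W \<and> z \<in> W \<and> smooth_on W ?g"
      using 1 2 Q(2) open_ovl[OF d c] open_Int[OF Q(1) open_jimg[OF d]] by blast
  qed
qed

lemma extend_vf_in_VF:
  assumes c: "c \<in> A \<times> B" and y: "smooth_on (jimg A B c) y"
    and K: "compact K" "K \<subseteq> jimg A B c" "\<And>z. z \<notin> K \<Longrightarrow> y z = 0"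
  shows "extend_vf c y \<in> VF"
proof (rule vfI)
  fix d d' e assume d: "d \<in> A \<times> B" "d' \<in> A \<times> B" and e: "e \<in> jdom A B d" "e \<in> jdom A B d'"
  show "extend_vf c y e d' = pd (jtrans A B d d') (extend_vf c y e d) (jcoord d e)"
    using pd_jtrans_comp[OF c d _ e] jtrans_differentiable[OF d e] d e by (simp add: extend_vf_def)
next
  show "extend_vf c y e d = 0" if "d \<notin> A \<times> B \<or> e \<notin> jdom A B d" for e d
    using that by (auto simp: extend_vf_def)
next
  fix d assume d: "d \<in> A \<times> B"
  obtain Q where Q: "open Q" "jimg A B d \<subseteq> ovl d c \<union> Q"
    "\<And>e. e \<in> jdom A B d \<Longrightarrow> e \<in> jdom A B c \<Longrightarrow> jcoord d e \<in> Q \<Longrightarrow> jcoord c e \<notin> K"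
    by (rule cover_chart[OF c d K(1,2)]) (rule that)
  let ?g = "vf_local A B d (extend_vf c y)"
  have 1: "smooth_on (ovl d c) ?g"
  proof (rule smooth_on_transform[OF open_ovl[OF d c]])
    have "smooth_on (ovl c d) (\<lambda>w. pd (jtrans A B c d) (y w) w)"
      by (intro smooth_on_pd_field open_ovl c d smooth_on_jtrans smooth_on_subset[OF y] ovl_subset)
    then show "smooth_on (ovl d c) (\<lambda>z. pd (jtrans A B c d) (y (jtrans A B d c z)) (jtrans A B d c z))"
      by (rule smooth_on_compose[OF open_ovl[OF d c] open_ovl[OF c d] _ smooth_on_jtrans[OF d c], rotated])
        (use jtrans_in_ovl[OF d] in blast)
    show "pd (jtrans A B c d) (y (jtrans A B d c z)) (jtrans A B d c z) = ?g z" if "z \<in> ovl d c" for z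
      using jinv_in_ovl[OF d that] d subsetD[OF ovl_subset that]
      by (simp add: extend_vf_def vf_local_def jtrans_def[of _ _ d c])
  qed
  have 2: "smooth_on (Q \<inter> jimg A B d) ?g"
  proof (rule smooth_on_transform[OF open_Int[OF Q(1) open_jimg[OF d]] smooth_on_const[of _ 0]])
    \<comment> \<open>Two reasons for vanishing: in the domain of c the point avoids the support K,
      and outside that domain the extension is zero by definition.\<close>
    show "0 = ?g z" if z: "z \<in> Q \<inter> jimg A B d" for z
    proof (cases "jinv A B d z \<in> jdom A B c")
      case True
      then have "y (jcoord c (jinv A B d z)) = 0"
        using z Q(3)[of "jinv A B d z"] K(3) by auto
      then show ?thesis
        using jtrans_differentiable[OF c d True] z by (simp add: extend_vf_def vf_local_def)
    qed (simp add: extend_vf_def vf_local_def)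
  qed
  show "smooth_on (jimg A B d) ?g"
  proof (rule smooth_on_local)
    fix z assume "z \<in> jimg A B d"
    then show "\<exists>W. open W \<and> z \<in> W \<and> smooth_on W ?g"
      using 1 2 Q(2) open_ovl[OF d c] open_Int[OF Q(1) open_jimg[OF d]] by blast
  qed
qed

lemma vf_local_extend:
  "c \<in> A \<times> B \<Longrightarrow> z \<in> jimg A B c \<Longrightarrow> vf_local A B c (extend_vf c y) z = y z"
  using pd_jtrans_self[of c "jinv A B c z"] by (simp add: vf_local_def extend_vf_def)

lemma chart_bump:
  assumes c: "c \<in> A \<times> B" and W: "open W" "w \<in> W" "W \<subseteq> jimg A B c"
  obtains h V K where "smooth_on UNIV h" "open V" "w \<in> V" "V \<subseteq> jimg A B c" "\<And>z. z \<in> V \<Longrightarrow> h z = (1::real)"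
    "compact K" "K \<subseteq> W" "\<And>z. z \<notin> K \<Longrightarrow> h z = 0" "extend_fun c h \<in> smooth_functions A B"
proof -
  obtain h V K where h: "smooth_on UNIV h" "open V" "w \<in> V" "\<And>z. z \<in> V \<Longrightarrow> h z = (1::real)"
    "compact K" "K \<subseteq> W" "\<And>z. z \<notin> K \<Longrightarrow> h z = 0"
    using smooth_bump[OF W(1,2)] by metis
  have "extend_fun c h \<in> smooth_functions A B"
    by (rule extend_fun_smooth[OF c smooth_on_subset[OF h(1)] h(5) _ h(7)]) (use h W in auto)
  then show ?thesis
    by (intro that[of h "V \<inter> W" K]) (use h W in auto)
qed

text \<open>V and h are chosen before y and f. The rules for a connection compare extensions of
  several fields and functions, and these must be valid on a common neighbourhood.\<close>

lemma local_extension: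
  assumes c: "c \<in> A \<times> B" and w: "w \<in> jimg A B c"
  obtains V h where "open V" "w \<in> V" "V \<subseteq> jimg A B c"
    "\<And>y. smooth_on (jimg A B c) y \<Longrightarrow> extend_vf c (\<lambda>z. h z *\<^sub>R y z) \<in> VF"
    "\<And>y z. smooth_on (jimg A B c) y \<Longrightarrow> z \<in> V \<Longrightarrow> vf_local A B c (extend_vf c (\<lambda>z. h z *\<^sub>R y z)) z = y z"
    "\<And>f. smooth_on (jimg A B c) f \<Longrightarrow> extend_fun c (\<lambda>z. h z * f z) \<in> smooth_functions A B"
    "\<And>f z. smooth_on (jimg A B c) f \<Longrightarrow> z \<in> V \<Longrightarrow> extend_fun c (\<lambda>z. h z * f z) (jinv A B c z) = f z"
proof -
  obtain h V K where h: "smooth_on UNIV h" "open V" "w \<in> V" "V \<subseteq> jimg A B c" "\<And>z. z \<in> V \<Longrightarrow> h z = (1::real)"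
    "compact K" "K \<subseteq> jimg A B c" "\<And>z. z \<notin> K \<Longrightarrow> h z = 0"
    using chart_bump[OF c open_jimg[OF c] w subset_refl] by metis
  have h': "smooth_on (jimg A B c) h" using h(1) smooth_on_subset by blast
  note op = open_jimg[OF c]
  show ?thesis
  proof (rule that[OF h(2,3,4)])
    show "extend_vf c (\<lambda>z. h z *\<^sub>R y z) \<in> VF" if "smooth_on (jimg A B c) y" for y
      by (rule extend_vf_in_VF[OF c smooth_on_scaleR[OF op h' that] h(6,7)]) (simp add: h(8))
    show "vf_local A B c (extend_vf c (\<lambda>z. h z *\<^sub>R y z)) z = y z" if "z \<in> V" for y z
      using vf_local_extend[OF c] h(4,5) that by (simp add: subsetD)
    show "extend_fun c (\<lambda>z. h z * f z) \<in> smooth_functions A B" if "smooth_on (jimg A B c) f" for f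
      by (rule extend_fun_smooth[OF c smooth_on_mult[OF op h' that] h(6,7)]) (simp add: h(8))
    show "extend_fun c (\<lambda>z. h z * f z) (jinv A B c z) = f z" if "z \<in> V" for f z
      using h(4,5) that by (simp add: extend_fun_def subsetD)
  qed
qed

text \<open>Existence of an extension turns the choice in \<open>globalize\<close> into a field with
  the prescribed germ.\<close>

lemma globalize:
  assumes c: "c \<in> A \<times> B" and w: "w \<in> jimg A B c" and y: "smooth_on (jimg A B c) y"
  obtains W where "globalize A B c y w \<in> VF" "open W" "w \<in> W" "W \<subseteq> jimg A B c"
    "\<And>z. z \<in> W \<Longrightarrow> vf_local A B c (globalize A B c y w) z = y z"
proof -
  let ?P = "\<lambda>Y. Y \<in> VF \<and>
        (\<exists>W. open W \<and> w \<in> W \<and> W \<subseteq> jimg A B c \<and> (\<forall>z\<in>W. vf_local A B c Y z = y z))"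
  obtain V h where "open V" "w \<in> V" "V \<subseteq> jimg A B c"
    "\<And>y. smooth_on (jimg A B c) y \<Longrightarrow> extend_vf c (\<lambda>z. h z *\<^sub>R y z) \<in> VF"
    "\<And>y z. smooth_on (jimg A B c) y \<Longrightarrow> z \<in> V \<Longrightarrow> vf_local A B c (extend_vf c (\<lambda>z. h z *\<^sub>R y z)) z = y z"
    by (rule local_extension[OF c w]) (rule that; assumption)
  then have "?P (extend_vf c (\<lambda>z. h z *\<^sub>R y z))" using y by blast
  then have "?P (globalize A B c y w)" unfolding globalize_def by (rule someI[of ?P])
  then show ?thesis using that by blast
qed

end

subsection \<open>Localization of a connection\<close>

locale jet_connection = jet_manifolds T Mf A B
  for T :: "'t topology" and Mf :: "'m topology"
    and A :: "('t, real^'p::finite) chart set" and B :: "('m, real^'n::finite) chart set" +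
  fixes nabla :: "('t, 'm, 'p, 'n) vfield \<Rightarrow> ('t, 'm, 'p, 'n) vfield \<Rightarrow> ('t, 'm, 'p, 'n) vfield"
  assumes linear_connection: "linear_connection A B nabla"
begin

lemma nabla_VF: "Y \<in> VF \<Longrightarrow> Z \<in> VF \<Longrightarrow> nabla Y Z \<in> VF"
  using linear_connection unfolding linear_connection_def by blast

lemma nabla_add1: "Y \<in> VF \<Longrightarrow> Y' \<in> VF \<Longrightarrow> Z \<in> VF
    \<Longrightarrow> nabla (\<lambda>e c. Y e c + Y' e c) Z e c = nabla Y Z e c + nabla Y' Z e c"
proof -
  assume "Y \<in> VF" "Y' \<in> VF" "Z \<in> VF"
  then have "nabla (\<lambda>e c. Y e c + Y' e c) Z = (\<lambda>e c. nabla Y Z e c + nabla Y' Z e c)"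
    using linear_connection unfolding linear_connection_def by blast
  then show ?thesis by simp
qed

lemma nabla_scale1: "F \<in> smooth_functions A B \<Longrightarrow> Y \<in> VF \<Longrightarrow> Z \<in> VF
    \<Longrightarrow> nabla (\<lambda>e c. F e *\<^sub>R Y e c) Z e c = F e *\<^sub>R nabla Y Z e c"
proof -
  assume "F \<in> smooth_functions A B" "Y \<in> VF" "Z \<in> VF"
  then have "nabla (\<lambda>e c. F e *\<^sub>R Y e c) Z = (\<lambda>e c. F e *\<^sub>R nabla Y Z e c)"
    using linear_connection unfolding linear_connection_def by blast
  then show ?thesis by simp
qed

lemma nabla_add2: "Y \<in> VF \<Longrightarrow> Z \<in> VF \<Longrightarrow> Z' \<in> VF
    \<Longrightarrow> nabla Y (\<lambda>e c. Z e c + Z' e c) e c = nabla Y Z e c + nabla Y Z' e c"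
proof -
  assume "Y \<in> VF" "Z \<in> VF" "Z' \<in> VF"
  then have "nabla Y (\<lambda>e c. Z e c + Z' e c) = (\<lambda>e c. nabla Y Z e c + nabla Y Z' e c)"
    using linear_connection unfolding linear_connection_def by blast
  then show ?thesis by simp
qed

lemma nabla_leibniz: "F \<in> smooth_functions A B \<Longrightarrow> Y \<in> VF \<Longrightarrow> Z \<in> VF \<Longrightarrow> c \<in> A \<times> B \<Longrightarrow> e \<in> jdom A B c
    \<Longrightarrow> nabla Y (\<lambda>e c. F e *\<^sub>R Z e c) e c =
            pd (F \<circ> jinv A B c) (Y e c) (jcoord c e) *\<^sub>R Z e c + F e *\<^sub>R nabla Y Z e c"
  using linear_connection unfolding linear_connection_def by blast

text \<open>With the bump multiplied in, agreement on W in the single chart c becomes equality of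
  global fields, since the components in c determine those in every other chart.\<close>

lemma bump_scale_eq:
  assumes c: "c \<in> A \<times> B" and Y: "Y \<in> VF" "Y' \<in> VF"
    and W: "\<And>z. z \<in> W \<Longrightarrow> vf_local A B c Y z = vf_local A B c Y' z" and h: "\<And>z. z \<notin> W \<Longrightarrow> h z = 0"
  shows "(\<lambda>e d. extend_fun c h e *\<^sub>R Y e d) = (\<lambda>e d. extend_fun c h e *\<^sub>R Y' e d)"
proof (intro ext)
  fix e d
  show "extend_fun c h e *\<^sub>R Y e d = extend_fun c h e *\<^sub>R Y' e d"
  proof (cases "e \<in> jdom A B c \<and> jcoord c e \<in> W \<and> d \<in> A \<times> B \<and> e \<in> jdom A B d")
    case True
    then have "Y e c = Y' e c"
      using W[of "jcoord c e"] c by (simp add: vf_local_def)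
    then have "Y e d = Y' e d"
      using True vf_change[OF Y(1) c, of d e] vf_change[OF Y(2) c, of d e] by simp
    then show ?thesis by simp
  next
    case False
    then show ?thesis
      using h[of "jcoord c e"] vf_outside[OF Y(1), of d e] vf_outside[OF Y(2), of d e] by (auto simp: extend_fun_def)
  qed
qed

text \<open>Both arguments are multiplied by a bump function that is 1 near w. In the first argument
  function-linearity shows that nothing changes at w; in the second the Leibniz rule adds a
  derivative of the bump, which vanishes at w.\<close>

lemma nabla_local:
  assumes c: "c \<in> A \<times> B" and YZ: "Y \<in> VF" "Y' \<in> VF" "Z \<in> VF" "Z' \<in> VF"
    and W: "open W" "w \<in> W" "W \<subseteq> jimg A B c"
    and Y: "\<And>z. z \<in> W \<Longrightarrow> vf_local A B c Y z = vf_local A B c Y' z"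
    and Z: "\<And>z. z \<in> W \<Longrightarrow> vf_local A B c Z z = vf_local A B c Z' z"
  shows "vf_local A B c (nabla Y Z) w = vf_local A B c (nabla Y' Z') w"
proof -
  obtain h V K where h: "open V" "w \<in> V" "V \<subseteq> jimg A B c" "\<And>z. z \<in> V \<Longrightarrow> h z = (1::real)"
    "K \<subseteq> W" "\<And>z. z \<notin> K \<Longrightarrow> h z = 0" and H: "extend_fun c h \<in> smooth_functions A B"
    using chart_bump[OF c W] by metis
  have h0: "\<And>z. z \<notin> W \<Longrightarrow> h z = 0" using h by blast
  define e where "e = jinv A B c w"
  have w: "w \<in> jimg A B c" using W by blast
  have e: "e \<in> jdom A B c" "jcoord c e = w" and He: "extend_fun c h e = 1"
    using w h by (simp_all add: e_def extend_fun_def)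
  have "nabla Y Z e c = nabla (\<lambda>e c'. extend_fun c h e *\<^sub>R Y e c') Z e c"
    by (simp add: nabla_scale1 H YZ He)
  also have "\<dots> = nabla Y' Z e c"
    by (simp add: bump_scale_eq[OF c YZ(1,2) Y h0] nabla_scale1 H YZ He)
  finally have 1: "nabla Y Z e c = nabla Y' Z e c" .
  have "pd (extend_fun c h \<circ> jinv A B c) v w = pd (\<lambda>z. 1) v w" for v
    by (rule pd_cong[OF h(1,2)]) (use h in \<open>auto simp: extend_fun_def\<close>)
  then have p: "pd (extend_fun c h \<circ> jinv A B c) v w = 0" for v by simp
  have "nabla Y' Z e c = nabla Y' (\<lambda>e c'. extend_fun c h e *\<^sub>R Z e c') e c"
    by (simp add: nabla_leibniz H YZ He c e p)
  also have "\<dots> = nabla Y' Z' e c"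
    by (simp add: bump_scale_eq[OF c YZ(3,4) Z h0] nabla_leibniz H YZ He c e p)
  finally show ?thesis using 1 by (simp add: vf_local_def e_def)
qed

context
  fixes c assumes c: "c \<in> A \<times> B"
begin

abbreviation D where "D \<equiv> local_conn A B nabla c"
abbreviation U where "U \<equiv> jimg A B c"
abbreviation loc where "loc \<equiv> vf_local A B c"

text \<open>Removes the choice from \<open>local_conn\<close>: any global fields with the right
  germs compute the value.\<close>

lemma local_conn_eq:
  assumes x: "smooth_on U x" and y: "smooth_on U y"
    and XY: "X \<in> VF" "Y \<in> VF" and W: "open W" "w \<in> W" "W \<subseteq> U"
    and xX: "\<And>z. z \<in> W \<Longrightarrow> loc X z = x z" and yY: "\<And>z. z \<in> W \<Longrightarrow> loc Y z = y z"
  shows "D x y w = loc (nabla X Y) w"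
proof -
  have w: "w \<in> U" using W by blast
  obtain W1 where W1: "globalize A B c x w \<in> VF" "open W1" "w \<in> W1" "W1 \<subseteq> U"
    "\<And>z. z \<in> W1 \<Longrightarrow> loc (globalize A B c x w) z = x z" using globalize[OF c w x] by metis
  obtain W2 where W2: "globalize A B c y w \<in> VF" "open W2" "w \<in> W2" "W2 \<subseteq> U"
    "\<And>z. z \<in> W2 \<Longrightarrow> loc (globalize A B c y w) z = y z" using globalize[OF c w y] by metis
  show ?thesis
    unfolding local_conn_def
    by (rule nabla_local[OF c W1(1) XY(1) W2(1) XY(2), where W = "W \<inter> W1 \<inter> W2"])
      (use W W1 W2 xX yY in auto)
qed

text \<open>The fields chosen by \<open>globalize\<close> vary with the point. On V one fixed pair
  of extensions computes the values at all points, and there \<open>nabla\<close> of this pair is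
  smooth.\<close>

lemma local_conn_smooth:
  assumes x: "smooth_on U x" and y: "smooth_on U y"
  shows "smooth_on U (D x y)"
proof (rule smooth_on_local)
  fix w assume w: "w \<in> U"
  obtain V h where V: "open V" "w \<in> V" "V \<subseteq> U"
    and e: "\<And>y. smooth_on U y \<Longrightarrow> extend_vf c (\<lambda>z. h z *\<^sub>R y z) \<in> VF"
    "\<And>y z. smooth_on U y \<Longrightarrow> z \<in> V \<Longrightarrow> loc (extend_vf c (\<lambda>z. h z *\<^sub>R y z)) z = y z"
    by (rule local_extension[OF c w]) (rule that; assumption)
  have "smooth_on V (loc (nabla (extend_vf c (\<lambda>z. h z *\<^sub>R x z)) (extend_vf c (\<lambda>z. h z *\<^sub>R y z))))"
    using vf_smooth[OF nabla_VF c] e(1)[OF x] e(1)[OF y] smooth_on_subset V(3) by blast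
  then have "smooth_on V (D x y)"
  proof (rule smooth_on_transform[OF V(1)])
    fix z assume z: "z \<in> V"
    show "loc (nabla (extend_vf c (\<lambda>z. h z *\<^sub>R x z)) (extend_vf c (\<lambda>z. h z *\<^sub>R y z))) z = D x y z"
      by (rule local_conn_eq[symmetric, OF x y _ _ V(1) z V(3)]) (use e x y in auto)
  qed
  then show "\<exists>W. open W \<and> w \<in> W \<and> smooth_on W (D x y)" using V by blast
qed

lemma local_conn_cong:
  assumes x: "smooth_on U x" and y: "smooth_on U y" and w: "w \<in> U"
    and xx': "\<And>z. z \<in> U \<Longrightarrow> x z = x' z" and yy': "\<And>z. z \<in> U \<Longrightarrow> y z = y' z"
  shows "D x y w = D x' y' w"
proof -
  obtain V h where V: "open V" "w \<in> V" "V \<subseteq> U"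
    and e: "\<And>y. smooth_on U y \<Longrightarrow> extend_vf c (\<lambda>z. h z *\<^sub>R y z) \<in> VF"
    "\<And>y z. smooth_on U y \<Longrightarrow> z \<in> V \<Longrightarrow> loc (extend_vf c (\<lambda>z. h z *\<^sub>R y z)) z = y z"
    by (rule local_extension[OF c w]) (rule that; assumption)
  have x': "smooth_on U x'" and y': "smooth_on U y'"
    using smooth_on_transform[OF open_jimg[OF c] x xx'] smooth_on_transform[OF open_jimg[OF c] y yy'] by auto
  have "D x y w = loc (nabla (extend_vf c (\<lambda>z. h z *\<^sub>R x z)) (extend_vf c (\<lambda>z. h z *\<^sub>R y z))) w"
    by (rule local_conn_eq[OF x y _ _ V]) (use e x y in auto)
  moreover have "D x' y' w = loc (nabla (extend_vf c (\<lambda>z. h z *\<^sub>R x z)) (extend_vf c (\<lambda>z. h z *\<^sub>R y z))) w"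
    by (rule local_conn_eq[OF x' y' _ _ V]) (use e x y xx' yy' V(3) in \<open>auto simp: subset_iff\<close>)
  ultimately show ?thesis by simp
qed

lemma local_conn_rules:
  assumes x: "smooth_on U x" "smooth_on U x'" and y: "smooth_on U y" "smooth_on U y'"
    and f: "smooth_on U f" and w: "w \<in> U"
  shows local_conn_add1: "D (\<lambda>z. x z + x' z) y w = D x y w + D x' y w"
    and local_conn_scale1: "D (\<lambda>z. f z *\<^sub>R x z) y w = f w *\<^sub>R D x y w"
    and local_conn_add2: "D x (\<lambda>z. y z + y' z) w = D x y w + D x y' w"
    and local_conn_leibniz: "D x (\<lambda>z. f z *\<^sub>R y z) w = pd f (x w) w *\<^sub>R y w + f w *\<^sub>R D x y w"
proof -
  obtain V h where V: "open V" "w \<in> V" "V \<subseteq> U"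
    and e: "\<And>y. smooth_on U y \<Longrightarrow> extend_vf c (\<lambda>z. h z *\<^sub>R y z) \<in> VF"
    "\<And>y z. smooth_on U y \<Longrightarrow> z \<in> V \<Longrightarrow> loc (extend_vf c (\<lambda>z. h z *\<^sub>R y z)) z = y z"
    "\<And>f. smooth_on U f \<Longrightarrow> extend_fun c (\<lambda>z. h z * f z) \<in> smooth_functions A B"
    "\<And>f z. smooth_on U f \<Longrightarrow> z \<in> V \<Longrightarrow> extend_fun c (\<lambda>z. h z * f z) (jinv A B c z) = f z"
    by (rule local_extension[OF c w]) (rule that; assumption)
  note op = open_jimg[OF c]
  define E where "E y = extend_vf c (\<lambda>z. h z *\<^sub>R y z)" for y
  define F where "F = extend_fun c (\<lambda>z. h z * f z)"
  have E: "E y \<in> VF" "z \<in> V \<Longrightarrow> loc (E y) z = y z" if "smooth_on U y" for y z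
    using e that by (simp_all add: E_def)
  have F: "F \<in> smooth_functions A B" "\<And>z. z \<in> V \<Longrightarrow> F (jinv A B c z) = f z"
    using e f by (simp_all add: F_def)
  have eq: "D u v w = loc (nabla X Y) w"
    if "smooth_on U u" "smooth_on U v" "X \<in> VF" "Y \<in> VF"
      "\<And>z. z \<in> V \<Longrightarrow> loc X z = u z" "\<And>z. z \<in> V \<Longrightarrow> loc Y z = v z" for u v X Y
    using local_conn_eq[OF that(1-4) V that(5,6)] .
  have DE: "D u v w = loc (nabla (E u) (E v)) w" if "smooth_on U u" "smooth_on U v" for u v
    by (rule eq) (use E that in auto)
  have Ew: "E v (jinv A B c w) c = v w" if "smooth_on U v" for v
    using E(2)[OF that V(2)] by (simp add: vf_local_def)
  have "D (\<lambda>z. x z + x' z) y w = loc (nabla (\<lambda>e c. E x e c + E x' e c) (E y)) w"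
    by (rule eq) (use E x y in \<open>auto intro!: smooth_on_add op vf_add simp: vf_local_def\<close>)
  then show "D (\<lambda>z. x z + x' z) y w = D x y w + D x' y w"
    using E x y by (simp add: DE vf_local_def nabla_add1)
  have "D (\<lambda>z. f z *\<^sub>R x z) y w = loc (nabla (\<lambda>e c. F e *\<^sub>R E x e c) (E y)) w"
    by (rule eq) (use E F x y f in \<open>auto intro!: smooth_on_scaleR op vf_scale simp: vf_local_def\<close>)
  then show "D (\<lambda>z. f z *\<^sub>R x z) y w = f w *\<^sub>R D x y w"
    using E F x y V by (simp add: DE vf_local_def nabla_scale1)
  have "D x (\<lambda>z. y z + y' z) w = loc (nabla (E x) (\<lambda>e c. E y e c + E y' e c)) w"
    by (rule eq) (use E x y in \<open>auto intro!: smooth_on_add op vf_add simp: vf_local_def\<close>)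
  then show "D x (\<lambda>z. y z + y' z) w = D x y w + D x y' w"
    using E x y by (simp add: DE vf_local_def nabla_add2)
  \<comment> \<open>The extension F agrees with f on V, so the derivative in the global Leibniz rule
    is that of f.\<close>
  have p: "pd (F \<circ> jinv A B c) v w = pd f v w" for v
    by (rule pd_cong[OF V(1,2)]) (use F in auto)
  have "D x (\<lambda>z. f z *\<^sub>R y z) w = loc (nabla (E x) (\<lambda>e c. F e *\<^sub>R E y e c)) w"
    by (rule eq) (use E F x y f in \<open>auto intro!: smooth_on_scaleR op vf_scale simp: vf_local_def\<close>)
  then show "D x (\<lambda>z. f z *\<^sub>R y z) w = pd f (x w) w *\<^sub>R y w + f w *\<^sub>R D x y w"
    using E F x y V w c p by (simp add: DE vf_local_def nabla_leibniz Ew)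
qed

end

end

subsection \<open>The adapted frame\<close>

lemma UNIV_idx: "(UNIV :: ('p, 'n) idx set) = range tI \<union> range xI \<union> (\<lambda>(i, \<alpha>). yI i \<alpha>) ` UNIV"
proof -
  have "a \<in> range tI \<union> range xI \<union> (\<lambda>(i, \<alpha>). yI i \<alpha>) ` UNIV" for a :: "('p, 'n) idx"
    by (cases a) (auto intro: rev_image_eqI)
  then show ?thesis by blast
qed

instance idx :: (finite, finite) finite
  by standard (simp add: UNIV_idx)

lemma sum_idx:
  fixes F :: "('p::finite, 'n::finite) idx \<Rightarrow> 'b::comm_monoid_add"
  shows "(\<Sum>a\<in>UNIV. F a) = (\<Sum>\<mu>\<in>UNIV. F (tI \<mu>)) + (\<Sum>m\<in>UNIV. F (xI m)) + (\<Sum>m\<in>UNIV. \<Sum>\<mu>\<in>UNIV. F (yI m \<mu>))"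
proof -
  have "(\<Sum>a\<in>UNIV. F a) = sum F (range tI) + sum F (range xI) + sum F ((\<lambda>(i, \<alpha>). yI i \<alpha>) ` UNIV)"
    by (subst UNIV_idx, subst sum.union_disjoint, simp, simp, force, subst sum.union_disjoint) auto
  also have "sum F ((\<lambda>(i, \<alpha>). yI i \<alpha>) ` UNIV) = (\<Sum>(m, \<mu>)\<in>UNIV \<times> UNIV. F (yI m \<mu>))"
    by (subst sum.reindex) (auto simp: inj_on_def case_prod_unfold)
  finally show ?thesis
    by (simp add: sum.reindex inj_on_def sum.cartesian_product)
qed

fun kind :: "('p, 'n) idx \<Rightarrow> nat" where
  "kind (tI _) = 0"
| "kind (xI _) = 1"
| "kind (yI _ _) = 2"

lemma ksum_eq_sum:
  assumes "\<And>s. kind s \<noteq> kind a \<Longrightarrow> F s = 0"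
  shows "ksum a F = (\<Sum>s\<in>UNIV. F s)"
  by (cases a) (simp_all add: sum_idx assms)

lemma bounded_linear_coframe: "bounded_linear (coframe M N a z)"
proof (cases a)
  case (tI \<alpha>)
  then have "coframe M N a z = (\<lambda>v. ct v \<alpha>)" by auto
  then show ?thesis by (simp add: bounded_linear_ct)
next
  case (xI i)
  then have "coframe M N a z = (\<lambda>v. cx v i)" by auto
  then show ?thesis by (simp add: bounded_linear_cx)
next
  case (yI i \<alpha>)
  then have "coframe M N a z = (\<lambda>v. cy v i \<alpha> + (\<Sum>\<beta>\<in>UNIV. M z i \<alpha> \<beta> * ct v \<beta>) + (\<Sum>j\<in>UNIV. N z i \<alpha> j * cx v j))"
    by auto
  then show ?thesis
    by (simp add: bounded_linear_add bounded_linear_sum bounded_linear_const_mult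
        bounded_linear_ct bounded_linear_cx bounded_linear_cy)
qed

lemmas coframe_linear = bounded_linear.linear[OF bounded_linear_coframe]
lemmas coframe_add = linear_add[OF coframe_linear]
lemmas coframe_diff = linear_diff[OF coframe_linear]
lemmas coframe_scale = linear_scale[OF coframe_linear]
lemmas coframe_sum = linear_sum[OF coframe_linear]
lemmas coframe_0 = linear_0[OF coframe_linear]

lemma double_sum_delta:
  "(\<Sum>i\<in>UNIV. \<Sum>\<alpha>\<in>UNIV. f i \<alpha> * (if j = i \<and> \<beta> = \<alpha> then 1 else 0)) = (f j \<beta> :: real)"
  for j :: "'i::finite" and \<beta> :: "'j::finite"
proof -
  have "(\<Sum>\<alpha>\<in>UNIV. f i \<alpha> * (if j = i \<and> \<beta> = \<alpha> then 1 else 0)) = (if j = i then f i \<beta> else 0)" for i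
    by (simp add: mult_delta_right)
  then show ?thesis by simp
qed

lemma ct_e [simp]: "ct (et \<alpha>) \<mu> = (if \<mu> = \<alpha> then 1 else 0)" "ct (ex i) \<mu> = 0" "ct (ey j \<beta>) \<mu> = 0"
  and cx_e [simp]: "cx (et \<alpha>) m = 0" "cx (ex i) m = (if m = i then 1 else 0)" "cx (ey j \<beta>) m = 0"
  and cy_e [simp]: "cy (et \<alpha>) m \<mu> = 0" "cy (ex i) m \<mu> = 0" "cy (ey j \<beta>) m \<mu> = (if m = j \<and> \<mu> = \<beta> then 1 else 0)"
  by (auto simp: ct_def cx_def cy_def et_def ex_def ey_def axis_def)

lemma ct_linear [simp]: "ct (u + v) \<mu> = ct u \<mu> + ct v \<mu>" "ct (u - v) \<mu> = ct u \<mu> - ct v \<mu>"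
    "ct (r *\<^sub>R u) \<mu> = r * ct u \<mu>" "ct (sum f I) \<mu> = (\<Sum>i\<in>I. ct (f i) \<mu>)"
  and cx_linear [simp]: "cx (u + v) m = cx u m + cx v m" "cx (u - v) m = cx u m - cx v m"
    "cx (r *\<^sub>R u) m = r * cx u m" "cx (sum f I) m = (\<Sum>i\<in>I. cx (f i) m)"
  and cy_linear [simp]: "cy (u + v) m \<mu> = cy u m \<mu> + cy v m \<mu>" "cy (u - v) m \<mu> = cy u m \<mu> - cy v m \<mu>"
    "cy (r *\<^sub>R u) m \<mu> = r * cy u m \<mu>" "cy (sum f I) m \<mu> = (\<Sum>i\<in>I. cy (f i) m \<mu>)"
  by (simp_all add: ct_def cx_def cy_def fst_sum snd_sum)

lemma ct_frame: "ct (frame M N a z) \<mu> = (if a = tI \<mu> then 1 else 0)"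
  and cx_frame: "cx (frame M N a z) m = (if a = xI m then 1 else 0)"
  by (cases a; auto)+

lemma cy_frame:
  "cy (frame M N (tI \<alpha>) z) m \<mu> = - M z m \<mu> \<alpha>"
  "cy (frame M N (xI i) z) m \<mu> = - N z m \<mu> i"
  "cy (frame M N (yI j \<beta>) z) m \<mu> = (if m = j \<and> \<mu> = \<beta> then 1 else 0)"
  by (simp_all add: double_sum_delta)

lemma coframe_frame: "coframe M N a z (frame M N b z) = (if a = b then 1 else 0)"
  by (cases a; cases b) (simp_all add: ct_frame cx_frame cy_frame mult_delta_right del: frame.simps)

lemma frame_expansion: "v = (\<Sum>a\<in>UNIV. coframe M N a z v *\<^sub>R frame M N a z)"
  using coframe_expansion[of v M N z]
  by (simp add: sum_idx proj_hT_def proj_hM_def proj_v_def del: coframe.simps frame.simps)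

lemma smooth_on_frame:
  assumes S: "open S" and M: "\<And>i \<alpha> \<beta>. smooth_on S (\<lambda>z. M z i \<alpha> \<beta>)"
    and N: "\<And>i \<alpha> j. smooth_on S (\<lambda>z. N z i \<alpha> j)"
  shows "smooth_on S (frame M N a)"
proof (cases a)
  case (tI \<alpha>)
  then have "frame M N a = (\<lambda>z. et \<alpha> - (\<Sum>j\<in>UNIV. \<Sum>\<beta>\<in>UNIV. M z j \<beta> \<alpha> *\<^sub>R ey j \<beta>))" by auto
  then show ?thesis by (simp add: smooth_on_diff smooth_on_sum smooth_on_scaleR M S)
next
  case (xI i)
  then have "frame M N a = (\<lambda>z. ex i - (\<Sum>j\<in>UNIV. \<Sum>\<beta>\<in>UNIV. N z j \<beta> i *\<^sub>R ey j \<beta>))" by auto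
  then show ?thesis by (simp add: smooth_on_diff smooth_on_sum smooth_on_scaleR N S)
next
  case (yI i \<alpha>)
  then have "frame M N a = (\<lambda>z. ey i \<alpha>)" by auto
  then show ?thesis by simp
qed

subsection \<open>Lie brackets\<close>

text \<open>X(Yf) - Y(Xf) = [X,Y]f in coordinates: the second derivatives of f cancel by
  symmetry.\<close>

lemma pd_bracket:
  fixes f :: "'a::euclidean_space \<Rightarrow> real"
  assumes S: "open S" "z \<in> S" and f: "smooth_on S f" and x: "smooth_on S x" and y: "smooth_on S y"
  shows "pd (\<lambda>u. pd f (y u) u) (x z) z - pd (\<lambda>u. pd f (x u) u) (y z) z = pd f (pd y (x z) z - pd x (y z) z) z"
proof -
  note df = smooth_on_differentiable[OF f S(2)]
  \<comment> \<open>The order of differentiation is already exchanged on the right, so that the sum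
    over the basis recombines into a single derivative along y.\<close>
  have main: "pd (\<lambda>u. pd f (y u) u) v z = pd f (pd y v z) z + pd (pd f v) (y z) z"
    if y: "smooth_on S y" for y v
  proof -
    note d1 = smooth_on_differentiable[OF smooth_on_pd[OF S(1) f] S(2)]
    note dy = smooth_on_differentiable[OF y S(2)]
    have dyb: "(\<lambda>u. y u \<bullet> b) differentiable (at z)" for b
      using bounded_linear.has_derivative[OF bounded_linear_inner_left has_derivative_pd[OF dy]]
      by (auto simp: differentiable_def)
    have "pd (\<lambda>u. pd f (y u) u) v z = pd (\<lambda>u. \<Sum>b\<in>Basis. (y u \<bullet> b) * pd f b u) v z"
      by (rule pd_cong[OF S])
        (use pd_basis_expansion[OF smooth_on_differentiable[OF f]] in \<open>auto simp del: pd_0\<close>)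
    also have "\<dots> = (\<Sum>b\<in>Basis. (y z \<bullet> b) * pd (pd f b) v z + (pd y v z \<bullet> b) * pd f b z)"
      by (subst pd_sum) (auto intro!: differentiable_mult dyb d1
          simp: pd_bilinear[OF bounded_bilinear_mult dyb d1] pd_linear_compose[OF bounded_linear_inner_left dy])
    also have "\<dots> = (\<Sum>b\<in>Basis. (y z \<bullet> b) * pd (pd f v) b z) + (\<Sum>b\<in>Basis. (pd y v z \<bullet> b) * pd f b z)"
      by (simp add: sum.distrib pd_commute[OF S(1) f S(2), of _ v])
    also have "(\<Sum>b\<in>Basis. (y z \<bullet> b) * pd (pd f v) b z) = pd (pd f v) (y z) z"
      using pd_basis_expansion[OF d1, of v "y z"] by simp
    also have "(\<Sum>b\<in>Basis. (pd y v z \<bullet> b) * pd f b z) = pd f (pd y v z) z"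
      using pd_basis_expansion[OF df, of "pd y v z"] by simp
    finally show ?thesis by simp
  qed
  show ?thesis
    by (simp add: main[OF x] main[OF y] pd_dir_diff[OF df] pd_commute[OF S(1) f S(2), of "x z" "y z"])
qed

subsection \<open>The Ricci identity in the adapted frame\<close>

text \<open>Isolates what the Ricci identity uses of nabla, so that the computation takes place on
  an open set of coordinates without jets or charts.\<close>

locale local_d_connection =
  fixes U :: "('p::finite, 'n::finite) jc set" and M :: "('p, 'n) Mcoeff" and N :: "('p, 'n) Ncoeff"
    and D :: "('p, 'n) lconn"
  assumes open_U: "open U"
    and smooth_M: "smooth_on U (\<lambda>z. M z i \<alpha> \<beta>)"
    and smooth_N: "smooth_on U (\<lambda>z. N z i \<alpha> j)"
    and D_smooth: "smooth_on U x \<Longrightarrow> smooth_on U y \<Longrightarrow> smooth_on U (D x y)"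
    and D_cong: "smooth_on U x \<Longrightarrow> smooth_on U y \<Longrightarrow> z \<in> U \<Longrightarrow> (\<And>u. u \<in> U \<Longrightarrow> x u = x' u)
      \<Longrightarrow> (\<And>u. u \<in> U \<Longrightarrow> y u = y' u) \<Longrightarrow> D x y z = D x' y' z"
    and D_add1: "smooth_on U x \<Longrightarrow> smooth_on U x' \<Longrightarrow> smooth_on U y \<Longrightarrow> z \<in> U
      \<Longrightarrow> D (\<lambda>u. x u + x' u) y z = D x y z + D x' y z"
    and D_scale1: "smooth_on U f \<Longrightarrow> smooth_on U x \<Longrightarrow> smooth_on U y \<Longrightarrow> z \<in> U
      \<Longrightarrow> D (\<lambda>u. f u *\<^sub>R x u) y z = f z *\<^sub>R D x y z"
    and D_add2: "smooth_on U x \<Longrightarrow> smooth_on U y \<Longrightarrow> smooth_on U y' \<Longrightarrow> z \<in> U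
      \<Longrightarrow> D x (\<lambda>u. y u + y' u) z = D x y z + D x y' z"
    and D_leibniz: "smooth_on U f \<Longrightarrow> smooth_on U x \<Longrightarrow> smooth_on U y \<Longrightarrow> z \<in> U
      \<Longrightarrow> D x (\<lambda>u. f u *\<^sub>R y u) z = pd f (x z) z *\<^sub>R y z + f z *\<^sub>R D x y z"
    and mixed: "z \<in> U \<Longrightarrow> kind a \<noteq> kind b \<Longrightarrow> conn_coeff M N D a b k z = 0"
begin

abbreviation E where "E \<equiv> frame M N"
abbreviation \<theta> where "\<theta> \<equiv> coframe M N"
abbreviation \<Gamma> where "\<Gamma> \<equiv> conn_coeff M N D"

lemma smooth_E: "smooth_on U (E a)"
  by (rule smooth_on_frame[OF open_U smooth_M smooth_N])

lemma smooth_\<theta>: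
  assumes "smooth_on U x"
  shows "smooth_on U (\<lambda>z. \<theta> a z (x z))"
proof -
  note c = smooth_on_linear_compose[OF open_U bounded_linear_ct assms]
    smooth_on_linear_compose[OF open_U bounded_linear_cx assms]
    smooth_on_linear_compose[OF open_U bounded_linear_cy assms]
  show ?thesis
    by (cases a) (simp_all add: c smooth_on_add smooth_on_sum smooth_on_mult smooth_M smooth_N open_U)
qed

lemma smooth_\<Gamma>: "smooth_on U (\<Gamma> a b k)"
  using smooth_\<theta>[OF D_smooth[OF smooth_E smooth_E], of a k b]
  unfolding conn_coeff_def[abs_def] .

lemma D_sum1:
  assumes "finite I" "\<And>i. smooth_on U (x i)" "\<And>i. smooth_on U (f i)" "smooth_on U y" "z \<in> U"
  shows "D (\<lambda>u. \<Sum>i\<in>I. f i u *\<^sub>R x i u) y z = (\<Sum>i\<in>I. f i z *\<^sub>R D (x i) y z)"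
  using assms(1)
proof (induction I rule: finite_induct)
  case empty
  \<comment> \<open>Writing the zero field as a zero multiple lets the scaling rule give the empty
    sum.\<close>
  have "D (\<lambda>u. 0 *\<^sub>R 0) y z = 0 *\<^sub>R D (\<lambda>u. 0) y z"
    by (rule D_scale1) (auto simp: assms)
  then show ?case by simp
next
  case (insert i I)
  then show ?case
    by (simp add: D_add1 D_scale1 smooth_on_sum smooth_on_scaleR open_U assms)
qed

lemma D_sum2:
  assumes "finite I" "smooth_on U x" "\<And>i. smooth_on U (f i)" "\<And>i. smooth_on U (y i)" "z \<in> U"
  shows "D x (\<lambda>u. \<Sum>i\<in>I. f i u *\<^sub>R y i u) z = (\<Sum>i\<in>I. pd (f i) (x z) z *\<^sub>R y i z + f i z *\<^sub>R D x (y i) z)"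
  using assms(1)
proof (induction I rule: finite_induct)
  case empty
  have "D x (\<lambda>u. 0 *\<^sub>R 0) z = pd (\<lambda>u. 0 :: real) (x z) z *\<^sub>R 0 + 0 *\<^sub>R D x (\<lambda>u. 0) z"
    by (rule D_leibniz) (auto simp: assms)
  then show ?case by simp
next
  case (insert i I)
  then show ?case
    by (simp add: D_add2 D_leibniz smooth_on_sum smooth_on_scaleR open_U assms)
qed

lemma D_frame: "D (E k) (E b) z = (\<Sum>a\<in>UNIV. \<Gamma> a b k z *\<^sub>R E a z)"
  unfolding conn_coeff_def by (rule frame_expansion)

text \<open>Leibniz applied to the frame expansion of the inner derivative: differentiating the
  coefficients gives the first term, differentiating the frame fields the quadratic one.\<close>

lemma D_D_frame:
  assumes z: "z \<in> U"
  shows "\<theta> l z (D (E k) (D (E b) (E s)) z) = pd (\<Gamma> l s b) (E k z) z + (\<Sum>m\<in>UNIV. \<Gamma> m s b z * \<Gamma> l m k z)"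
proof -
  have "D (E k) (D (E b) (E s)) z = D (E k) (\<lambda>u. \<Sum>m\<in>UNIV. \<Gamma> m s b u *\<^sub>R E m u) z"
    by (rule D_cong[OF smooth_E D_smooth[OF smooth_E smooth_E] z refl D_frame])
  also have "\<dots> = (\<Sum>m\<in>UNIV. pd (\<Gamma> m s b) (E k z) z *\<^sub>R E m z + \<Gamma> m s b z *\<^sub>R D (E k) (E m) z)"
    by (rule D_sum2) (auto intro: smooth_E smooth_\<Gamma> z)
  finally have "\<theta> l z (D (E k) (D (E b) (E s)) z) =
      (\<Sum>m\<in>UNIV. pd (\<Gamma> m s b) (E k z) z * \<theta> l z (E m z)) + (\<Sum>m\<in>UNIV. \<Gamma> m s b z * \<theta> l z (D (E k) (E m) z))"
    by (simp add: coframe_sum coframe_add coframe_scale sum.distrib)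
  then show ?thesis
    by (simp add: coframe_frame conn_coeff_def mult_delta_right)
qed

text \<open>Structure functions (anholonomy coefficients) of the adapted frame.\<close>

definition Br where "Br m k b z = \<theta> m z (bracket (E k) (E b) z)"

lemma smooth_bracket: "smooth_on U x \<Longrightarrow> smooth_on U y \<Longrightarrow> smooth_on U (bracket x y)"
  unfolding bracket_def[abs_def] by (intro smooth_on_diff smooth_on_pd_field open_U)

lemma D_bracket_frame:
  assumes z: "z \<in> U"
  shows "\<theta> l z (D (bracket (E k) (E b)) (E s) z) = (\<Sum>m\<in>UNIV. Br m k b z * \<Gamma> l s m z)"
proof -
  have sBr: "smooth_on U (Br m k b)" for m
    unfolding Br_def[abs_def] by (intro smooth_\<theta> smooth_bracket smooth_E)
  have "D (bracket (E k) (E b)) (E s) z = D (\<lambda>u. \<Sum>m\<in>UNIV. Br m k b u *\<^sub>R E m u) (E s) z"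
    by (rule D_cong[OF smooth_bracket[OF smooth_E smooth_E] smooth_E z _ refl])
      (unfold Br_def, rule frame_expansion)
  also have "\<dots> = (\<Sum>m\<in>UNIV. Br m k b z *\<^sub>R D (E m) (E s) z)"
    by (rule D_sum1) (auto intro: smooth_E sBr z)
  finally show ?thesis
    by (simp add: coframe_sum coframe_scale conn_coeff_def)
qed

lemma curv_eq:
  assumes z: "z \<in> U"
  shows "curv_coeff M N D l s b k z =
    pd (\<Gamma> l s b) (E k z) z + (\<Sum>m\<in>UNIV. \<Gamma> m s b z * \<Gamma> l m k z)
    - (pd (\<Gamma> l s k) (E b z) z + (\<Sum>m\<in>UNIV. \<Gamma> m s k z * \<Gamma> l m b z))
    - (\<Sum>m\<in>UNIV. Br m k b z * \<Gamma> l s m z)"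
  by (simp add: curv_coeff_def curvature_def coframe_diff D_D_frame D_bracket_frame z)

definition Tor where "Tor s b k z = \<Gamma> s b k z - \<Gamma> s k b z - Br s k b z"

section \<open>First and second covariant derivatives of a vector field\<close>

context
  fixes x :: "('p, 'n) jc \<Rightarrow> ('p, 'n) jc" assumes x: "smooth_on U x"
begin

abbreviation X0 where "X0 \<equiv> vf_dtensor M N x"
abbreviation X1 where "X1 \<equiv> cov M N D X0"
abbreviation X2 where "X2 \<equiv> cov M N D X1"

lemma smooth_X0: "smooth_on U (X0 [a] [])"
  using smooth_\<theta>[OF x] by simp

lemma X1_eq:
  assumes z: "z \<in> U"
  shows "X1 [a] [k] z = pd (X0 [a] []) (E k z) z + (\<Sum>s\<in>UNIV. X0 [s] [] z * \<Gamma> a s k z)"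
proof -
  have "ksum a (\<lambda>s. X0 [s] [] z * \<Gamma> a s k z) = (\<Sum>s\<in>UNIV. X0 [s] [] z * \<Gamma> a s k z)"
    by (rule ksum_eq_sum) (simp add: mixed[OF z])
  then show ?thesis by (simp add: cov_def cov_along_def delta_def)
qed

text \<open>\<open>cov\<close> consumes the last covariant index k as direction of differentiation.
  The index b of the first derivative remains as a covariant slot and produces the subtracted
  sum.\<close>

lemma X2_eq:
  assumes z: "z \<in> U"
  shows "X2 [a] [b, k] z = pd (X1 [a] [b]) (E k z) z + (\<Sum>s\<in>UNIV. X1 [s] [b] z * \<Gamma> a s k z)
    - (\<Sum>s\<in>UNIV. X1 [a] [s] z * \<Gamma> s b k z)"
proof -
  have "ksum a (\<lambda>s. X1 [s] [b] z * \<Gamma> a s k z) = (\<Sum>s\<in>UNIV. X1 [s] [b] z * \<Gamma> a s k z)"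
    by (rule ksum_eq_sum) (simp add: mixed[OF z])
  moreover have "ksum b (\<lambda>s. X1 [a] [s] z * \<Gamma> s b k z) = (\<Sum>s\<in>UNIV. X1 [a] [s] z * \<Gamma> s b k z)"
    by (rule ksum_eq_sum) (simp add: mixed[OF z])
  ultimately show ?thesis
    by (simp add: cov_def[of M N D X1] cov_along_def delta_def)
qed

lemma pd_X1:
  assumes z: "z \<in> U"
  shows "pd (X1 [a] [b]) v z = pd (\<lambda>u. pd (X0 [a] []) (E b u) u) v z
    + (\<Sum>s\<in>UNIV. X0 [s] [] z * pd (\<Gamma> a s b) v z + pd (X0 [s] []) v z * \<Gamma> a s b z)"
proof -
  note dX = smooth_on_differentiable[OF smooth_X0 z] and d\<Gamma> = smooth_on_differentiable[OF smooth_\<Gamma> z]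
  have dp: "(\<lambda>u. pd (X0 [a] []) (E b u) u) differentiable (at z)"
    by (rule smooth_on_differentiable[OF smooth_on_pd_field[OF open_U smooth_X0 smooth_E] z])
  have "pd (X1 [a] [b]) v z = pd (\<lambda>u. pd (X0 [a] []) (E b u) u + (\<Sum>s\<in>UNIV. X0 [s] [] u * \<Gamma> a s b u)) v z"
    by (rule pd_cong[OF open_U z X1_eq])
  also have "\<dots> = pd (\<lambda>u. pd (X0 [a] []) (E b u) u) v z + (\<Sum>s\<in>UNIV. pd (\<lambda>u. X0 [s] [] u * \<Gamma> a s b u) v z)"
  proof -
    have ds: "(\<lambda>u. X0 [s] [] u * \<Gamma> a s b u) differentiable (at z)" for s
      by (rule differentiable_mult[OF dX d\<Gamma>])
    then have dS: "(\<lambda>u. \<Sum>s\<in>UNIV. X0 [s] [] u * \<Gamma> a s b u) differentiable (at z)"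
      by (intro differentiable_sum) auto
    show ?thesis by (simp only: pd_add[OF dp dS] pd_sum[OF ds])
  qed
  also have "\<dots> = pd (\<lambda>u. pd (X0 [a] []) (E b u) u) v z
    + (\<Sum>s\<in>UNIV. X0 [s] [] z * pd (\<Gamma> a s b) v z + pd (X0 [s] []) v z * \<Gamma> a s b z)"
    by (simp only: pd_bilinear[OF bounded_bilinear_mult dX d\<Gamma>])
  finally show ?thesis .
qed

text \<open>In the difference the products of a first derivative with a coefficient are symmetric in
  b and k and cancel. Derivatives and products of coefficients give the curvature up to its bracket
  term. The subtracted sums give the torsion up to its bracket term. Both missing bracket terms
  together amount to the bracket acting on the component functions, which is the commutator of their
  second derivatives.\<close>

lemma ricci:
  assumes z: "z \<in> U"
  shows "X2 [a] [b, k] z - X2 [a] [k, b] z =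
    (\<Sum>s\<in>UNIV. X0 [s] [] z * curv_coeff M N D a s b k z) - (\<Sum>s\<in>UNIV. X1 [a] [s] z * Tor s b k z)"
proof -
  note dX = smooth_on_differentiable[OF smooth_X0 z]
  have br: "pd (\<lambda>u. pd (X0 [a] []) (E b u) u) (E k z) z - pd (\<lambda>u. pd (X0 [a] []) (E k u) u) (E b z) z
    = (\<Sum>m\<in>UNIV. Br m k b z * pd (X0 [a] []) (E m z) z)"
  proof -
    have "pd (\<lambda>u. pd (X0 [a] []) (E b u) u) (E k z) z - pd (\<lambda>u. pd (X0 [a] []) (E k u) u) (E b z) z
      = pd (X0 [a] []) (bracket (E k) (E b) z) z"
      unfolding bracket_def by (rule pd_bracket[OF open_U z smooth_X0 smooth_E smooth_E])
    also have "bracket (E k) (E b) z = (\<Sum>m\<in>UNIV. Br m k b z *\<^sub>R E m z)"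
      unfolding Br_def by (rule frame_expansion)
    finally show ?thesis by (simp only: pd_dir_sum[OF dX] pd_dir_scale[OF dX] real_scaleR_def)
  qed
  \<comment> \<open>From here on all values at z become opaque atoms, so that the last step is
    algebra with finite sums.\<close>
  define x0 where "x0 s = X0 [s] [] z" for s
  define dx where "dx s m = pd (X0 [s] []) (E m z) z" for s m
  define G where "G s t m = \<Gamma> s t m z" for s t m
  define dG where "dG s t m j = pd (\<Gamma> s t m) (E j z) z" for s t m j
  define B where "B m = Br m k b z" for m
  define H where "H b k = pd (\<lambda>u. pd (X0 [a] []) (E b u) u) (E k z) z" for b k
  have X1: "X1 [s] [m] z = dx s m + (\<Sum>t\<in>UNIV. x0 t * G s t m)" for s m
    by (simp only: X1_eq[OF z] dx_def x0_def G_def)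
  have X2: "X2 [a] [b, k] z = H b k + (\<Sum>s\<in>UNIV. x0 s * dG a s b k + dx s k * G a s b)
    + (\<Sum>s\<in>UNIV. (dx s b + (\<Sum>t\<in>UNIV. x0 t * G s t b)) * G a s k) - (\<Sum>s\<in>UNIV. X1 [a] [s] z * G s b k)" for b k
    by (simp only: X2_eq[OF z] pd_X1[OF z] X1[of _ b] flip: H_def x0_def G_def dG_def dx_def)
  have C: "curv_coeff M N D a s b k z = dG a s b k + (\<Sum>m\<in>UNIV. G m s b * G a m k)
    - (dG a s k b + (\<Sum>m\<in>UNIV. G m s k * G a m b)) - (\<Sum>m\<in>UNIV. B m * G a s m)" for s
    by (simp only: curv_eq[OF z] G_def dG_def B_def)
  have T: "Tor s b k z = G s b k - G s k b - B s" for s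
    by (simp only: Tor_def G_def B_def)
  \<comment> \<open>Interchanging the summations brings the quadratic term into the shape it has in
    the curvature.\<close>
  have swap: "(\<Sum>s\<in>UNIV. (\<Sum>t\<in>UNIV. x0 t * G s t b) * G a s k) = (\<Sum>s\<in>UNIV. x0 s * (\<Sum>m\<in>UNIV. G m s b * G a m k))" for b k
    unfolding sum_distrib_left sum_distrib_right by (subst sum.swap) (simp add: mult.assoc)
  have swapB: "(\<Sum>s\<in>UNIV. (\<Sum>t\<in>UNIV. x0 t * G a t s) * B s) = (\<Sum>s\<in>UNIV. x0 s * (\<Sum>m\<in>UNIV. B m * G a s m))"
    unfolding sum_distrib_left sum_distrib_right by (subst sum.swap) (simp add: mult_ac)
  have XB: "(\<Sum>s\<in>UNIV. X1 [a] [s] z * B s) = (\<Sum>s\<in>UNIV. B s * dx a s) + (\<Sum>s\<in>UNIV. x0 s * (\<Sum>m\<in>UNIV. B m * G a s m))"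
    by (simp only: X1 distrib_right sum.distrib swapB) (simp add: mult.commute)
  have Hbr: "H b k - H k b = (\<Sum>m\<in>UNIV. B m * dx a m)"
    using br by (simp only: H_def B_def dx_def)
  have XT: "(\<Sum>s\<in>UNIV. X1 [a] [s] z * Tor s b k z) =
      (\<Sum>s\<in>UNIV. X1 [a] [s] z * G s b k) - (\<Sum>s\<in>UNIV. X1 [a] [s] z * G s k b) - (\<Sum>s\<in>UNIV. X1 [a] [s] z * B s)"
    by (simp only: T right_diff_distrib sum_subtractf)
  have XC: "(\<Sum>s\<in>UNIV. x0 s * curv_coeff M N D a s b k z) =
     (\<Sum>s\<in>UNIV. x0 s * dG a s b k) + (\<Sum>s\<in>UNIV. x0 s * (\<Sum>m\<in>UNIV. G m s b * G a m k))
    - ((\<Sum>s\<in>UNIV. x0 s * dG a s k b) + (\<Sum>s\<in>UNIV. x0 s * (\<Sum>m\<in>UNIV. G m s k * G a m b)))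
    - (\<Sum>s\<in>UNIV. x0 s * (\<Sum>m\<in>UNIV. B m * G a s m))"
    by (simp only: C right_diff_distrib distrib_left sum_subtractf sum.distrib)
  have X2': "X2 [a] [b, k] z = H b k + ((\<Sum>s\<in>UNIV. x0 s * dG a s b k) + (\<Sum>s\<in>UNIV. dx s k * G a s b))
    + ((\<Sum>s\<in>UNIV. dx s b * G a s k) + (\<Sum>s\<in>UNIV. x0 s * (\<Sum>m\<in>UNIV. G m s b * G a m k)))
    - (\<Sum>s\<in>UNIV. X1 [a] [s] z * G s b k)" for b k
    by (simp only: X2 distrib_right sum.distrib swap)
  show ?thesis
    unfolding XT XB X2' x0_def[symmetric] XC using Hbr by (simp only: algebra_simps)
qed

end

section \<open>Brackets and torsion components of the adapted frame\<close>

lemma pd_ct_E: "z \<in> U \<Longrightarrow> ct (pd (E a) v z) \<mu> = 0"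
  and pd_cx_E: "z \<in> U \<Longrightarrow> cx (pd (E a) v z) m = 0"
  and pd_cy_E: "z \<in> U \<Longrightarrow> cy (pd (E a) v z) m \<mu> = pd (\<lambda>u. cy (E a u) m \<mu>) v z"
  by (simp_all add: ct_frame cx_frame del: frame.simps
      flip: pd_linear_compose[OF bounded_linear_ct smooth_on_differentiable[OF smooth_E]]
        pd_linear_compose[OF bounded_linear_cx smooth_on_differentiable[OF smooth_E]]
        pd_linear_compose[OF bounded_linear_cy smooth_on_differentiable[OF smooth_E]])

text \<open>The t- and x-components of frame fields are constants 0 or 1, so brackets are vertical.
  On a vertical vector the terms with M and N in the vertical coframe vanish, which leaves the
  difference of derivatives of the fibre components.\<close>

lemma Br_eq:
  assumes z: "z \<in> U"
  shows "Br (tI \<mu>) k b z = 0" "Br (xI m) k b z = 0"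
    "Br (yI m \<mu>) k b z = pd (\<lambda>u. cy (E b u) m \<mu>) (E k z) z - pd (\<lambda>u. cy (E k u) m \<mu>) (E b z) z"
  by (simp_all add: Br_def bracket_def pd_ct_E pd_cx_E pd_cy_E z del: frame.simps)

lemma pd_cy_frame:
  assumes z: "z \<in> U"
  shows "pd (\<lambda>u. cy (E (tI \<alpha>) u) m \<mu>) v z = - pd (\<lambda>u. M u m \<mu> \<alpha>) v z"
    "pd (\<lambda>u. cy (E (xI i) u) m \<mu>) v z = - pd (\<lambda>u. N u m \<mu> i) v z"
    "pd (\<lambda>u. cy (E (yI j \<beta>) u) m \<mu>) v z = 0"
  using pd_linear_compose[OF bounded_linear_minus[OF bounded_linear_ident] smooth_on_differentiable[OF smooth_M z]]
    pd_linear_compose[OF bounded_linear_minus[OF bounded_linear_ident] smooth_on_differentiable[OF smooth_N z]]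
  by (simp_all add: cy_frame del: frame.simps)

text \<open>The torsion sum is split by kind, while in the curvature sum only the kind of a
  survives: the coefficients with different kinds vanish on all of U, hence so do their
  derivatives.\<close>

lemma ricci_kind:
  assumes x: "smooth_on U x" and z: "z \<in> U"
  shows "X2 x [a] [b, k] z - X2 x [a] [k, b] z =
    ksum a (\<lambda>s. X0 x [s] [] z * curv_coeff M N D a s b k z)
    - (\<Sum>\<mu>\<in>UNIV. X1 x [a] [tI \<mu>] z * Tor (tI \<mu>) b k z) - (\<Sum>m\<in>UNIV. X1 x [a] [xI m] z * Tor (xI m) b k z)
    - (\<Sum>m\<in>UNIV. \<Sum>\<mu>\<in>UNIV. X1 x [a] [yI m \<mu>] z * Tor (yI m \<mu>) b k z)"
proof -
  have "curv_coeff M N D a s b k z = 0" if "kind s \<noteq> kind a" for s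
  proof -
    have p: "pd (\<Gamma> a s j) v z = 0" for j v
    proof -
      have "pd (\<Gamma> a s j) v z = pd (\<lambda>u. 0) v z"
        by (rule pd_cong[OF open_U z]) (use mixed[of _ a s] that in auto)
      then show ?thesis by simp
    qed
    \<comment> \<open>An intermediate index m cannot share its kind with both s and a, so one factor
      is mixed.\<close>
    have q: "\<Gamma> m s i z * \<Gamma> a m j z = 0" for m i j
      using mixed[OF z, of m s i] mixed[OF z, of a m j] that by (cases "kind m = kind s") auto
    show ?thesis using that by (simp add: curv_eq[OF z] p q mixed[OF z])
  qed
  then have "ksum a (\<lambda>s. X0 x [s] [] z * curv_coeff M N D a s b k z) = (\<Sum>s\<in>UNIV. X0 x [s] [] z * curv_coeff M N D a s b k z)"
    by (intro ksum_eq_sum) simp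
  then show ?thesis
    by (simp only: ricci[OF x z] sum_idx[of "\<lambda>s. X1 x [a] [s] z * Tor s b k z"] diff_diff_eq add.assoc)
qed

text \<open>At most one of the two coefficients survives when b and k differ in kind, whence the
  one-term components. For horizontal b and k the vertical component is the bracket alone, giving
  the R's; the P's combine one bracket term with one coefficient.\<close>

lemma Tor_eq:
  assumes z: "z \<in> U"
  shows
    "Tor (tI \<mu>) (tI \<beta>) (tI \<gamma>) z = tor_Tbar_tt M N D \<mu> \<beta> \<gamma> z"
    "Tor (xI m) (tI \<beta>) (tI \<gamma>) z = 0"
    "Tor (yI m \<mu>) (tI \<beta>) (tI \<gamma>) z = tor_Rtt M N m \<mu> \<beta> \<gamma> z"
    "Tor (tI \<mu>) (tI \<beta>) (xI k) z = tor_Tbar_tx M N D \<mu> \<beta> k z"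
    "Tor (xI m) (tI \<beta>) (xI k) z = tor_T_tx M N D m \<beta> k z"
    "Tor (yI m \<mu>) (tI \<beta>) (xI k) z = tor_Rtx M N m \<mu> \<beta> k z"
    "Tor (tI \<mu>) (xI j) (xI k) z = 0"
    "Tor (xI m) (xI j) (xI k) z = tor_T_xx M N D m j k z"
    "Tor (yI m \<mu>) (xI j) (xI k) z = tor_Rxx M N m \<mu> j k z"
    "Tor (tI \<mu>) (tI \<beta>) (yI k \<gamma>) z = \<Gamma> (tI \<mu>) (tI \<beta>) (yI k \<gamma>) z"
    "Tor (xI m) (tI \<beta>) (yI k \<gamma>) z = 0"
    "Tor (yI m \<mu>) (tI \<beta>) (yI k \<gamma>) z = tor_Pt M N D m \<mu> \<beta> k \<gamma> z"
    "Tor (tI \<mu>) (xI j) (yI k \<gamma>) z = 0"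
    "Tor (xI m) (xI j) (yI k \<gamma>) z = \<Gamma> (xI m) (xI j) (yI k \<gamma>) z"
    "Tor (yI m \<mu>) (xI j) (yI k \<gamma>) z = tor_Px M N D m \<mu> j k \<gamma> z"
    "Tor (tI \<mu>) (yI j \<beta>) (yI k \<gamma>) z = 0"
    "Tor (xI m) (yI j \<beta>) (yI k \<gamma>) z = 0"
    "Tor (yI m \<mu>) (yI j \<beta>) (yI k \<gamma>) z = tor_S M N D m \<mu> j \<beta> k \<gamma> z"
  by (simp_all add: Tor_def Br_eq[OF z] pd_cy_frame[OF z] mixed[OF z] tor_Tbar_tt_def tor_Rtt_def tor_Tbar_tx_def
      tor_T_tx_def tor_Rtx_def tor_T_xx_def tor_Rxx_def tor_Pt_def tor_Px_def tor_S_def delta_def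
      del: frame.simps(1,2))

end

subsection \<open>Gamma-linear connections preserve the adapted frame\<close>

locale gamma_connection = jet_connection T Mf A B nabla
  for T :: "'t topology" and Mf :: "'m topology"
    and A :: "('t, real^'p::finite) chart set" and B :: "('m, real^'n::finite) chart set"
    and nabla :: "('t, 'm, 'p, 'n) vfield \<Rightarrow> ('t, 'm, 'p, 'n) vfield \<Rightarrow> ('t, 'm, 'p, 'n) vfield" +
  fixes M :: "('t, 'm, 'p, 'n) jchart \<Rightarrow> ('p, 'n) Mcoeff"
    and N :: "('t, 'm, 'p, 'n) jchart \<Rightarrow> ('p, 'n) Ncoeff"
  assumes nonlinear_connection: "nonlinear_connection A B M N"
    and Gamma_linear: "Gamma_linear_connection A B M N nabla"
begin

lemma smooth_M: "c \<in> A \<times> B \<Longrightarrow> smooth_on (jimg A B c) (\<lambda>z. M c z i \<alpha> \<beta>)"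
  and smooth_N: "c \<in> A \<times> B \<Longrightarrow> smooth_on (jimg A B c) (\<lambda>z. N c z i \<alpha> j)"
  using nonlinear_connection unfolding nonlinear_connection_def by blast+

lemma ct_pd_jtrans:
  assumes c: "c \<in> A \<times> B" and d: "d \<in> A \<times> B" and e: "e \<in> jdom A B c" "e \<in> jdom A B d"
  shows "pd (\<lambda>u. ct (jtrans A B c d u) \<mu>) v (jcoord c e) = ct (pd (jtrans A B c d) v (jcoord c e)) \<mu>"
    and "pd (\<lambda>u. cx (jtrans A B c d u) m) v (jcoord c e) = cx (pd (jtrans A B c d) v (jcoord c e)) m"
    and "pd (\<lambda>u. cy (jtrans A B c d u) m \<mu>) v (jcoord c e) = cy (pd (jtrans A B c d) v (jcoord c e)) m \<mu>"
  using pd_linear_compose[OF bounded_linear_ct jtrans_differentiable[OF c d e]]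
    pd_linear_compose[OF bounded_linear_cx jtrans_differentiable[OF c d e]]
    pd_linear_compose[OF bounded_linear_cy jtrans_differentiable[OF c d e]] by blast+

lemma ct_pd_jtrans_eq_0:
  assumes c: "c \<in> A \<times> B" and d: "d \<in> A \<times> B" and e: "e \<in> jdom A B c" "e \<in> jdom A B d"
  shows "(\<And>\<mu>. ct v \<mu> = 0) \<Longrightarrow> ct (pd (jtrans A B c d) v (jcoord c e)) \<mu> = 0"
    and "(\<And>m. cx v m = 0) \<Longrightarrow> cx (pd (jtrans A B c d) v (jcoord c e)) m = 0"
proof -
  have z: "jcoord c e \<in> ovl c d" using jcoord_in_ovl e by blast
  then have in1: "fst (jcoord c e) \<in> ovT c d" "fst (snd (jcoord c e)) \<in> ovM c d"
    using ovl_eq[OF c, of d] by auto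
  note dT = smooth_on_differentiable[OF smooth_on_trT[OF c d] in1(1)]
    and dM = smooth_on_differentiable[OF smooth_on_trM[OF c d] in1(2)]
  show "ct (pd (jtrans A B c d) v (jcoord c e)) \<mu> = 0" if "\<And>\<mu>. ct v \<mu> = 0"
  proof -
    have "fst v = 0" using that by (simp add: ct_def vec_eq_iff)
    then show ?thesis by (simp add: ct_def fst_pd_jtrans[OF c d e] dT)
  qed
  show "cx (pd (jtrans A B c d) v (jcoord c e)) m = 0" if "\<And>m. cx v m = 0"
  proof -
    have "fst (snd v) = 0" using that by (simp add: cx_def vec_eq_iff)
    then show ?thesis by (simp add: cx_def fst_pd_jtrans[OF c d e] dM)
  qed
qed

text \<open>The transformation rules of the nonlinear connection say exactly that the push-forwards of the
  horizontal frame fields have no vertical component in the new chart.\<close>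

lemma transformation_rules:
  assumes c: "c \<in> A \<times> B" and d: "d \<in> A \<times> B" and e: "e \<in> jdom A B c" "e \<in> jdom A B d"
  defines "J \<equiv> \<lambda>v. pd (jtrans A B c d) v (jcoord c e)"
  shows "(\<Sum>\<mu>\<in>UNIV. M d (jcoord d e) j \<beta> \<mu> * ct (J (et \<alpha>)) \<mu>) =
      (\<Sum>k\<in>UNIV. \<Sum>\<gamma>\<in>UNIV. M c (jcoord c e) k \<gamma> \<alpha> * cy (J (ey k \<gamma>)) j \<beta>) - cy (J (et \<alpha>)) j \<beta>"
    and "(\<Sum>k\<in>UNIV. N d (jcoord d e) j \<beta> k * cx (J (ex i)) k) =
      (\<Sum>k\<in>UNIV. \<Sum>\<gamma>\<in>UNIV. N c (jcoord c e) k \<gamma> i * cy (J (ey k \<gamma>)) j \<beta>) - cy (J (ex i)) j \<beta>"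
proof -
  let ?z = "jcoord c e" and ?w = "jcoord d e" and ?\<phi> = "jtrans A B c d" and ?\<psi> = "jtrans A B d c"
  \<comment> \<open>The product of base Jacobians occurring in both rules is a fibre component of
    the push-forward of a vertical basis vector.\<close>
  have v: "pd (\<lambda>u. cx (?\<phi> u) j) (ex k) ?z * pd (\<lambda>u. ct (?\<psi> u) \<gamma>) (et \<beta>) ?w = cy (J (ey k \<gamma>)) j \<beta>" for j k \<gamma> \<beta>
    unfolding ct_pd_jtrans[OF c d e] ct_pd_jtrans[OF d c e(2,1)] J_def
    by (simp add: cx_def ct_def cy_def cy_pd_jtrans_vertical[OF c d e] fst_pd_jtrans[OF c d e]
        fst_pd_jtrans[OF d c e(2,1)] ex_def et_def)
  have r: "(\<forall>j \<beta> \<alpha>.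
           (\<Sum>\<mu>\<in>UNIV. M d ?w j \<beta> \<mu> * pd (\<lambda>u. ct (?\<phi> u) \<mu>) (et \<alpha>) ?z) =
           (\<Sum>k\<in>UNIV. \<Sum>\<gamma>\<in>UNIV.
              M c ?z k \<gamma> \<alpha> * pd (\<lambda>u. cx (?\<phi> u) j) (ex k) ?z * pd (\<lambda>u. ct (?\<psi> u) \<gamma>) (et \<beta>) ?w)
           - pd (\<lambda>u. cy (?\<phi> u) j \<beta>) (et \<alpha>) ?z) \<and>
        (\<forall>j \<beta> i.
           (\<Sum>k\<in>UNIV. N d ?w j \<beta> k * pd (\<lambda>u. cx (?\<phi> u) k) (ex i) ?z) =
           (\<Sum>k\<in>UNIV. \<Sum>\<gamma>\<in>UNIV.
              N c ?z k \<gamma> i * pd (\<lambda>u. cx (?\<phi> u) j) (ex k) ?z * pd (\<lambda>u. ct (?\<psi> u) \<gamma>) (et \<beta>) ?w)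
           - pd (\<lambda>u. cy (?\<phi> u) j \<beta>) (ex i) ?z)"
    using nonlinear_connection c d e unfolding nonlinear_connection_def Let_def by blast
  show "(\<Sum>\<mu>\<in>UNIV. M d ?w j \<beta> \<mu> * ct (J (et \<alpha>)) \<mu>) =
      (\<Sum>k\<in>UNIV. \<Sum>\<gamma>\<in>UNIV. M c ?z k \<gamma> \<alpha> * cy (J (ey k \<gamma>)) j \<beta>) - cy (J (et \<alpha>)) j \<beta>"
    using conjunct1[OF r, rule_format, of j \<beta> \<alpha>] v
    by (simp only: mult.assoc v) (simp only: ct_pd_jtrans[OF c d e] J_def)
  show "(\<Sum>k\<in>UNIV. N d ?w j \<beta> k * cx (J (ex i)) k) =
      (\<Sum>k\<in>UNIV. \<Sum>\<gamma>\<in>UNIV. N c ?z k \<gamma> i * cy (J (ey k \<gamma>)) j \<beta>) - cy (J (ex i)) j \<beta>"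
    using conjunct2[OF r, rule_format, of j \<beta> i] v
    by (simp only: mult.assoc v) (simp only: ct_pd_jtrans[OF c d e] J_def)
qed

text \<open>Base components vanish because t and x transform separately. In the vertical component
  of a horizontal field, the fibre part of the push-forward and the terms with the coefficients of d
  cancel by the transformation rules.\<close>

lemma coframe_pushforward_frame:
  assumes c: "c \<in> A \<times> B" and d: "d \<in> A \<times> B" and e: "e \<in> jdom A B c" "e \<in> jdom A B d"
    and ab: "kind a \<noteq> kind b"
  shows "coframe (M d) (N d) a (jcoord d e) (pd (jtrans A B c d) (frame (M c) (N c) b (jcoord c e)) (jcoord c e)) = 0"
proof -
  define J where "J v = pd (jtrans A B c d) v (jcoord c e)" for v
  note dj = jtrans_differentiable[OF c d e]
  have J: "J (u - v) = J u - J v" "J (\<Sum>i\<in>I. f i) = (\<Sum>i\<in>I. J (f i))" "J (r *\<^sub>R u) = r *\<^sub>R J u"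
    for u v r I and f :: "'z \<Rightarrow> ('p, 'n) jc"
    by (simp_all add: J_def pd_dir_diff[OF dj] pd_dir_sum[OF dj] pd_dir_scale[OF dj])
  have J2: "J (\<Sum>i\<in>UNIV. \<Sum>j\<in>UNIV. f i j *\<^sub>R g i j) = (\<Sum>i\<in>UNIV. \<Sum>j\<in>UNIV. f i j *\<^sub>R J (g i j))"
    for f and g :: "'n \<Rightarrow> 'p \<Rightarrow> ('p, 'n) jc"
    by (simp add: J_def pd_dir_sum[OF dj] pd_dir_scale[OF dj])
  have z: "ct (J (ex i)) \<mu> = 0" "ct (J (ey k \<gamma>)) \<mu> = 0" "cx (J (et \<alpha>)) m = 0" "cx (J (ey k \<gamma>)) m = 0" for i k \<gamma> \<alpha> \<mu> m
    by (simp_all add: J_def ct_pd_jtrans_eq_0[OF c d e])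
  note r = transformation_rules[OF c d e, folded J_def]
  have "coframe (M d) (N d) a (jcoord d e) (J (frame (M c) (N c) b (jcoord c e))) = 0"
    by (cases a; cases b) (use ab in \<open>simp_all add: J(1) J2 z r\<close>)
  then show ?thesis by (simp add: J_def)
qed

text \<open>Numbers the three projections as \<open>kind\<close> numbers the indices, so that the
  three conditions on nabla are used in one argument.\<close>

definition kproj :: "nat \<Rightarrow> ('t, 'm, 'p, 'n) jchart \<Rightarrow> ('p, 'n) jc \<Rightarrow> ('p, 'n) jc \<Rightarrow> ('p, 'n) jc" where
  "kproj r c = (if r = 0 then proj_hT (M c) (N c) else if r = 1 then proj_hM (M c) (N c) else proj_v (M c) (N c))"

lemma kproj_eq:
  assumes "r < 3"
  shows "kproj r c z v = (\<Sum>a\<in>UNIV. if kind a = r then coframe (M c) (N c) a z v *\<^sub>R frame (M c) (N c) a z else 0)"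
proof -
  have "r = 0 \<or> r = 1 \<or> r = 2" using assms by auto
  then show ?thesis
    by (auto simp: kproj_def sum_idx proj_hT_def proj_hM_def proj_v_def simp del: coframe.simps frame.simps)
qed

lemma kind_less: "kind a < 3"
  by (cases a) auto

lemma kproj_id:
  assumes "\<And>a. kind a \<noteq> r \<Longrightarrow> coframe (M c) (N c) a z v = 0" "r < 3"
  shows "kproj r c z v = v"
proof -
  have "kproj r c z v = (\<Sum>a\<in>UNIV. coframe (M c) (N c) a z v *\<^sub>R frame (M c) (N c) a z)"
    unfolding kproj_eq[OF assms(2)] by (rule sum.cong) (auto simp: assms)
  then show ?thesis by (simp flip: frame_expansion)
qed

lemma coframe_kproj:
  assumes "kind a \<noteq> r" "r < 3"
  shows "coframe (M c) (N c) a z (kproj r c z v) = 0"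
  unfolding kproj_eq[OF assms(2)] coframe_sum
  by (rule sum.neutral) (use assms in \<open>auto simp: coframe_scale coframe_frame coframe_0\<close>)

lemma nabla_kproj:
  assumes YZ: "Y \<in> VF" "Z \<in> VF" and r: "r < 3"
  shows "nabla Y (lift_proj (kproj r) Z) e c = kproj r c (jcoord c e) (nabla Y Z e c)"
proof -
  have "r = 0 \<or> r = 1 \<or> r = 2" using r by auto
  moreover have "kproj 0 = (\<lambda>c. proj_hT (M c) (N c))" "kproj 1 = (\<lambda>c. proj_hM (M c) (N c))"
    "kproj 2 = (\<lambda>c. proj_v (M c) (N c))" by (auto simp: kproj_def)
  ultimately have "nabla_endo nabla (lift_proj (kproj r)) Y Z = (\<lambda>e c. 0)"
    using Gamma_linear YZ unfolding Gamma_linear_connection_def by auto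
  from fun_cong[OF fun_cong[OF this], of e c] show ?thesis
    by (simp add: nabla_endo_def lift_proj_def)
qed

lemma mixed_conn_coeff:
  assumes c: "c \<in> A \<times> B" and z: "z \<in> jimg A B c" and ab: "kind a \<noteq> kind b"
  shows "conn_coeff (M c) (N c) (local_conn A B nabla c) a b k z = 0"
proof -
  let ?U = "jimg A B c" and ?E = "frame (M c) (N c)"
  have sE: "smooth_on ?U (?E b)" for b
    by (rule smooth_on_frame[OF open_jimg[OF c] smooth_M[OF c] smooth_N[OF c]])
  obtain V h where V: "open V" "z \<in> V" "V \<subseteq> ?U"
    and e: "\<And>y. smooth_on ?U y \<Longrightarrow> extend_vf c (\<lambda>z. h z *\<^sub>R y z) \<in> VF"
    "\<And>y z. smooth_on ?U y \<Longrightarrow> z \<in> V \<Longrightarrow> vf_local A B c (extend_vf c (\<lambda>z. h z *\<^sub>R y z)) z = y z"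
    by (rule local_extension[OF c z]) (rule that; assumption)
  define Y where "Y k = extend_vf c (\<lambda>z. h z *\<^sub>R ?E k z)" for k
  have Y: "Y k \<in> VF" for k using e(1)[OF sE] by (simp add: Y_def)
  \<comment> \<open>The conditions on nabla concern global fields, so invariance is needed in every
    chart d: there the extension is a multiple of a pushed-forward frame vector, or zero.\<close>
  have "lift_proj (kproj (kind b)) (Y b) = Y b"
  proof (intro ext)
    fix e d
    show "lift_proj (kproj (kind b)) (Y b) e d = Y b e d"
      unfolding lift_proj_def
    proof (rule kproj_id[OF _ kind_less])
      fix a' :: "('p, 'n) idx" assume a': "kind a' \<noteq> kind b"
      show "coframe (M d) (N d) a' (jcoord d e) (Y b e d) = 0"
        using coframe_pushforward_frame[OF c, of d e a' b] jtrans_differentiable[OF c, of d e] a'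
        by (simp add: Y_def extend_vf_def pd_dir_scale coframe_scale coframe_0 del: split_paired_All)
    qed
  qed
  \<comment> \<open>As nabla commutes with the projection, the derivative of a field fixed by it is
    fixed as well.\<close>
  then have "nabla (Y k) (Y b) (jinv A B c z) c = kproj (kind b) c z (nabla (Y k) (Y b) (jinv A B c z) c)"
    using nabla_kproj[OF Y Y kind_less, of k b b "jinv A B c z" c] z by simp
  then have "coframe (M c) (N c) a z (nabla (Y k) (Y b) (jinv A B c z) c) = 0"
    using coframe_kproj[OF ab kind_less] by metis
  moreover have "local_conn A B nabla c (?E k) (?E b) z = vf_local A B c (nabla (Y k) (Y b)) z"
    by (rule local_conn_eq[OF c sE sE Y Y V]) (simp_all add: Y_def e(2)[OF sE])
  ultimately show ?thesis by (simp add: conn_coeff_def vf_local_def)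
qed

lemma local_d_connection:
  assumes c: "c \<in> A \<times> B"
  shows "local_d_connection (jimg A B c) (M c) (N c) (local_conn A B nabla c)"
proof -
  note 1 = local_conn_add1[OF c _ _ _ _ smooth_on_const] local_conn_scale1[OF c]
    local_conn_add2[OF c _ _ _ _ smooth_on_const] local_conn_leibniz[OF c]
  note 2 = open_jimg[OF c] smooth_M[OF c] smooth_N[OF c] local_conn_smooth[OF c]
    local_conn_cong[OF c] mixed_conn_coeff[OF c]
  show ?thesis
    by unfold_locales (fact 2 | rule 1, assumption+)+
qed

end

theorem theorem4p1:
  fixes T :: "'t topology" and Mf :: "'m topology"
    and A :: "('t, real^'p::finite) chart set" and B :: "('m, real^'n::finite) chart set"
    and M :: "('t, 'm, 'p, 'n) jchart \<Rightarrow> ('p, 'n) Mcoeff"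
    and N :: "('t, 'm, 'p, 'n) jchart \<Rightarrow> ('p, 'n) Ncoeff"
    and nabla :: "('t, 'm, 'p, 'n) vfield \<Rightarrow> ('t, 'm, 'p, 'n) vfield \<Rightarrow> ('t, 'm, 'p, 'n) vfield"
    and X :: "('t, 'm, 'p, 'n) vfield"
    and c :: "('t, 'm, 'p, 'n) jchart" and z :: "('p, 'n) jc"
    and \<alpha> \<beta> \<gamma> :: 'p and i j k :: 'n
  assumes "smooth_manifold T A" and "smooth_manifold Mf B"
    and "nonlinear_connection A B M N"
    and "Gamma_linear_connection A B M N nabla"
    and "X \<in> vector_fields A B"
    and "c \<in> A \<times> B" and "z \<in> jimg A B c"
  shows
    "let D = local_conn A B nabla c;
         K = conn_coeff (M c) (N c) D;
         Curv = curv_coeff (M c) (N c) D;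
         R_tt = tor_Rtt (M c) (N c); R_tx = tor_Rtx (M c) (N c); R_xx = tor_Rxx (M c) (N c);
         Tbar_tt = tor_Tbar_tt (M c) (N c) D; Tbar_tx = tor_Tbar_tx (M c) (N c) D;
         T_tx = tor_T_tx (M c) (N c) D; T_xx = tor_T_xx (M c) (N c) D;
         S = tor_S (M c) (N c) D;
         P_t = tor_Pt (M c) (N c) D; P_x = tor_Px (M c) (N c) D;
         X0 = vf_dtensor (M c) (N c) (vf_local A B c X);
         X1 = cov (M c) (N c) D X0;
         X2 = cov (M c) (N c) D X1
     in
      (X2 [tI \<alpha>] [tI \<beta>, tI \<gamma>] z - X2 [tI \<alpha>] [tI \<gamma>, tI \<beta>] z =
        (\<Sum>\<mu>\<in>UNIV. X0 [tI \<mu>] [] z * Curv (tI \<alpha>) (tI \<mu>) (tI \<beta>) (tI \<gamma>) z)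
        - (\<Sum>\<mu>\<in>UNIV. X1 [tI \<alpha>] [tI \<mu>] z * Tbar_tt \<mu> \<beta> \<gamma> z)
        - (\<Sum>m\<in>UNIV. \<Sum>\<mu>\<in>UNIV. X1 [tI \<alpha>] [yI m \<mu>] z * R_tt m \<mu> \<beta> \<gamma> z)) \<and>
      (X2 [tI \<alpha>] [tI \<beta>, xI k] z - X2 [tI \<alpha>] [xI k, tI \<beta>] z =
        (\<Sum>\<mu>\<in>UNIV. X0 [tI \<mu>] [] z * Curv (tI \<alpha>) (tI \<mu>) (tI \<beta>) (xI k) z)
        - (\<Sum>\<mu>\<in>UNIV. X1 [tI \<alpha>] [tI \<mu>] z * Tbar_tx \<mu> \<beta> k z)
        - (\<Sum>m\<in>UNIV. X1 [tI \<alpha>] [xI m] z * T_tx m \<beta> k z)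
        - (\<Sum>m\<in>UNIV. \<Sum>\<mu>\<in>UNIV. X1 [tI \<alpha>] [yI m \<mu>] z * R_tx m \<mu> \<beta> k z)) \<and>
      (X2 [tI \<alpha>] [xI j, xI k] z - X2 [tI \<alpha>] [xI k, xI j] z =
        (\<Sum>\<mu>\<in>UNIV. X0 [tI \<mu>] [] z * Curv (tI \<alpha>) (tI \<mu>) (xI j) (xI k) z)
        - (\<Sum>m\<in>UNIV. X1 [tI \<alpha>] [xI m] z * T_xx m j k z)
        - (\<Sum>m\<in>UNIV. \<Sum>\<mu>\<in>UNIV. X1 [tI \<alpha>] [yI m \<mu>] z * R_xx m \<mu> j k z)) \<and>
      (X2 [tI \<alpha>] [tI \<beta>, yI k \<gamma>] z - X2 [tI \<alpha>] [yI k \<gamma>, tI \<beta>] z =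
        (\<Sum>\<mu>\<in>UNIV. X0 [tI \<mu>] [] z * Curv (tI \<alpha>) (tI \<mu>) (tI \<beta>) (yI k \<gamma>) z)
        - (\<Sum>\<mu>\<in>UNIV. X1 [tI \<alpha>] [tI \<mu>] z * K (tI \<mu>) (tI \<beta>) (yI k \<gamma>) z)
        - (\<Sum>m\<in>UNIV. \<Sum>\<mu>\<in>UNIV. X1 [tI \<alpha>] [yI m \<mu>] z * P_t m \<mu> \<beta> k \<gamma> z)) \<and>
      (X2 [tI \<alpha>] [xI j, yI k \<gamma>] z - X2 [tI \<alpha>] [yI k \<gamma>, xI j] z =
        (\<Sum>\<mu>\<in>UNIV. X0 [tI \<mu>] [] z * Curv (tI \<alpha>) (tI \<mu>) (xI j) (yI k \<gamma>) z)
        - (\<Sum>m\<in>UNIV. X1 [tI \<alpha>] [xI m] z * K (xI m) (xI j) (yI k \<gamma>) z)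
        - (\<Sum>m\<in>UNIV. \<Sum>\<mu>\<in>UNIV. X1 [tI \<alpha>] [yI m \<mu>] z * P_x m \<mu> j k \<gamma> z)) \<and>
      (X2 [tI \<alpha>] [yI j \<beta>, yI k \<gamma>] z - X2 [tI \<alpha>] [yI k \<gamma>, yI j \<beta>] z =
        (\<Sum>\<mu>\<in>UNIV. X0 [tI \<mu>] [] z * Curv (tI \<alpha>) (tI \<mu>) (yI j \<beta>) (yI k \<gamma>) z)
        - (\<Sum>m\<in>UNIV. \<Sum>\<mu>\<in>UNIV. X1 [tI \<alpha>] [yI m \<mu>] z * S m \<mu> j \<beta> k \<gamma> z)) \<and>
      (X2 [xI i] [tI \<beta>, tI \<gamma>] z - X2 [xI i] [tI \<gamma>, tI \<beta>] z =
        (\<Sum>m\<in>UNIV. X0 [xI m] [] z * Curv (xI i) (xI m) (tI \<beta>) (tI \<gamma>) z)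
        - (\<Sum>\<mu>\<in>UNIV. X1 [xI i] [tI \<mu>] z * Tbar_tt \<mu> \<beta> \<gamma> z)
        - (\<Sum>m\<in>UNIV. \<Sum>\<mu>\<in>UNIV. X1 [xI i] [yI m \<mu>] z * R_tt m \<mu> \<beta> \<gamma> z)) \<and>
      (X2 [xI i] [tI \<beta>, xI k] z - X2 [xI i] [xI k, tI \<beta>] z =
        (\<Sum>m\<in>UNIV. X0 [xI m] [] z * Curv (xI i) (xI m) (tI \<beta>) (xI k) z)
        - (\<Sum>\<mu>\<in>UNIV. X1 [xI i] [tI \<mu>] z * Tbar_tx \<mu> \<beta> k z)
        - (\<Sum>m\<in>UNIV. X1 [xI i] [xI m] z * T_tx m \<beta> k z)
        - (\<Sum>m\<in>UNIV. \<Sum>\<mu>\<in>UNIV. X1 [xI i] [yI m \<mu>] z * R_tx m \<mu> \<beta> k z)) \<and>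
      (X2 [xI i] [xI j, xI k] z - X2 [xI i] [xI k, xI j] z =
        (\<Sum>m\<in>UNIV. X0 [xI m] [] z * Curv (xI i) (xI m) (xI j) (xI k) z)
        - (\<Sum>m\<in>UNIV. X1 [xI i] [xI m] z * T_xx m j k z)
        - (\<Sum>m\<in>UNIV. \<Sum>\<mu>\<in>UNIV. X1 [xI i] [yI m \<mu>] z * R_xx m \<mu> j k z)) \<and>
      (X2 [xI i] [tI \<beta>, yI k \<gamma>] z - X2 [xI i] [yI k \<gamma>, tI \<beta>] z =
        (\<Sum>m\<in>UNIV. X0 [xI m] [] z * Curv (xI i) (xI m) (tI \<beta>) (yI k \<gamma>) z)
        - (\<Sum>\<mu>\<in>UNIV. X1 [xI i] [tI \<mu>] z * K (tI \<mu>) (tI \<beta>) (yI k \<gamma>) z)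
        - (\<Sum>m\<in>UNIV. \<Sum>\<mu>\<in>UNIV. X1 [xI i] [yI m \<mu>] z * P_t m \<mu> \<beta> k \<gamma> z)) \<and>
      (X2 [xI i] [xI j, yI k \<gamma>] z - X2 [xI i] [yI k \<gamma>, xI j] z =
        (\<Sum>m\<in>UNIV. X0 [xI m] [] z * Curv (xI i) (xI m) (xI j) (yI k \<gamma>) z)
        - (\<Sum>m\<in>UNIV. X1 [xI i] [xI m] z * K (xI m) (xI j) (yI k \<gamma>) z)
        - (\<Sum>m\<in>UNIV. \<Sum>\<mu>\<in>UNIV. X1 [xI i] [yI m \<mu>] z * P_x m \<mu> j k \<gamma> z)) \<and>
      (X2 [xI i] [yI j \<beta>, yI k \<gamma>] z - X2 [xI i] [yI k \<gamma>, yI j \<beta>] z =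
        (\<Sum>m\<in>UNIV. X0 [xI m] [] z * Curv (xI i) (xI m) (yI j \<beta>) (yI k \<gamma>) z)
        - (\<Sum>m\<in>UNIV. \<Sum>\<mu>\<in>UNIV. X1 [xI i] [yI m \<mu>] z * S m \<mu> j \<beta> k \<gamma> z)) \<and>
      (X2 [yI i \<alpha>] [tI \<beta>, tI \<gamma>] z - X2 [yI i \<alpha>] [tI \<gamma>, tI \<beta>] z =
        (\<Sum>m\<in>UNIV. \<Sum>\<mu>\<in>UNIV. X0 [yI m \<mu>] [] z * Curv (yI i \<alpha>) (yI m \<mu>) (tI \<beta>) (tI \<gamma>) z)
        - (\<Sum>\<mu>\<in>UNIV. X1 [yI i \<alpha>] [tI \<mu>] z * Tbar_tt \<mu> \<beta> \<gamma> z)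
        - (\<Sum>m\<in>UNIV. \<Sum>\<mu>\<in>UNIV. X1 [yI i \<alpha>] [yI m \<mu>] z * R_tt m \<mu> \<beta> \<gamma> z)) \<and>
      (X2 [yI i \<alpha>] [tI \<beta>, xI k] z - X2 [yI i \<alpha>] [xI k, tI \<beta>] z =
        (\<Sum>m\<in>UNIV. \<Sum>\<mu>\<in>UNIV. X0 [yI m \<mu>] [] z * Curv (yI i \<alpha>) (yI m \<mu>) (tI \<beta>) (xI k) z)
        - (\<Sum>\<mu>\<in>UNIV. X1 [yI i \<alpha>] [tI \<mu>] z * Tbar_tx \<mu> \<beta> k z)
        - (\<Sum>m\<in>UNIV. X1 [yI i \<alpha>] [xI m] z * T_tx m \<beta> k z)
        - (\<Sum>m\<in>UNIV. \<Sum>\<mu>\<in>UNIV. X1 [yI i \<alpha>] [yI m \<mu>] z * R_tx m \<mu> \<beta> k z)) \<and>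
      (X2 [yI i \<alpha>] [xI j, xI k] z - X2 [yI i \<alpha>] [xI k, xI j] z =
        (\<Sum>m\<in>UNIV. \<Sum>\<mu>\<in>UNIV. X0 [yI m \<mu>] [] z * Curv (yI i \<alpha>) (yI m \<mu>) (xI j) (xI k) z)
        - (\<Sum>m\<in>UNIV. X1 [yI i \<alpha>] [xI m] z * T_xx m j k z)
        - (\<Sum>m\<in>UNIV. \<Sum>\<mu>\<in>UNIV. X1 [yI i \<alpha>] [yI m \<mu>] z * R_xx m \<mu> j k z)) \<and>
      (X2 [yI i \<alpha>] [tI \<beta>, yI k \<gamma>] z - X2 [yI i \<alpha>] [yI k \<gamma>, tI \<beta>] z =
        (\<Sum>m\<in>UNIV. \<Sum>\<mu>\<in>UNIV. X0 [yI m \<mu>] [] z * Curv (yI i \<alpha>) (yI m \<mu>) (tI \<beta>) (yI k \<gamma>) z)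
        - (\<Sum>\<mu>\<in>UNIV. X1 [yI i \<alpha>] [tI \<mu>] z * K (tI \<mu>) (tI \<beta>) (yI k \<gamma>) z)
        - (\<Sum>m\<in>UNIV. \<Sum>\<mu>\<in>UNIV. X1 [yI i \<alpha>] [yI m \<mu>] z * P_t m \<mu> \<beta> k \<gamma> z)) \<and>
      (X2 [yI i \<alpha>] [xI j, yI k \<gamma>] z - X2 [yI i \<alpha>] [yI k \<gamma>, xI j] z =
        (\<Sum>m\<in>UNIV. \<Sum>\<mu>\<in>UNIV. X0 [yI m \<mu>] [] z * Curv (yI i \<alpha>) (yI m \<mu>) (xI j) (yI k \<gamma>) z)
        - (\<Sum>m\<in>UNIV. X1 [yI i \<alpha>] [xI m] z * K (xI m) (xI j) (yI k \<gamma>) z)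
        - (\<Sum>m\<in>UNIV. \<Sum>\<mu>\<in>UNIV. X1 [yI i \<alpha>] [yI m \<mu>] z * P_x m \<mu> j k \<gamma> z)) \<and>
      (X2 [yI i \<alpha>] [yI j \<beta>, yI k \<gamma>] z - X2 [yI i \<alpha>] [yI k \<gamma>, yI j \<beta>] z =
        (\<Sum>m\<in>UNIV. \<Sum>\<mu>\<in>UNIV. X0 [yI m \<mu>] [] z * Curv (yI i \<alpha>) (yI m \<mu>) (yI j \<beta>) (yI k \<gamma>) z)
        - (\<Sum>m\<in>UNIV. \<Sum>\<mu>\<in>UNIV. X1 [yI i \<alpha>] [yI m \<mu>] z * S m \<mu> j \<beta> k \<gamma> z))"
proof -
  interpret gamma_connection T Mf A B nabla M N
    using assms(1-4) by unfold_locales (simp_all add: Gamma_linear_connection_def)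
  interpret local_d_connection "jimg A B c" "M c" "N c" "local_conn A B nabla c"
    by (rule local_d_connection[OF assms(6)])
  note r = ricci_kind[OF vf_smooth[OF assms(5,6)] assms(7)]
  \<comment> \<open>The kind of the contravariant index selects the curvature sum, and the zero
    entries of \<open>Tor_eq\<close> delete the torsion sums absent from the individual
    identities.\<close>
  show ?thesis
    unfolding Let_def by (simp only: r ksum.simps Tor_eq[OF assms(7)]) simp
qed

end
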